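(* Let $H\supseteq\mathbb{R}$ be a Liouville closed Hardy field with $H$-couple $(\Gamma,\psi)$ over $\mathbb{R}$. Suppose $\beta$, an element of an extension $(\Gamma^*,\psi^* )$ of $(\Gamma,\psi)$, has countable type over $\Gamma$ and falls under Case (b), witnessed by sequences $(\alpha_i)$ in $\Gamma$ and $(\beta_i)$ in $\Gamma^*$, and that $\beta_i^\dagger<0$ for all $i$. Then there exists a nonzero $y$ in a Hardy field extension of $H$ such that $vy$ realizes the same cut in $\Gamma$ as $\beta$, i.e. for all $\gamma\in\Gamma$: $vy<\gamma\iff\beta<\gamma$.
   Context: A Hardy field is a subfield of the ring of germs at $+\infty$ of real differentiable functions closed under differentiation, ordered by eventual comparison; $H\supseteq\mathbb{R}$ is Liouville closed if it is real closed and for each $f\in H$ contains $\exp f$ and some $g$ with $g'=f$. The valuation $v$ on a Hardy field has valuation ring the convex hull of $\mathbb{Z}$ ($vf>vg$ iff $f/g$ infinitesimal); value groups of extensions of $H$ contain $\Gamma=v(H^\times)$. $\Gamma$ is an ordered $\mathbb{R}$-vector space with $c\cdot vf=vg$ whenever $c f'/f=g'/g$, and $\psi(vf)=v(f'/f)$ for $vf\ne0$. An $H$-couple over $\mathbb{R}$ is an ordered $\mathbb{R}$-vector space with $\psi:\Gamma\setminus\{0\}\to\Gamma$ (write $\alpha^\dagger=\psi(\alpha)$) such that for nonzero $\alpha,\beta$: $\alpha+\beta\ne0\Rightarrow\psi(\alpha+\beta)\ge\min(\psi\alpha,\psi\beta)$; $\alpha>0\Rightarrow\alpha+\psi(\alpha)>\psi(\beta)$;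 $|\alpha|\le c|\beta|$ for some real $c>0$ implies $\psi(\alpha)\ge\psi(\beta)$. An extension is an $H$-couple over $\mathbb{R}$ containing $\Gamma$ as an ordered subspace with $\psi^*$ extending $\psi$. $\beta$ has countable type over $\Gamma$ if $\beta\notin\Gamma$ and $\{\gamma\in\Gamma:\gamma<\beta\}$ has cofinality $\le\omega$ and $\{\gamma\in\Gamma:\gamma>\beta\}$ has coinitiality $\le\omega$. Let $\Gamma\langle\beta\rangle$ be the smallest $\mathbb{R}$-subspace of $\Gamma^*$ containing $\Gamma\cup\{\beta\}$ and closed under $\psi^*$. $\beta$ falls under Case (b) if there are a sequence $(\alpha_i)$ in $\Gamma$ and a sequence $(\beta_i)$ in $\Gamma^*$, $\mathbb{R}$-linearly independent over $\Gamma$, with $\beta_0=\beta-\alpha_0$, $\beta_{i+1}=\beta_i^\dagger-\alpha_{i+1}$ for all $i$, and $\Gamma\langle\beta\rangle=\Gamma\oplus\bigoplus_{i}\mathbb{R}\beta_i$. *)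

theory Defs
  imports "HOL-Analysis.Analysis" "HOL-Computational_Algebra.Polynomial"
begin

section \<open>Germs at infinity\<close>

quotient_type germ = "real \<Rightarrow> real" / "\<lambda>f g. eventually (\<lambda>x. f x = g x) at_top"
proof (rule equivpI)
  show "reflp (\<lambda>f g :: real \<Rightarrow> real. \<forall>\<^sub>F x in at_top. f x = g x)"
    by (auto simp: reflp_def)
  show "symp (\<lambda>f g :: real \<Rightarrow> real. \<forall>\<^sub>F x in at_top. f x = g x)"
    by (auto simp: symp_def eq_commute)
  show "transp (\<lambda>f g :: real \<Rightarrow> real. \<forall>\<^sub>F x in at_top. f x = g x)"
    unfolding transp_def by (auto elim: eventually_elim2)
qed

instantiation germ :: "{real_algebra_1, comm_ring_1, inverse, order}"
begin

lift_definition zero_germ :: germ is "\<lambda>_. 0" .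
lift_definition one_germ :: germ is "\<lambda>_. 1" .
lift_definition plus_germ :: "germ \<Rightarrow> germ \<Rightarrow> germ" is "\<lambda>f g x. f x + g x"
  by (auto elim: eventually_elim2)
lift_definition minus_germ :: "germ \<Rightarrow> germ \<Rightarrow> germ" is "\<lambda>f g x. f x - g x"
  by (auto elim: eventually_elim2)
lift_definition uminus_germ :: "germ \<Rightarrow> germ" is "\<lambda>f x. - f x"
  by (auto elim: eventually_mono)
lift_definition times_germ :: "germ \<Rightarrow> germ \<Rightarrow> germ" is "\<lambda>f g x. f x * g x"
  by (auto elim: eventually_elim2)
lift_definition scaleR_germ :: "real \<Rightarrow> germ \<Rightarrow> germ" is "\<lambda>c f x. c * f x"
  by (auto elim: eventually_mono)
lift_definition inverse_germ :: "germ \<Rightarrow> germ" is "\<lambda>f x. inverse (f x)"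
  by (auto elim: eventually_mono)
lift_definition divide_germ :: "germ \<Rightarrow> germ \<Rightarrow> germ" is "\<lambda>f g x. f x / g x"
  by (auto elim: eventually_elim2)
lift_definition less_eq_germ :: "germ \<Rightarrow> germ \<Rightarrow> bool" is "\<lambda>f g. \<forall>\<^sub>F x in at_top. f x \<le> g x"
proof -
  fix f f' g g' :: "real \<Rightarrow> real"
  assume "\<forall>\<^sub>F x in at_top. f x = f' x" "\<forall>\<^sub>F x in at_top. g x = g' x"
  then have "\<forall>\<^sub>F x in at_top. f x \<le> g x \<longleftrightarrow> f' x \<le> g' x"
    by (auto elim: eventually_elim2)
  then show "(\<forall>\<^sub>F x in at_top. f x \<le> g x) = (\<forall>\<^sub>F x in at_top. f' x \<le> g' x)"
    by (rule eventually_subst)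
qed
definition less_germ :: "germ \<Rightarrow> germ \<Rightarrow> bool" where
  "less_germ f g \<longleftrightarrow> f \<le> g \<and> \<not> g \<le> f"

instance
proof
  show "(0::germ) \<noteq> 1" by transfer simp
  show "x \<le> y \<Longrightarrow> y \<le> z \<Longrightarrow> x \<le> z" for x y z :: germ
    by transfer (auto elim: eventually_elim2)
  show "x \<le> y \<Longrightarrow> y \<le> x \<Longrightarrow> x = y" for x y :: germ
    by transfer (auto elim: eventually_elim2)
qed (simp add: less_germ_def; fail | transfer, simp add: algebra_simps; fail)+

end

lemma germ_eventually_nhds:
  fixes f g :: "real \<Rightarrow> real"
  assumes "\<forall>\<^sub>F x in at_top. f x = g x"
  shows "\<forall>\<^sub>F x in at_top. \<forall>\<^sub>F y in nhds x. f y = g y"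
proof -
  obtain N where N: "\<And>x. x > N \<Longrightarrow> f x = g x"
    using assms by (auto simp: eventually_at_top_dense)
  have "\<forall>\<^sub>F y in nhds x. f y = g y" if "x > N" for x
    unfolding eventually_nhds using that N by (intro exI[of _ "{N<..}"]) auto
  then show ?thesis by (auto simp: eventually_at_top_dense)
qed

lift_definition germ_differentiable :: "germ \<Rightarrow> bool"
  is "\<lambda>f. \<forall>\<^sub>F x in at_top. f differentiable at x"
proof -
  fix f g :: "real \<Rightarrow> real"
  assume "\<forall>\<^sub>F x in at_top. f x = g x"
  then have "\<forall>\<^sub>F x in at_top. f differentiable at x \<longleftrightarrow> g differentiable at x"
    by (rule eventually_mono[OF germ_eventually_nhds])
      (auto simp: real_differentiable_def DERIV_cong_ev)
  then show "(\<forall>\<^sub>F x in at_top. f differentiable at x) = (\<forall>\<^sub>F x in at_top. g differentiable at x)"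
    by (rule eventually_subst)
qed

lift_definition germ_deriv :: "germ \<Rightarrow> germ" is deriv
  by (rule eventually_mono[OF germ_eventually_nhds]) (auto intro: deriv_cong_ev)

lift_definition germ_exp :: "germ \<Rightarrow> germ" is "\<lambda>f x. exp (f x)"
  by (auto elim: eventually_mono)

definition germ_dlog :: "germ \<Rightarrow> germ" where
  "germ_dlog f = germ_deriv f / f"


section \<open>Hardy fields\<close>

definition hardy_field :: "germ set \<Rightarrow> bool" where
  "hardy_field K \<longleftrightarrow>
     0 \<in> K \<and> 1 \<in> K \<and>
     (\<forall>f\<in>K. \<forall>g\<in>K. f + g \<in> K \<and> f - g \<in> K \<and> f * g \<in> K) \<and>
     (\<forall>f\<in>K. f \<noteq> 0 \<longrightarrow> (\<exists>g\<in>K. f * g = 1)) \<and>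
     (\<forall>f\<in>K. germ_differentiable f \<and> germ_deriv f \<in> K)"

text \<open>For a Hardy field the order inherited from \<^typ>\<open>germ\<close> (eventual comparison) is
  total, see \<open>hardy_field_total\<close> below.\<close>

definition real_closed :: "germ set \<Rightarrow> bool" where
  "real_closed K \<longleftrightarrow>
     (\<forall>f\<in>K. 0 \<le> f \<longrightarrow> (\<exists>g\<in>K. g ^ 2 = f)) \<and>
     (\<forall>p :: germ poly. range (coeff p) \<subseteq> K \<and> odd (degree p) \<longrightarrow> (\<exists>g\<in>K. poly p g = 0))"

definition Liouville_closed :: "germ set \<Rightarrow> bool" where
  "Liouville_closed H \<longleftrightarrow>
     hardy_field H \<and> \<real> \<subseteq> H \<and> real_closed H \<and>
     (\<forall>f\<in>H. germ_exp f \<in> H \<and> (\<exists>g\<in>H. germ_deriv g = f))"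


section \<open>The valuation\<close>

text \<open>The convex hull of the integers in \<open>K\<close>.\<close>

definition valuation_ring :: "germ set \<Rightarrow> germ set" where
  "valuation_ring K = {f \<in> K. \<exists>m\<in>\<int>. \<exists>n\<in>\<int>. m \<le> f \<and> f \<le> n}"

definition dominated :: "germ \<Rightarrow> germ \<Rightarrow> bool" where
  "dominated f g \<longleftrightarrow> (\<exists>u\<in>valuation_ring UNIV. f = u * g)"

lemma valuation_ring_UNIV_iff:
  "u \<in> valuation_ring UNIV \<longleftrightarrow> (\<exists>c. - of_real c \<le> u \<and> u \<le> of_real c)"
proof
  assume "u \<in> valuation_ring UNIV"
  then obtain m n :: int where u: "of_int m \<le> u" "u \<le> of_int n"
    by (auto simp: valuation_ring_def Ints_def)
  have le: "of_real x \<le> (of_real y :: germ)" if "x \<le> y" for x y :: real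
    using that unfolding of_real_def by transfer simp
  let ?c = "real_of_int (max (- m) n)"
  have "- of_real ?c \<le> u"
    using order_trans[OF le[of "- ?c" "of_int m"]] u by simp
  moreover have "u \<le> of_real ?c"
    using order_trans[OF _ le[of "of_int n" ?c]] u by simp
  ultimately show "\<exists>c. - of_real c \<le> u \<and> u \<le> of_real c" by blast
next
  assume "\<exists>c. - of_real c \<le> u \<and> u \<le> of_real c"
  then obtain c where u: "- of_real c \<le> u" "u \<le> of_real c" by blast
  have le: "of_real x \<le> (of_real y :: germ)" if "x \<le> y" for x y :: real
    using that unfolding of_real_def by transfer simp
  have "of_int (- \<lceil>c\<rceil>) \<le> u"
    using order_trans[OF le[of "of_int (- \<lceil>c\<rceil>)" "- c"]] u by simp
  moreover have "u \<le> of_int \<lceil>c\<rceil>"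
    using order_trans[OF _ le[of c "of_int \<lceil>c\<rceil>"]] u by simp
  ultimately show "u \<in> valuation_ring UNIV"
    unfolding valuation_ring_def using Ints_of_int by blast
qed

lemma valuation_ring_UNIV_mult:
  assumes "u \<in> valuation_ring UNIV" "w \<in> valuation_ring UNIV"
  shows "u * w \<in> valuation_ring UNIV"
proof -
  obtain c d where "- of_real c \<le> u" "u \<le> of_real c" "- of_real d \<le> w" "w \<le> of_real d"
    using assms by (auto simp: valuation_ring_UNIV_iff)
  then have "- of_real (c * d) \<le> u * w \<and> u * w \<le> of_real (c * d)"
    unfolding of_real_def
  proof transfer
    fix c d :: real and u w :: "real \<Rightarrow> real"
    assume "\<forall>\<^sub>F x in at_top. - (c * 1) \<le> u x" "\<forall>\<^sub>F x in at_top. u x \<le> c * 1"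
      "\<forall>\<^sub>F x in at_top. - (d * 1) \<le> w x" "\<forall>\<^sub>F x in at_top. w x \<le> d * 1"
    then have "\<forall>\<^sub>F x in at_top. \<bar>u x * w x\<bar> \<le> c * d"
      by eventually_elim (auto simp: abs_mult intro!: mult_mono)
    then show "(\<forall>\<^sub>F x in at_top. - (c * d * 1) \<le> u x * w x) \<and>
        (\<forall>\<^sub>F x in at_top. u x * w x \<le> c * d * 1)"
      by (auto elim!: eventually_mono)
  qed
  then show ?thesis unfolding valuation_ring_UNIV_iff by blast
qed

lemma dominated_refl: "dominated f f"
  unfolding dominated_def valuation_ring_def
  by (intro bexI[of _ 1]) (auto intro!: bexI[of _ 1])

lemma dominated_trans: "dominated f g \<Longrightarrow> dominated g h \<Longrightarrow> dominated f h"
  unfolding dominated_def using valuation_ring_UNIV_mult by (metis mult.assoc)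

lemma dominated_mult: "dominated f f' \<Longrightarrow> dominated g g' \<Longrightarrow> dominated (f * g) (f' * g')"
  unfolding dominated_def using valuation_ring_UNIV_mult
  by (metis mult.assoc mult.left_commute)

text \<open>Values of germs: for nonzero elements \<open>f\<close> and \<open>g\<close> of a Hardy field \<open>K\<close> we have
  \<open>germ_val f = germ_val g\<close> iff \<open>f / g\<close> is a unit of the valuation ring of \<open>K\<close>.  The quotient
  is taken over all germs, so that the value group of a Hardy field is literally contained in
  that of each Hardy field extension.  The class of the zero germ plays the role of infinity.
  On all of \<^typ>\<open>germ\<close> the order on values is only partial; see
  \<open>germ_val_le_iff\<close> and \<open>germ_val_less_iff\<close> for its meaning in a Hardy field.\<close>

quotient_type gval = germ / "\<lambda>f g. dominated f g \<and> dominated g f"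
  by (rule equivpI) (auto simp: reflp_def symp_def transp_def dominated_refl intro: dominated_trans)

instantiation gval :: "{comm_monoid_add, order}"
begin

lift_definition zero_gval :: gval is 1 .
lift_definition plus_gval :: "gval \<Rightarrow> gval \<Rightarrow> gval" is "(*)"
  by (auto intro: dominated_mult)
lift_definition less_eq_gval :: "gval \<Rightarrow> gval \<Rightarrow> bool" is "\<lambda>f g. dominated g f"
  by (auto intro: dominated_trans)
definition less_gval :: "gval \<Rightarrow> gval \<Rightarrow> bool" where
  "less_gval a b \<longleftrightarrow> a \<le> b \<and> \<not> b \<le> a"

instance
proof
  show "a + b + c = a + (b + c)" for a b c :: gval
    by transfer (simp add: mult.assoc dominated_refl)
  show "a + b = b + a" for a b :: gval
    by transfer (simp add: mult.commute dominated_refl)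
  show "0 + a = a" for a :: gval
    by transfer (simp add: dominated_refl)
  show "a \<le> a" for a :: gval by transfer (rule dominated_refl)
  show "a \<le> b \<Longrightarrow> b \<le> c \<Longrightarrow> a \<le> c" for a b c :: gval
    by transfer (rule dominated_trans)
  show "a \<le> b \<Longrightarrow> b \<le> a \<Longrightarrow> a = b" for a b :: gval by transfer simp
qed (simp add: less_gval_def)

end

definition germ_val :: "germ \<Rightarrow> gval" where
  "germ_val = abs_gval"

lemma germ_val_eq_iff: "germ_val f = germ_val g \<longleftrightarrow> dominated f g \<and> dominated g f"
  unfolding germ_val_def by (rule gval.abs_eq_iff)

lemma germ_val_le_iff_dominated: "germ_val g \<le> germ_val f \<longleftrightarrow> dominated f g"
  unfolding germ_val_def by (rule less_eq_gval.abs_eq)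

lemma germ_val_one: "germ_val 1 = 0"
  unfolding germ_val_def zero_gval_def ..

lemma germ_val_mult: "germ_val (f * g) = germ_val f + germ_val g"
  unfolding germ_val_def by (rule plus_gval.abs_eq[symmetric])

definition value_group :: "germ set \<Rightarrow> gval set" where
  "value_group K = germ_val ` (K - {0})"

lemma value_group_mono: "H \<subseteq> K \<Longrightarrow> value_group H \<subseteq> value_group K"
  by (auto simp: value_group_def)

lemma hardy_field_inverse:
  assumes K: "hardy_field K" and f: "f \<in> K" "f \<noteq> 0"
  shows "inverse f \<in> K" "f * inverse f = 1" "\<And>g. g / f = g * inverse f"
proof -
  obtain g where g: "g \<in> K" "f * g = 1" using K f by (auto simp: hardy_field_def)
  have "f * g = 1 \<Longrightarrow> inverse f = g"
    by transfer (auto elim!: eventually_mono intro: inverse_unique)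
  with g show "inverse f \<in> K" "f * inverse f = 1" by auto
  show "h / f = h * inverse f" for h
    by transfer (simp add: divide_inverse)
qed

lemma hardy_field_sign:
  assumes K: "hardy_field K" and f: "f \<in> K"
  shows "0 \<le> f \<or> f \<le> 0"
proof (cases "f = 0")
  case False
  with assms obtain g where g: "f * g = 1" by (auto simp: hardy_field_def)
  have d: "germ_differentiable f" using assms by (auto simp: hardy_field_def)
  from d g show ?thesis
  proof transfer
    fix f g :: "real \<Rightarrow> real"
    assume "\<forall>\<^sub>F x in at_top. f differentiable at x" "\<forall>\<^sub>F x in at_top. f x * g x = 1"
    then have "\<forall>\<^sub>F x in at_top. f differentiable at x \<and> f x \<noteq> 0"
      by eventually_elim auto
    then obtain N where N: "\<And>x. x > N \<Longrightarrow> f differentiable at x \<and> f x \<noteq> 0"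
      by (auto simp: eventually_at_top_dense)
    have "continuous_on {N<..} f"
      using N by (auto intro!: continuous_at_imp_continuous_on differentiable_imp_continuous_within)
    then have "connected (f ` {N<..})" by (intro connected_continuous_image) auto
    then have iv: "0 \<in> f ` {N<..}" if "f x \<le> 0" "0 \<le> f y" "x > N" "y > N" for x y
      using that connectedD_interval[of "f ` {N<..}" "f x" "f y" 0] by auto
    have "(\<forall>x>N. 0 \<le> f x) \<or> (\<forall>x>N. f x \<le> 0)"
      using iv N by (smt (verit) imageE greaterThan_iff)
    then show "(\<forall>\<^sub>F x in at_top. 0 \<le> f x) \<or> (\<forall>\<^sub>F x in at_top. f x \<le> 0)"
      by (auto simp: eventually_at_top_dense)
  qed
qed simp

lemma hardy_field_total:
  assumes K: "hardy_field K" and "f \<in> K" "g \<in> K"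
  shows "f \<le> g \<or> g \<le> f"
proof -
  have "f - g \<in> K" using assms by (auto simp: hardy_field_def)
  moreover have "0 \<le> f - g \<Longrightarrow> g \<le> f" "f - g \<le> 0 \<Longrightarrow> f \<le> g"
    by (transfer, simp)+
  ultimately show ?thesis using hardy_field_sign[OF K] by blast
qed

lemma dominated_iff:
  assumes K: "hardy_field K" and g: "g \<in> K" "g \<noteq> 0"
  shows "dominated f g \<longleftrightarrow> f / g \<in> valuation_ring UNIV"
proof -
  note inv = hardy_field_inverse[OF K g]
  have "f = u * g \<longleftrightarrow> u = f / g" for u
    unfolding inv(3) using inv(2) by (metis mult.assoc mult.commute mult_1)
  then show ?thesis by (auto simp: dominated_def)
qed

lemma germ_val_le_iff:
  assumes K: "hardy_field K" and "f \<in> K" "g \<in> K" "g \<noteq> 0"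
  shows "germ_val g \<le> germ_val f \<longleftrightarrow> f / g \<in> valuation_ring K"
proof -
  have "f / g \<in> K"
    using assms hardy_field_inverse[OF K, of g] by (auto simp: hardy_field_def)
  then show ?thesis
    using dominated_iff[OF K] assms by (auto simp: germ_val_le_iff_dominated valuation_ring_def)
qed

lemma germ_val_less_iff:
  assumes K: "hardy_field K" "\<real> \<subseteq> K" and f: "f \<in> K" "f \<noteq> 0" and g: "g \<in> K" "g \<noteq> 0"
  shows "germ_val g < germ_val f \<longleftrightarrow> (\<forall>\<epsilon>>0. - of_real \<epsilon> \<le> f / g \<and> f / g \<le> of_real \<epsilon>)"
proof -
  let ?O = "valuation_ring UNIV"
  have less: "germ_val g < germ_val f \<longleftrightarrow> f / g \<in> ?O \<and> g / f \<notin> ?O"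
    unfolding less_gval_def using dominated_iff[OF K(1)] f g
    by (auto simp: germ_val_le_iff_dominated)
  note invf = hardy_field_inverse[OF K(1) f] and invg = hardy_field_inverse[OF K(1) g]
  have h: "f / g \<in> K" using f invg K by (auto simp: hardy_field_def)
  have prod1: "(f / g) * (g / f) = 1"
    unfolding invf(3) invg(3) using invf(2) invg(2)
    by (metis (no_types, opaque_lifting) mult.assoc mult.commute mult_1)
  show ?thesis unfolding less
  proof safe
    fix \<epsilon> :: real assume \<epsilon>: "\<epsilon> > 0" and n: "g / f \<notin> ?O"
    have reals: "of_real x \<in> K" for x using K(2) by auto
    have "- of_real \<epsilon> \<in> K" using reals[of "- \<epsilon>"] by simp
    have bound: "\<bar>k\<bar> \<le> 1 / \<epsilon>" if hk: "h * k = 1" and "\<epsilon> \<le> h \<or> h \<le> - \<epsilon>" for h k :: real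
    proof -
      have "\<epsilon> * \<bar>k\<bar> \<le> \<bar>h\<bar> * \<bar>k\<bar>" using that(2) by (intro mult_right_mono) auto
      also have "\<dots> = 1" using hk by (simp add: abs_mult[symmetric])
      finally show ?thesis using \<epsilon> by (simp add: pos_le_divide_eq mult.commute)
    qed
    have no1: "\<not> of_real \<epsilon> \<le> f / g"
    proof
      assume "of_real \<epsilon> \<le> f / g"
      with prod1 have "- of_real (1 / \<epsilon>) \<le> g / f \<and> g / f \<le> of_real (1 / \<epsilon>)"
        unfolding of_real_def
      proof (transfer fixing: \<epsilon>)
        fix f g :: "real \<Rightarrow> real"
        assume "\<forall>\<^sub>F x in at_top. f x / g x * (g x / f x) = 1" "\<forall>\<^sub>F x in at_top. \<epsilon> * 1 \<le> f x / g x"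
        then have "\<forall>\<^sub>F x in at_top. \<bar>g x / f x\<bar> \<le> 1 / \<epsilon>"
        proof eventually_elim
          case (elim x)
          show ?case by (rule bound[OF elim(1)]) (use elim(2) in simp)
        qed
        then show "(\<forall>\<^sub>F x in at_top. - (1 / \<epsilon> * 1) \<le> g x / f x) \<and> (\<forall>\<^sub>F x in at_top. g x / f x \<le> 1 / \<epsilon> * 1)"
          by (auto simp del: abs_divide elim!: eventually_mono)
      qed
      with n show False unfolding valuation_ring_UNIV_iff by blast
    qed
    have no2: "\<not> f / g \<le> - of_real \<epsilon>"
    proof
      assume "f / g \<le> - of_real \<epsilon>"
      with prod1 have "- of_real (1 / \<epsilon>) \<le> g / f \<and> g / f \<le> of_real (1 / \<epsilon>)"
        unfolding of_real_def
      proof (transfer fixing: \<epsilon>)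
        fix f g :: "real \<Rightarrow> real"
        assume "\<forall>\<^sub>F x in at_top. f x / g x * (g x / f x) = 1" "\<forall>\<^sub>F x in at_top. f x / g x \<le> - (\<epsilon> * 1)"
        then have "\<forall>\<^sub>F x in at_top. \<bar>g x / f x\<bar> \<le> 1 / \<epsilon>"
        proof eventually_elim
          case (elim x)
          show ?case by (rule bound[OF elim(1)]) (use elim(2) in simp)
        qed
        then show "(\<forall>\<^sub>F x in at_top. - (1 / \<epsilon> * 1) \<le> g x / f x) \<and> (\<forall>\<^sub>F x in at_top. g x / f x \<le> 1 / \<epsilon> * 1)"
          by (auto simp del: abs_divide elim!: eventually_mono)
      qed
      with n show False unfolding valuation_ring_UNIV_iff by blast
    qed
    show "- of_real \<epsilon> \<le> f / g" "f / g \<le> of_real \<epsilon>"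
      using no1 no2 hardy_field_total[OF K(1) h] reals \<open>- of_real \<epsilon> \<in> K\<close> by blast+
  next
    assume "\<forall>\<epsilon>>0. - of_real \<epsilon> \<le> f / g \<and> f / g \<le> of_real \<epsilon>"
    then show "f / g \<in> ?O" unfolding valuation_ring_UNIV_iff using zero_less_one by blast
  next
    assume inf: "\<forall>\<epsilon>>0. - of_real \<epsilon> \<le> f / g \<and> f / g \<le> of_real \<epsilon>" and "g / f \<in> ?O"
    then obtain c where c: "- of_real c \<le> g / f" "g / f \<le> of_real c"
      by (auto simp: valuation_ring_UNIV_iff)
    define \<epsilon> where "\<epsilon> = 1 / (2 * (\<bar>c\<bar> + 1))"
    have "\<epsilon> > 0" unfolding \<epsilon>_def by auto
    with inf have "- of_real \<epsilon> \<le> f / g" "f / g \<le> of_real \<epsilon>" by auto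
    with c prod1 show False
      unfolding of_real_def
    proof (transfer fixing: \<epsilon> c)
      fix f g :: "real \<Rightarrow> real"
      assume "\<forall>\<^sub>F x in at_top. - (c * 1) \<le> g x / f x" "\<forall>\<^sub>F x in at_top. g x / f x \<le> c * 1"
        "\<forall>\<^sub>F x in at_top. f x / g x * (g x / f x) = 1"
        "\<forall>\<^sub>F x in at_top. - (\<epsilon> * 1) \<le> f x / g x" "\<forall>\<^sub>F x in at_top. f x / g x \<le> \<epsilon> * 1"
      then have "\<forall>\<^sub>F x in at_top :: real filter. False"
      proof eventually_elim
        case (elim x)
        have "\<bar>f x / g x\<bar> * \<bar>g x / f x\<bar> \<le> \<epsilon> * (\<bar>c\<bar> + 1)"
          using elim \<open>\<epsilon> > 0\<close> by (intro mult_mono) auto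
        also have "\<dots> = 1 / 2" unfolding \<epsilon>_def by (simp add: field_simps)
        finally have "\<bar>f x / g x * (g x / f x)\<bar> \<le> 1 / 2" unfolding abs_mult .
        then show False unfolding elim(3) by simp
      qed
      then show False by simp
    qed
  qed
qed


section \<open>H-couples\<close>

class linordered_real_vector = ordered_real_vector + linordered_ab_group_add + abs_if

text \<open>The map \<open>\<psi>\<close> of an H-couple is defined only at nonzero elements; the value of the total
  function \<open>\<psi>\<close> at \<open>0\<close> is irrelevant throughout.\<close>

definition H_couple :: "('g::linordered_real_vector \<Rightarrow> 'g) \<Rightarrow> bool" where
  "H_couple \<psi> \<longleftrightarrow>
     (\<forall>\<alpha> \<beta>. \<alpha> \<noteq> 0 \<longrightarrow> \<beta> \<noteq> 0 \<longrightarrow>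
        (\<alpha> + \<beta> \<noteq> 0 \<longrightarrow> \<psi> (\<alpha> + \<beta>) \<ge> min (\<psi> \<alpha>) (\<psi> \<beta>)) \<and>
        (\<alpha> > 0 \<longrightarrow> \<alpha> + \<psi> \<alpha> > \<psi> \<beta>) \<and>
        ((\<exists>c::real. c > 0 \<and> \<bar>\<alpha>\<bar> \<le> c *\<^sub>R \<bar>\<beta>\<bar>) \<longrightarrow> \<psi> \<alpha> \<ge> \<psi> \<beta>))"

text \<open>\<open>(UNIV :: 'g set, \<psi>)\<close> is an H-couple extending the H-couple of the Hardy field \<open>H\<close>, the
  inclusion being the embedding \<open>\<iota>\<close> of the value group of \<open>H\<close>.  The third and the fourth
  condition say that \<open>\<iota>\<close> respects the scalar multiplication and the map \<open>\<psi>\<close> of the H-couple of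
  \<open>H\<close>, which are given on values by \<open>c \<cdot> v f = v g\<close> whenever \<open>c f'/f = g'/g\<close> and by
  \<open>\<psi> (v f) = v (f'/f)\<close> for \<open>v f \<noteq> 0\<close>.\<close>

definition H_couple_extension ::
    "germ set \<Rightarrow> (gval \<Rightarrow> 'g::linordered_real_vector) \<Rightarrow> ('g \<Rightarrow> 'g) \<Rightarrow> bool" where
  "H_couple_extension H \<iota> \<psi> \<longleftrightarrow>
     H_couple \<psi> \<and>
     (\<forall>\<gamma>\<in>value_group H. \<forall>\<delta>\<in>value_group H.
        \<iota> (\<gamma> + \<delta>) = \<iota> \<gamma> + \<iota> \<delta> \<and> (\<iota> \<gamma> \<le> \<iota> \<delta> \<longleftrightarrow> \<gamma> \<le> \<delta>)) \<and>
     (\<forall>c. \<forall>f\<in>H - {0}. \<forall>g\<in>H - {0}. c *\<^sub>R germ_dlog f = germ_dlog g \<longrightarrow>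
        \<iota> (germ_val g) = c *\<^sub>R \<iota> (germ_val f)) \<and>
     (\<forall>f\<in>H - {0}. germ_val f \<noteq> 0 \<longrightarrow> \<psi> (\<iota> (germ_val f)) = \<iota> (germ_val (germ_dlog f)))"

definition countable_type_over :: "'g::linorder set \<Rightarrow> 'g \<Rightarrow> bool" where
  "countable_type_over G \<beta> \<longleftrightarrow>
     \<beta> \<notin> G \<and>
     (\<exists>C. countable C \<and> C \<subseteq> {\<gamma>\<in>G. \<gamma> < \<beta>} \<and> (\<forall>\<gamma>\<in>G. \<gamma> < \<beta> \<longrightarrow> (\<exists>\<delta>\<in>C. \<gamma> \<le> \<delta>))) \<and>
     (\<exists>C. countable C \<and> C \<subseteq> {\<gamma>\<in>G. \<gamma> > \<beta>} \<and> (\<forall>\<gamma>\<in>G. \<gamma> > \<beta> \<longrightarrow> (\<exists>\<delta>\<in>C. \<delta> \<le> \<gamma>)))"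

definition generated_subspace :: "'g::real_vector set \<Rightarrow> ('g \<Rightarrow> 'g) \<Rightarrow> 'g \<Rightarrow> 'g set" where
  "generated_subspace G \<psi> \<beta> =
     (\<lambda>S. subspace S \<and> (\<forall>\<alpha>\<in>S - {0}. \<psi> \<alpha> \<in> S)) hull (insert \<beta> G)"

definition independent_over :: "'g::real_vector set \<Rightarrow> (nat \<Rightarrow> 'g) \<Rightarrow> bool" where
  "independent_over G b \<longleftrightarrow>
     (\<forall>F c. finite F \<longrightarrow> (\<Sum>i\<in>F. c i *\<^sub>R b i) \<in> G \<longrightarrow> (\<forall>i\<in>F. c i = 0))"

text \<open>The sum of \<open>G\<close> and the lines spanned by the \<open>b i\<close> in the last condition is direct by
  \<open>independent_over G b\<close>.\<close>

definition case_b ::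
    "'g::real_vector set \<Rightarrow> ('g \<Rightarrow> 'g) \<Rightarrow> 'g \<Rightarrow> (nat \<Rightarrow> 'g) \<Rightarrow> (nat \<Rightarrow> 'g) \<Rightarrow> bool" where
  "case_b G \<psi> \<beta> a b \<longleftrightarrow>
     (\<forall>i. a i \<in> G) \<and>
     independent_over G b \<and>
     b 0 = \<beta> - a 0 \<and>
     (\<forall>i. b (Suc i) = \<psi> (b i) - a (Suc i)) \<and>
     generated_subspace G \<psi> \<beta> = {\<gamma> + \<delta> | \<gamma> \<delta>. \<gamma> \<in> G \<and> \<delta> \<in> span (range b)}"

end

theory Submission
  imports Defs
begin

text \<open>Choose \<open>F i > 0\<close> in \<open>H\<close> with value \<open>a i\<close>. Up to signs, a realization \<open>y\<close> of the cut of \<open>\<beta>\<close>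
  should be \<open>W 0\<close> for a sequence of positive functions with \<open>W i' / W i = F i' / F i \<plusminus> W (i + 1)\<close>, where
  \<open>W (i + 1)\<close> lies in the cut of \<open>\<psi> (b i)\<close>. A bound on \<open>W i\<close> by an element of \<open>H\<close> propagates forward in time
  as soon as \<open>W (i + 1)\<close> satisfies a suitable bound by another element of \<open>H\<close>, and so does
  \<open>W i \<ge> 4 W (i + 1)\<close>. Since the cuts are countable, one can therefore solve for \<open>W\<close> in stages: from the
  time \<open>t N\<close> to \<open>t (N + 1)\<close> the level \<open>W N\<close> is a prescribed function satisfying the first finitely many
  bounds, and the lower levels are obtained by integration. A jump of \<open>W N\<close> at the end of a stage does
  not hurt, because \<open>W i\<close> is differentiable from some time on. Finally, as \<open>\<psi> (b i) < 0\<close>, the logarithmic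
  derivative of a nontrivial monomial in the \<open>W i\<close> over \<open>H\<close> is bounded away from \<open>0\<close>. So distinct
  monomials are never of the same order of magnitude, no nontrivial polynomial in the \<open>W i\<close> over \<open>H\<close>
  has zeros at arbitrarily large arguments, and \<open>H(W 0, W 1, \<dots>)\<close> is a Hardy field.\<close>

section \<open>Ladders of logarithmic derivatives\<close>

text \<open>The equations determine each level from the next one only, so an infinite ladder has no
  top from which to integrate; prescribing level N during stage N supplies a temporary one. A
  constraint on one level is protected by a constraint on the next, so a single bound on
  \<open>W 0\<close> already needs bounds on all levels, and each of these acts only from its own
  time on. Hence only finitely many are imposed at a time, and a newly imposed one is reached rather
  than prescribed: the logarithm of the quotient of level and bound moves with slope at least 1 in
  the wanted direction. Cut conditions alone do not separate consecutive levels, since no element of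
  H need lie between them. This is why a factor 4 between levels is carried along; afterwards it
  improves to a ratio tending to infinity. If the cut of \<open>\<psi> (b 0)\<close> lies below the
  whole value group, the levels outgrow all of H, and the prescribed functions cannot be taken from
  H. Countability then gives a cofinal sequence in H, and a smooth function with controlled
  derivative that dominates it takes over.\<close>

lemma eventually_at_topE:
  fixes P :: "real \<Rightarrow> bool"
  assumes "\<forall>\<^sub>F x in at_top. P x"
  obtains T where "\<And>x. T \<le> x \<Longrightarrow> P x"
  using assms unfolding eventually_at_top_linorder by blast

section \<open>Linear equations of first order and comparison of their solutions\<close>

definition exp_primitive :: "real \<Rightarrow> real \<Rightarrow> (real \<Rightarrow> real) \<Rightarrow> real \<Rightarrow> real" where
  "exp_primitive v t g x = v * exp (integral {t..x} g)"

lemma exp_primitive_initial: "exp_primitive v t g t = v"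
  by (simp add: exp_primitive_def)

lemma exp_primitive_pos: "0 < v \<Longrightarrow> 0 < exp_primitive v t g x"
  by (simp add: exp_primitive_def)

lemma integral_has_real_derivative_atLeast:
  fixes g :: "real \<Rightarrow> real"
  assumes g: "continuous_on {t..} g" and x: "t \<le> x"
  shows "((\<lambda>x. integral {t..x} g) has_real_derivative g x) (at x within {t..})"
proof -
  have "continuous_on {t..x + 1} g" using g by (rule continuous_on_subset) auto
  then have "((\<lambda>x. integral {t..x} g) has_real_derivative g x) (at x within {t..x + 1})"
    using x by (intro integral_has_real_derivative) auto
  moreover have "at x within {t..x + 1} = at x within {t..}"
    by (rule at_within_nhd[of x "{..<x + 1}"]) auto
  ultimately show ?thesis by simp
qed

lemma exp_primitive_has_derivative:
  assumes g: "continuous_on {t..} g" and x: "t \<le> x"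
  shows "(exp_primitive v t g has_real_derivative exp_primitive v t g x * g x) (at x within {t..})"
  unfolding exp_primitive_def [abs_def]
  by (rule derivative_eq_intros integral_has_real_derivative_atLeast[OF g x] refl | simp)+

lemma exp_primitive_continuous:
  assumes "continuous_on {t..} g"
  shows "continuous_on {t..} (exp_primitive v t g)"
  unfolding continuous_on_eq_continuous_within
  using exp_primitive_has_derivative[OF assms] DERIV_isCont
  by (metis atLeast_iff has_field_derivative_imp_has_derivative has_derivative_continuous)

lemma slope_lower_bound:
  fixes f f' :: "real \<Rightarrow> real"
  assumes f: "\<And>x. t \<le> x \<Longrightarrow> (f has_real_derivative f' x) (at x within {t..})"
    and f': "\<And>x. t \<le> x \<Longrightarrow> \<rho> \<le> f' x" and x: "t \<le> x"
  shows "f t + \<rho> * (x - t) \<le> f x"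
proof -
  let ?g = "\<lambda>x. f x - \<rho> * x"
  have "?g t \<le> ?g x"
  proof (rule DERIV_nonneg_imp_increasing_open[OF x])
    fix s assume s: "t < s" "s < x"
    have "at s within {t..} = at s"
      by (rule at_within_interior) (use s in \<open>simp add: interior_Ici\<close>)
    then have "(f has_real_derivative f' s) (at s)" using f[of s] s by simp
    then have "(?g has_real_derivative f' s - \<rho>) (at s)"
      by (auto intro!: derivative_eq_intros)
    then show "\<exists>y. (?g has_real_derivative y) (at s) \<and> 0 \<le> y"
      using f'[of s] s by (intro exI[of _ "f' s - \<rho>"]) simp
  next
    have "continuous_on {t..} f"
      unfolding continuous_on_eq_continuous_within using f
      by (metis atLeast_iff has_field_derivative_imp_has_derivative has_derivative_continuous)
    then have "continuous_on {t..x} f" by (rule continuous_on_subset) auto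
    then show "continuous_on {t..x} ?g" by (intro continuous_intros)
  qed
  then show ?thesis by (simp add: algebra_simps)
qed

text \<open>The derivative of \<open>ln u - ln h\<close> is \<open>A - B\<close>. With
  \<open>\<rho> = 0\<close> a side on which \<open>u\<close> starts relative to \<open>h\<close> is
  kept; with \<open>\<rho> = 1\<close> the right side is eventually reached from any initial value.
  Here \<open>h\<close> is a bound from H or another level of the ladder.\<close>

lemma log_ratio_lower_bound:
  fixes u h A B :: "real \<Rightarrow> real"
  assumes u: "\<And>x. t \<le> x \<Longrightarrow> 0 < u x \<and> (u has_real_derivative u x * A x) (at x within {t..})"
    and h: "\<And>x. t \<le> x \<Longrightarrow> 0 < h x \<and> (h has_real_derivative h x * B x) (at x within {t..})"
    and AB: "\<And>x. t \<le> x \<Longrightarrow> \<rho> \<le> \<sigma> * (A x - B x)" and x: "t \<le> x"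
  shows "\<sigma> * (ln (u t) - ln (h t)) + \<rho> * (x - t) \<le> \<sigma> * (ln (u x) - ln (h x))"
proof (rule slope_lower_bound[OF _ AB x, where f = "\<lambda>x. \<sigma> * (ln (u x) - ln (h x))"])
  fix s assume s: "t \<le> s"
  note d = u[OF s] h[OF s]
  show "((\<lambda>x. \<sigma> * (ln (u x) - ln (h x))) has_real_derivative \<sigma> * (A s - B s)) (at s within {t..})"
    using d by (auto intro!: derivative_eq_intros simp: field_simps)
qed

lemma sign_ln_diff_pos_iff:
  fixes u h \<sigma> :: real
  assumes "0 < u" "0 < h" "\<sigma> \<in> {1, - 1}"
  shows "0 < \<sigma> * (ln u - ln h) \<longleftrightarrow> 0 < \<sigma> * (u - h)"
  using assms by auto

text \<open>Level \<open>i\<close> of a ladder has logarithmic derivative \<open>\<phi> i + \<epsilon> i * w (Suc i)\<close>. A pair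
  \<open>(\<sigma>, h)\<close> in \<open>S N i\<close> is a strip constraint \<open>w i > h\<close> or \<open>w i < h\<close>, according to the sign
  \<open>\<sigma>\<close>, which has to hold from stage \<open>N\<close> on. In stage \<open>N\<close> the level \<open>N\<close> is taken to be \<open>Z N\<close>,
  which determines the lower levels up to initial values.\<close>

locale ladder =
  fixes \<phi> :: "nat \<Rightarrow> real \<Rightarrow> real" and \<epsilon> :: "nat \<Rightarrow> real" and Z :: "nat \<Rightarrow> real \<Rightarrow> real"
    and S :: "nat \<Rightarrow> nat \<Rightarrow> (real \<times> (real \<Rightarrow> real)) set"
  assumes fin: "finite (S N i)"
    and mono_S: "S N i \<subseteq> S (Suc N) i"
    and sign: "(\<sigma>, h) \<in> S N i \<Longrightarrow> \<sigma> \<in> {1, - 1}"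
    and regular: "(\<sigma>, h) \<in> S N i \<Longrightarrow>
      \<forall>\<^sub>F x in at_top. 0 < h x \<and> (h has_real_derivative deriv h x) (at x)"
    and \<phi>_cont: "\<forall>\<^sub>F x in at_top. isCont (\<phi> i) x"
    and transfer_strip: "(\<sigma>, h) \<in> S N i \<Longrightarrow>
      \<forall>\<^sub>F x in at_top. \<forall>w>0. (\<forall>(\<sigma>', h')\<in>S N (Suc i). 0 < \<sigma>' * (w - h' x)) \<longrightarrow>
        1 \<le> \<sigma> * (\<phi> i x + \<epsilon> i * w - deriv h x / h x)"
    and Z_regular: "\<forall>\<^sub>F x in at_top. 0 < Z i x \<and> (Z i has_real_derivative deriv (Z i) x) (at x)"
    and Z_strip: "(\<sigma>, h) \<in> S N N \<Longrightarrow> \<forall>\<^sub>F x in at_top. 0 < \<sigma> * (Z N x - h x)"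
    and ratio: "(\<exists>k. \<forall>N. (1, \<lambda>x. 4 * k x) \<in> S N i \<and> (- 1, k) \<in> S N (Suc i)) \<or>
      \<epsilon> i = 1 \<and> (\<exists>g. (\<forall>N. (1, g) \<in> S N (Suc i)) \<and>
         (\<forall>\<^sub>F x in at_top. 4 * \<bar>\<phi> i x\<bar> + 4 * \<bar>\<phi> (Suc i) x\<bar> + 4 \<le> g x)) \<and>
       (\<forall>\<^sub>F x in at_top. deriv (Z (Suc i)) x \<le> Z (Suc i) x * (Z (Suc i) x / 4)) \<and>
       (\<forall>\<^sub>F x in at_top. 4 * Z (Suc i) x \<le> Z i x) \<and> \<epsilon> (Suc i) \<in> {1, - 1}"
begin

section \<open>A single stage of the construction and the passage to the next one\<close>

definition trajectory :: "nat \<Rightarrow> real \<Rightarrow> (nat \<Rightarrow> real \<Rightarrow> real) \<Rightarrow> bool" where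
  "trajectory N t V \<longleftrightarrow>
     (\<forall>x\<ge>t. V N x = Z N x \<and> (\<forall>i\<le>N. 0 < V i x) \<and>
       (\<forall>i<N. (V i has_real_derivative V i x * (\<phi> i x + \<epsilon> i * V (Suc i) x)) (at x within {t..})))"

text \<open>The constraints in \<open>S (N - 1)\<close> hold during the whole stage, those in
  \<open>S N\<close> only from some time on. The next stage starts after that time and can therefore
  keep the latter throughout. For \<open>N = 0\<close> the condition with \<open>N - 1\<close>
  ranges over no level.\<close>

definition stage :: "nat \<Rightarrow> real \<Rightarrow> (nat \<Rightarrow> real \<Rightarrow> real) \<Rightarrow> bool" where
  "stage N t V \<longleftrightarrow> trajectory N t V \<and>
     (\<forall>x\<ge>t. \<forall>i<N. 4 * V (Suc i) x \<le> V i x \<and> (\<forall>(\<sigma>, h)\<in>S (N - 1) i. 0 < \<sigma> * (V i x - h x))) \<and>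
     (\<forall>\<^sub>F x in at_top. \<forall>i\<le>N. \<forall>(\<sigma>, h)\<in>S N i. 0 < \<sigma> * (V i x - h x))"

text \<open>The recursion counts the distance \<open>k\<close> from the top, so
  \<open>descend t v N k\<close> is level \<open>Suc N - k\<close>.\<close>

primrec descend :: "real \<Rightarrow> (nat \<Rightarrow> real) \<Rightarrow> nat \<Rightarrow> nat \<Rightarrow> real \<Rightarrow> real" where
  "descend t v N 0 = Z (Suc N)"
| "descend t v N (Suc k) =
     exp_primitive (v (N - k)) t (\<lambda>x. \<phi> (N - k) x + \<epsilon> (N - k) * descend t v N k x)"

text \<open>Below a prescribed top level every level solves a homogeneous linear equation whose
  coefficient is already known and continuous. The solutions therefore exist for all times and stay
  positive.\<close>

lemma trajectory_exists:
  assumes v: "\<And>i. i \<le> N \<Longrightarrow> 0 < v i"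
    and \<phi>: "\<And>i x. i \<le> N \<Longrightarrow> t \<le> x \<Longrightarrow> isCont (\<phi> i) x"
    and Z: "\<And>x. t \<le> x \<Longrightarrow> 0 < Z (Suc N) x \<and> isCont (Z (Suc N)) x"
  shows "\<exists>V. trajectory (Suc N) t V \<and> (\<forall>i\<le>N. V i t = v i)"
proof -
  have cont: "continuous_on {t..} (descend t v N k)" if "k \<le> Suc N" for k
    using that
  proof (induction k)
    case 0
    then show ?case using Z by (auto intro!: continuous_at_imp_continuous_on)
  next
    case (Suc k)
    have "continuous_on {t..} (\<phi> (N - k))"
      using \<phi> by (auto intro!: continuous_at_imp_continuous_on)
    then show ?case
      using Suc by (auto intro!: exp_primitive_continuous continuous_intros)
  qed
  define V where "V i = descend t v N (Suc N - i)" for i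
  have V: "V i = exp_primitive (v i) t (\<lambda>x. \<phi> i x + \<epsilon> i * V (Suc i) x)" if "i \<le> N" for i
    using that by (simp add: V_def Suc_diff_le)
  have c: "continuous_on {t..} (\<lambda>x. \<phi> i x + \<epsilon> i * V (Suc i) x)" if "i \<le> N" for i
  proof (intro continuous_intros)
    show "continuous_on {t..} (\<phi> i)"
      using \<phi> that by (auto intro!: continuous_at_imp_continuous_on)
    show "continuous_on {t..} (V (Suc i))" unfolding V_def by (rule cont) simp
  qed
  have top: "V (Suc N) = Z (Suc N)" by (simp add: V_def)
  show ?thesis
  proof (intro exI[of _ V] conjI allI impI)
    show "V i t = v i" if "i \<le> N" for i
      by (subst V[OF that]) (rule exp_primitive_initial)
    have pos: "0 < V i x" if "i \<le> Suc N" "t \<le> x" for i x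
    proof (cases "i = Suc N")
      case False
      then have i: "i \<le> N" using that by simp
      show ?thesis by (subst V[OF i]) (rule exp_primitive_pos[OF v[OF i]])
    qed (use Z that top in auto)
    have "(V i has_real_derivative V i x * (\<phi> i x + \<epsilon> i * V (Suc i) x)) (at x within {t..})"
      if "i \<le> N" "t \<le> x" for i x
      using exp_primitive_has_derivative[OF c[OF that(1)] that(2), of "v i"]
      unfolding V[OF that(1), symmetric] .
    then show "trajectory (Suc N) t V"
      unfolding trajectory_def using top pos by auto
  qed
qed

text \<open>After a late enough restart, level \<open>Suc N\<close> is prescribed by
  \<open>Z (Suc N)\<close> and the old levels continue from their current values. Everything is
  proved from the top level downwards, because control of a level needs control of the next
  one.\<close>

lemma stage_step:
  assumes st: "stage N t V"
  shows "\<exists>t' V'. t + 1 \<le> t' \<and> stage (Suc N) t' V' \<and> (\<forall>i\<le>N. V' i t' = V i t')"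
proof -
  have "\<forall>\<^sub>F x in at_top. \<forall>i\<in>{..N}. isCont (\<phi> i) x"
    by (rule eventually_ball_finite) (auto intro: \<phi>_cont)
  then obtain T1 where T1: "\<And>x. T1 \<le> x \<Longrightarrow> \<forall>i\<in>{..N}. isCont (\<phi> i) x"
    by (rule eventually_at_topE) blast
  have "\<forall>\<^sub>F x in at_top. \<forall>i\<in>{..Suc N}. \<forall>p\<in>S (Suc N) i.
      0 < snd p x \<and> (snd p has_real_derivative deriv (snd p) x) (at x)"
    by (intro eventually_ball_finite ballI fin) (auto intro: regular)
  then obtain T2 where T2: "\<And>x. T2 \<le> x \<Longrightarrow> \<forall>i\<in>{..Suc N}. \<forall>p\<in>S (Suc N) i.
      0 < snd p x \<and> (snd p has_real_derivative deriv (snd p) x) (at x)"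
    by (rule eventually_at_topE) blast
  have "\<forall>\<^sub>F x in at_top. \<forall>M\<in>{N, Suc N}. \<forall>i\<in>{..N}. \<forall>p\<in>S M i. \<forall>w>0.
      (\<forall>(\<sigma>', h')\<in>S M (Suc i). 0 < \<sigma>' * (w - h' x)) \<longrightarrow>
        1 \<le> fst p * (\<phi> i x + \<epsilon> i * w - deriv (snd p) x / snd p x)"
    by (intro eventually_ball_finite ballI fin) (auto intro!: transfer_strip)
  then obtain T3 where T3: "\<And>x. T3 \<le> x \<Longrightarrow> \<forall>M\<in>{N, Suc N}. \<forall>i\<in>{..N}. \<forall>p\<in>S M i. \<forall>w>0.
      (\<forall>(\<sigma>', h')\<in>S M (Suc i). 0 < \<sigma>' * (w - h' x)) \<longrightarrow>
        1 \<le> fst p * (\<phi> i x + \<epsilon> i * w - deriv (snd p) x / snd p x)"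
    by (rule eventually_at_topE) blast
  have "\<forall>\<^sub>F x in at_top. \<forall>p\<in>S (Suc N) (Suc N). 0 < fst p * (Z (Suc N) x - snd p x)"
    by (intro eventually_ball_finite ballI fin) (auto intro: Z_strip)
  then obtain T4 where T4: "\<And>x. T4 \<le> x \<Longrightarrow>
      \<forall>p\<in>S (Suc N) (Suc N). 0 < fst p * (Z (Suc N) x - snd p x)"
    by (rule eventually_at_topE) blast
  have "\<forall>\<^sub>F x in at_top. \<forall>i\<le>N. \<forall>(\<sigma>, h)\<in>S N i. 0 < \<sigma> * (V i x - h x)"
    using st by (simp add: stage_def)
  then obtain T5 where T5: "\<And>x. T5 \<le> x \<Longrightarrow> \<forall>i\<le>N. \<forall>(\<sigma>, h)\<in>S N i. 0 < \<sigma> * (V i x - h x)"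
    by (rule eventually_at_topE) blast
  \<comment> \<open>The alternatives of \<open>ratio\<close> read at a single time, so that they
    become one eventual property per level.\<close>
  define R where "R i x \<longleftrightarrow> (\<exists>k. \<forall>N. (1, \<lambda>x. 4 * k x) \<in> S N i \<and> (- 1, k) \<in> S N (Suc i)) \<or>
      \<epsilon> i = 1 \<and> (\<exists>g. (\<forall>N. (1, g) \<in> S N (Suc i)) \<and>
         4 * \<bar>\<phi> i x\<bar> + 4 * \<bar>\<phi> (Suc i) x\<bar> + 4 \<le> g x) \<and>
       deriv (Z (Suc i)) x \<le> Z (Suc i) x * (Z (Suc i) x / 4) \<and>
       4 * Z (Suc i) x \<le> Z i x \<and> \<epsilon> (Suc i) \<in> {1, - 1}" for i x
  have "\<forall>\<^sub>F x in at_top. R i x" for i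
    using ratio[of i]
  proof (elim disjE conjE exE)
    fix g assume g: "\<forall>N. (1, g) \<in> S N (Suc i)" "\<epsilon> i = 1" "\<epsilon> (Suc i) \<in> {1, - 1}"
      and ev: "\<forall>\<^sub>F x in at_top. 4 * \<bar>\<phi> i x\<bar> + 4 * \<bar>\<phi> (Suc i) x\<bar> + 4 \<le> g x"
        "\<forall>\<^sub>F x in at_top. deriv (Z (Suc i)) x \<le> Z (Suc i) x * (Z (Suc i) x / 4)"
        "\<forall>\<^sub>F x in at_top. 4 * Z (Suc i) x \<le> Z i x"
    from ev show ?thesis
    proof eventually_elim
      case (elim x)
      then show ?case using g unfolding R_def by blast
    qed
  next
    fix k assume "\<forall>N. (1, \<lambda>x. 4 * k x) \<in> S N i \<and> (- 1, k) \<in> S N (Suc i)"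
    then show ?thesis unfolding R_def by (intro always_eventually) blast
  qed
  then have "\<forall>\<^sub>F x in at_top. \<forall>i\<in>{..N}. R i x"
    by (intro eventually_ball_finite) auto
  then obtain T6 where T6: "\<And>x. T6 \<le> x \<Longrightarrow> \<forall>i\<in>{..N}. R i x"
    by (rule eventually_at_topE) blast
  obtain T7 where T7: "\<And>x. T7 \<le> x \<Longrightarrow>
      0 < Z (Suc N) x \<and> (Z (Suc N) has_real_derivative deriv (Z (Suc N)) x) (at x)"
    using Z_regular[of "Suc N"] by (rule eventually_at_topE) blast
  \<comment> \<open>The entry \<open>t + 1\<close> makes the starting times of the stages tend to
    infinity.\<close>
  define t' where "t' = Max {t + 1, T1, T2, T3, T4, T5, T6, T7}"
  have tt': "t + 1 \<le> t'" and T: "T1 \<le> t'" "T2 \<le> t'" "T3 \<le> t'" "T4 \<le> t'" "T5 \<le> t'" "T6 \<le> t'" "T7 \<le> t'"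
    unfolding t'_def by (rule Max_ge; simp)+
  have \<phi>c: "isCont (\<phi> i) x" if "i \<le> N" "t' \<le> x" for i x
    using T1[of x] T that by simp
  have Zpos: "0 < Z (Suc N) x" and
    Zder: "(Z (Suc N) has_real_derivative deriv (Z (Suc N)) x) (at x)" if "t' \<le> x" for x
    using T7[of x] T that by simp_all
  have reg: "0 < h x \<and> (h has_real_derivative deriv h x) (at x)"
    if "(\<sigma>, h) \<in> S (Suc N) i" "i \<le> Suc N" "t' \<le> x" for \<sigma> h i x
  proof -
    have "T2 \<le> x" using T that by linarith
    from bspec[OF bspec[OF T2[OF this], of i] that(1)] that(2) show ?thesis by simp
  qed
  have transfer: "1 \<le> \<sigma> * (\<phi> i x + \<epsilon> i * w - deriv h x / h x)"
    if "M \<in> {N, Suc N}" "i \<le> N" "(\<sigma>, h) \<in> S M i" "t' \<le> x" "0 < w"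
      "\<And>\<sigma>' h'. (\<sigma>', h') \<in> S M (Suc i) \<Longrightarrow> 0 < \<sigma>' * (w - h' x)" for M i \<sigma> h x w
  proof -
    have "T3 \<le> x" using T that by linarith
    then have "\<forall>p\<in>S M i. \<forall>w>0.
      (\<forall>(\<sigma>', h')\<in>S M (Suc i). 0 < \<sigma>' * (w - h' x)) \<longrightarrow>
        1 \<le> fst p * (\<phi> i x + \<epsilon> i * w - deriv (snd p) x / snd p x)"
      using bspec[OF bspec[OF T3 that(1)], of x i] that(2) by simp
    from bspec[OF this that(3)] have "(\<forall>(\<sigma>', h')\<in>S M (Suc i). 0 < \<sigma>' * (w - h' x)) \<longrightarrow>
        1 \<le> \<sigma> * (\<phi> i x + \<epsilon> i * w - deriv h x / h x)"
      using that(5) by simp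
    moreover have "\<forall>(\<sigma>', h')\<in>S M (Suc i). 0 < \<sigma>' * (w - h' x)" using that(6) by blast
    ultimately show ?thesis by (rule mp)
  qed
  have Zs: "0 < \<sigma> * (Z (Suc N) x - h x)" if "(\<sigma>, h) \<in> S (Suc N) (Suc N)" "t' \<le> x" for \<sigma> h x
  proof -
    have "T4 \<le> x" using T that by linarith
    from bspec[OF T4[OF this] that(1)] show ?thesis by simp
  qed
  have Vs: "0 < \<sigma> * (V i x - h x)" if "(\<sigma>, h) \<in> S N i" "t' \<le> x" "i \<le> N" for \<sigma> h x i
  proof -
    have "T5 \<le> x" using T that by linarith
    from T5[OF this, rule_format, OF that(3,1)] show ?thesis by simp
  qed
  have rat: "R i x" if "i \<le> N" "t' \<le> x" for i x
    using T6[of x] T that by simp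
  have Vpos: "0 < V i t'" if "i \<le> N" for i
    using st tt' that by (auto simp: stage_def trajectory_def)
  obtain V' where V': "trajectory (Suc N) t' V'" and init: "\<And>i. i \<le> N \<Longrightarrow> V' i t' = V i t'"
    using trajectory_exists[of N "\<lambda>i. V i t'" t'] Vpos \<phi>c Zpos DERIV_isCont[OF Zder] by blast
  have top: "V' (Suc N) x = Z (Suc N) x" if "t' \<le> x" for x
    using V' that by (auto simp: trajectory_def)
  have pos: "0 < V' i x" if "t' \<le> x" "i \<le> Suc N" for i x
    using V' that by (auto simp: trajectory_def)
  have der: "0 < V' i x \<and>
      (V' i has_real_derivative V' i x * (\<phi> i x + \<epsilon> i * V' (Suc i) x)) (at x within {t'..})"
    if "t' \<le> x" "i \<le> N" for i x
    using V' that by (auto simp: trajectory_def)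
  have hder: "0 < h x \<and> (h has_real_derivative h x * (deriv h x / h x)) (at x within {t'..})"
    if "(\<sigma>, h) \<in> S (Suc N) i" "i \<le> Suc N" "t' \<le> x" for \<sigma> h i x
  proof -
    have "0 < h x" "(h has_real_derivative h x * (deriv h x / h x)) (at x)"
      using reg[OF that] by auto
    then show ?thesis by (blast intro: DERIV_subset)
  qed
  \<comment> \<open>At \<open>t'\<close> the constraint is inherited from the old stage. It persists
    because the constraints on level \<open>Suc i\<close> give the logarithmic derivative of
    \<open>V' i / h\<close> the sign \<open>\<sigma>\<close>.\<close>
  have strip: "\<forall>(\<sigma>, h)\<in>S N i. \<forall>x\<ge>t'. 0 < \<sigma> * (V' i x - h x)" if "i \<le> Suc N" for i
    using that
  proof (induction i rule: inc_induct)
    case base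
    show ?case using Zs mono_S top by fastforce
  next
    case (step i)
    show ?case
    proof (clarify)
      fix \<sigma> h x assume h: "(\<sigma>, h) \<in> S N i" and x: "t' \<le> x"
      have i: "i \<le> N" using step by simp
      have h': "(\<sigma>, h) \<in> S (Suc N) i" using h mono_S by blast
      note dh = hder[OF h' le_SucI[OF i]]
      have "1 \<le> \<sigma> * (\<phi> i s + \<epsilon> i * V' (Suc i) s - deriv h s / h s)" if "t' \<le> s" for s
        by (rule transfer[OF _ i h that]) (use pos[OF that] i step.IH that in auto)
      from log_ratio_lower_bound[OF der[OF _ i] dh this x]
      have "\<sigma> * (ln (V i t') - ln (h t')) \<le> \<sigma> * (ln (V' i x) - ln (h x))"
        using x init[OF i] by simp
      moreover have "0 < \<sigma> * (ln (V i t') - ln (h t'))"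
        using sign_ln_diff_pos_iff Vpos[OF i] dh[of t'] sign[OF h] Vs[OF h] i by simp
      ultimately have "0 < \<sigma> * (ln (V' i x) - ln (h x))" by linarith
      then show "0 < \<sigma> * (V' i x - h x)"
        using sign_ln_diff_pos_iff pos[OF x] dh[OF x] sign[OF h] i by simp
    qed
  qed
  then have strip: "0 < \<sigma> * (V' i x - h x)" if "(\<sigma>, h) \<in> S N i" "t' \<le> x" "i \<le> Suc N" for \<sigma> h x i
    using that by blast
  have ratioV: "4 * V' (Suc i) x \<le> V' i x" if "i \<le> N" "t' \<le> x" for i x
    using that
  proof (induction i arbitrary: x rule: inc_induct)
    case (base x)
    show ?case
    proof (cases "\<exists>k. \<forall>M. (1, \<lambda>x. 4 * k x) \<in> S M N \<and> (- 1, k) \<in> S M (Suc N)")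
      case True
      then obtain k where k: "(1, \<lambda>x. 4 * k x) \<in> S N N" "(- 1, k) \<in> S N (Suc N)" by blast
      then show ?thesis using strip[OF k(1)] strip[OF k(2)] base by fastforce
    next
      case False
      \<comment> \<open>Level \<open>N\<close> starts as \<open>Z N\<close>, which is at least
        \<open>4 * Z (Suc N)\<close>. Both \<open>- \<phi> N\<close> and the logarithmic derivative
        of \<open>Z (Suc N)\<close> are at most a quarter of \<open>V' (Suc N)\<close>, so the
        quotient of the two levels does not decrease.\<close>
      have r: "\<epsilon> N = 1 \<and> V' (Suc N) s / 4 \<ge> \<bar>\<phi> N s\<bar> \<and>
        deriv (Z (Suc N)) s \<le> Z (Suc N) s * (Z (Suc N) s / 4) \<and> 4 * Z (Suc N) s \<le> Z N s"
        if s: "t' \<le> s" for s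
      proof -
        obtain g where "(1, g) \<in> S N (Suc N)" "4 * \<bar>\<phi> N s\<bar> + 4 * \<bar>\<phi> (Suc N) s\<bar> + 4 \<le> g s"
          "\<epsilon> N = 1" "deriv (Z (Suc N)) s \<le> Z (Suc N) s * (Z (Suc N) s / 4)"
            "4 * Z (Suc N) s \<le> Z N s"
          using rat[of N s] False s unfolding R_def by blast
        then show ?thesis using strip[of 1 g "Suc N" s] s by simp
      qed
      have Zd: "0 < Z (Suc N) s \<and> (Z (Suc N) has_real_derivative
          Z (Suc N) s * (deriv (Z (Suc N)) s / Z (Suc N) s)) (at s within {t'..})" if "t' \<le> s" for s
        using Zpos[OF that] DERIV_subset[OF Zder[OF that]] by simp
      have "0 \<le> 1 * (\<phi> N s + \<epsilon> N * V' (Suc N) s - deriv (Z (Suc N)) s / Z (Suc N) s)"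
        if s: "t' \<le> s" for s
      proof -
        have "deriv (Z (Suc N)) s / Z (Suc N) s \<le> V' (Suc N) s / 4"
          using r[OF s] Zpos[OF s] top[OF s] by (simp add: divide_le_eq mult.commute)
        moreover have "- \<phi> N s \<le> V' (Suc N) s / 4" using r[OF s] by linarith
        moreover have "0 < V' (Suc N) s" using pos[OF s] by simp
        ultimately have "deriv (Z (Suc N)) s / Z (Suc N) s \<le> \<phi> N s + V' (Suc N) s" by linarith
        then show ?thesis using r[OF s] by simp
      qed
      from log_ratio_lower_bound[OF der Zd this] base
      have "ln (V N t') - ln (Z (Suc N) t') \<le> ln (V' N x) - ln (Z (Suc N) x)"
        using init by simp
      moreover have "V N t' = Z N t'" using st tt' by (auto simp: stage_def trajectory_def)
      moreover have "ln (4 * Z (Suc N) t') \<le> ln (Z N t')"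
        using r[of t'] Zpos[of t'] by (intro ln_mono) auto
      ultimately have "ln 4 \<le> ln (V' N x) - ln (Z (Suc N) x)"
        using Zpos[of t'] by (simp add: ln_mult)
      then have "ln (4 * Z (Suc N) x) \<le> ln (V' N x)"
        using Zpos[of x] base by (simp add: ln_mult)
      then show ?thesis using pos[of x N] Zpos[of x] base top by simp
    qed
  next
    case (step i x)
    show ?case
    proof (cases "\<exists>k. \<forall>M. (1, \<lambda>x. 4 * k x) \<in> S M i \<and> (- 1, k) \<in> S M (Suc i)")
      case True
      then obtain k where k: "(1, \<lambda>x. 4 * k x) \<in> S N i" "(- 1, k) \<in> S N (Suc i)" by blast
      then show ?thesis using strip[OF k(1), of x] strip[OF k(2), of x] step by fastforce
    next
      case False
      have i: "i \<le> N" "Suc i \<le> N" using step by auto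
      \<comment> \<open>The bound \<open>g\<close> makes
        \<open>\<bar>\<phi> i\<bar> + \<bar>\<phi> (Suc i)\<bar>\<close> less than a quarter of
        \<open>V' (Suc i)\<close>, and the induction hypothesis does the same for
        \<open>V' (Suc (Suc i))\<close> up to equality. Half of \<open>V' (Suc i)\<close>
        remains.\<close>
      have "0 \<le> 1 * (\<phi> i s + \<epsilon> i * V' (Suc i) s - (\<phi> (Suc i) s + \<epsilon> (Suc i) * V' (Suc (Suc i)) s))"
        if s: "t' \<le> s" for s
      proof -
        obtain g where g: "(1, g) \<in> S N (Suc i)" "4 * \<bar>\<phi> i s\<bar> + 4 * \<bar>\<phi> (Suc i) s\<bar> + 4 \<le> g s"
          "\<epsilon> i = 1" "\<epsilon> (Suc i) \<in> {1, - 1}"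
          using rat[OF i(1) s] False unfolding R_def by blast
        have "g s < V' (Suc i) s" using strip[OF g(1) s] i by simp
        moreover have "4 * V' (Suc (Suc i)) s \<le> V' (Suc i) s" using step.IH[OF s] .
        moreover have "0 < V' (Suc (Suc i)) s" using pos[OF s] i by simp
        ultimately show ?thesis using g by (auto simp: abs_if split: if_splits)
      qed
      from log_ratio_lower_bound[OF der[OF _ i(1)] der[OF _ i(2)] this step.prems]
      have "ln (V i t') - ln (V (Suc i) t') \<le> ln (V' i x) - ln (V' (Suc i) x)"
        using init i by simp
      moreover have "4 * V (Suc i) t' \<le> V i t'"
        using st tt' step by (auto simp: stage_def)
      then have "ln (4 * V (Suc i) t') \<le> ln (V i t')"
        using Vpos i by (intro ln_mono) auto
      ultimately have "ln 4 \<le> ln (V' i x) - ln (V' (Suc i) x)"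
        using Vpos[of "Suc i"] i by (simp add: ln_mult)
      then have "ln (4 * V' (Suc i) x) \<le> ln (V' i x)"
        using pos[OF step.prems, of "Suc i"] i by (simp add: ln_mult)
      then show ?thesis using pos[OF step.prems] i by simp
    qed
  qed
  \<comment> \<open>Constraints that are new in \<open>S (Suc N)\<close> may fail at
    \<open>t'\<close>. Once level \<open>Suc i\<close> satisfies its own, the signed logarithm of
    \<open>V' i / h\<close> grows at least with slope 1 from its value \<open>c\<close> at
    \<open>T\<close> and is positive after \<open>T - c\<close>.\<close>
  have evs: "\<forall>(\<sigma>, h)\<in>S (Suc N) i. \<forall>\<^sub>F x in at_top. 0 < \<sigma> * (V' i x - h x)" if "i \<le> Suc N" for i
    using that
  proof (induction i rule: inc_induct)
    case base
    have "\<forall>\<^sub>F x in at_top. 0 < \<sigma> * (V' (Suc N) x - h x)" if "(\<sigma>, h) \<in> S (Suc N) (Suc N)" for \<sigma> h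
      using eventually_ge_at_top[of t'] by eventually_elim (use Zs[OF that] top in simp)
    then show ?case by blast
  next
    case (step i)
    have i: "i \<le> N" using step by simp
    have "\<forall>\<^sub>F x in at_top. \<forall>p\<in>S (Suc N) (Suc i). 0 < fst p * (V' (Suc i) x - snd p x)"
      using step.IH by (intro eventually_ball_finite fin) auto
    then obtain T0 where T0: "\<And>x p. T0 \<le> x \<Longrightarrow> p \<in> S (Suc N) (Suc i) \<Longrightarrow> 0 < fst p * (V' (Suc i) x - snd p x)"
      by (auto simp: eventually_at_top_linorder)
    define T where "T = max T0 t'"
    have T: "T0 \<le> T" "t' \<le> T" by (auto simp: T_def)
    have "\<forall>\<^sub>F x in at_top. 0 < \<sigma> * (V' i x - h x)" if h: "(\<sigma>, h) \<in> S (Suc N) i" for \<sigma> h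
    proof -
      note dh = hder[OF h le_SucI[OF i]]
      have sub: "at x within {T..} \<le> at x within {t'..}" for x using T by (intro at_le) auto
      have A: "1 \<le> \<sigma> * (\<phi> i s + \<epsilon> i * V' (Suc i) s - deriv h s / h s)" if s: "T \<le> s" for s
        by (rule transfer[OF _ i h]) (use s T T0[of s] i pos[of s "Suc i"] in fastforce)+
      have d1: "0 < V' i s \<and> (V' i has_real_derivative V' i s * (\<phi> i s + \<epsilon> i * V' (Suc i) s)) (at s within {T..})"
        if "T \<le> s" for s using der[OF _ i, of s] T that by (auto intro: DERIV_subset)
      have d2: "0 < h s \<and> (h has_real_derivative h s * (deriv h s / h s)) (at s within {T..})"
        if "T \<le> s" for s using dh[of s] T that by (auto intro: DERIV_subset simp del: times_divide_eq_right)
      define c where "c = \<sigma> * (ln (V' i T) - ln (h T))"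
      have "\<forall>\<^sub>F x in at_top. T \<le> x \<and> T - c < x"
        by (intro eventually_conj eventually_ge_at_top eventually_gt_at_top)
      then show ?thesis
      proof eventually_elim
        case (elim x)
        have "c + (x - T) \<le> \<sigma> * (ln (V' i x) - ln (h x))"
          using log_ratio_lower_bound[OF d1 d2 A, of x] elim by (simp add: c_def)
        then have "0 < \<sigma> * (ln (V' i x) - ln (h x))" using elim by simp
        then show ?case
          using sign_ln_diff_pos_iff pos[of x i] dh[of x] sign[OF h] i T elim by simp
      qed
    qed
    then show ?case by blast
  qed
  have "\<forall>\<^sub>F x in at_top. \<forall>i\<in>{..Suc N}. \<forall>p\<in>S (Suc N) i. 0 < fst p * (V' i x - snd p x)"
  proof (intro eventually_ball_finite fin ballI)
    fix i p assume "i \<in> {..Suc N}" "p \<in> S (Suc N) i"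
    then show "\<forall>\<^sub>F x in at_top. 0 < fst p * (V' i x - snd p x)"
      using evs[of i] by (cases p) auto
  qed simp
  then have "\<forall>\<^sub>F x in at_top. \<forall>i\<le>Suc N. \<forall>(\<sigma>, h)\<in>S (Suc N) i. 0 < \<sigma> * (V' i x - h x)"
    by eventually_elim fastforce
  then have "stage (Suc N) t' V'"
    unfolding stage_def using V' strip ratioV by (auto simp: less_Suc_eq_le)
  then show ?thesis using tt' init by blast
qed

section \<open>Gluing the stages to a ladder without top\<close>

theorem ladder_exists:
  "\<exists>w. \<forall>i. (\<forall>\<^sub>F x in at_top. 0 < w i x \<and>
        (w i has_real_derivative w i x * (\<phi> i x + \<epsilon> i * w (Suc i) x)) (at x)) \<and>
      (\<forall>\<^sub>F x in at_top. 4 * w (Suc i) x \<le> w i x) \<and>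
      (\<forall>N. \<forall>(\<sigma>, h)\<in>S N i. \<forall>\<^sub>F x in at_top. 0 < \<sigma> * (w i x - h x))"
proof -
  have "\<exists>p. stage 0 (fst p) (snd p)"
  proof -
    obtain t where t: "\<And>x. t \<le> x \<Longrightarrow> 0 < Z 0 x \<and> (Z 0 has_real_derivative deriv (Z 0) x) (at x)"
      using Z_regular[of 0] by (rule eventually_at_topE) blast
    have "\<forall>\<^sub>F x in at_top. \<forall>p\<in>S 0 0. 0 < fst p * (Z 0 x - snd p x)"
      by (intro eventually_ball_finite ballI fin) (auto intro: Z_strip)
    then have "stage 0 t (\<lambda>_. Z 0)"
      unfolding stage_def trajectory_def using t by (auto simp: case_prod_beta)
    then show ?thesis by (intro exI[of _ "(t, \<lambda>_. Z 0)"]) simp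
  qed
  moreover have "\<exists>p'. stage (Suc N) (fst p') (snd p') \<and>
      (fst p + 1 \<le> fst p' \<and> (\<forall>i\<le>N. snd p' i (fst p') = snd p i (fst p')))"
    if "stage N (fst p) (snd p)" for N p
    using stage_step[OF that] by fastforce
  ultimately obtain p where p: "\<And>N. stage N (fst (p N)) (snd (p N))"
    "\<And>N. fst (p N) + 1 \<le> fst (p (Suc N)) \<and>
      (\<forall>i\<le>N. snd (p (Suc N)) i (fst (p (Suc N))) = snd (p N) i (fst (p (Suc N))))"
    using dependent_nat_choice[of "\<lambda>N p. stage N (fst p) (snd p)"
        "\<lambda>N p p'. fst p + 1 \<le> fst p' \<and> (\<forall>i\<le>N. snd p' i (fst p') = snd p i (fst p'))"]
    by blast
  define t V where "t N = fst (p N)" and "V N = snd (p N)" for N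
  have st: "stage N (t N) (V N)" and t_Suc: "t N + 1 \<le> t (Suc N)"
    and V_Suc: "i \<le> N \<Longrightarrow> V (Suc N) i (t (Suc N)) = V N i (t (Suc N))" for N i
    using p[of N] by (auto simp: t_def V_def)
  have pos: "0 < V N i x" if "i \<le> N" "t N \<le> x" for N i x
    using st that by (auto simp: stage_def trajectory_def)
  have der: "(V N i has_real_derivative V N i x * (\<phi> i x + \<epsilon> i * V N (Suc i) x)) (at x within {t N..})"
    if "i < N" "t N \<le> x" for N i x
    using st that by (auto simp: stage_def trajectory_def)
  have rat: "4 * V N (Suc i) x \<le> V N i x" if "i < N" "t N \<le> x" for N i x
    using st that by (auto simp: stage_def)
  have strip: "0 < \<sigma> * (V N i x - h x)" if "i < N" "t N \<le> x" "(\<sigma>, h) \<in> S (N - 1) i" for N i x \<sigma> h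
    using st[of N] that unfolding stage_def by blast
  have t_mono: "t M \<le> t N" if "M \<le> N" for M N
  proof (rule lift_Suc_mono_le[OF _ that])
    show "t n \<le> t (Suc n)" for n using t_Suc[of n] by simp
  qed
  have t_ge: "t 0 + real N \<le> t N" for N
  proof (induction N)
    case (Suc N)
    then show ?case using t_Suc[of N] by simp
  qed simp
  define ix where "ix x = (LEAST N. x < t (Suc N))" for x
  have ix: "ix x = N" if "t N \<le> x" "x < t (Suc N)" for x N
    unfolding ix_def
  proof (rule Least_equality)
    show "x < t (Suc N)" by (rule that(2))
    fix M assume "x < t (Suc M)"
    then show "N \<le> M" using t_mono[of "Suc M" N] that by (meson not_less not_less_eq_eq order_trans)
  qed
  have ex_ix: "\<exists>N. M \<le> N \<and> t N \<le> x \<and> x < t (Suc N)" if "t M \<le> x" for x M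
  proof -
    obtain n where "x - t 0 < real n" using reals_Archimedean2 by blast
    then have n: "x < t n" using t_ge[of n] by linarith
    define N where "N = (LEAST N. x < t (Suc N))"
    have "x < t (Suc n)" using n t_Suc[of n] by linarith
    then have N: "x < t (Suc N)" unfolding N_def by (rule LeastI)
    have "M \<le> N"
      using N that t_mono[of "Suc N" M] by (meson not_less not_less_eq_eq order_trans)
    moreover have "t N \<le> x"
    proof (cases "N = M")
      case False
      with \<open>M \<le> N\<close> obtain k where k: "N = Suc k" by (metis le_0_eq not0_implies_Suc)
      then have "\<not> x < t (Suc k)" using not_less_Least[of k "\<lambda>N. x < t (Suc N)"] N_def by simp
      then show ?thesis using k by simp
    qed (use that in simp)
    ultimately show ?thesis using N by blast
  qed
  define w where "w i x = V (ix x) i x" for i x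
  have w: "w i x = V N i x" if "t N \<le> x" "x < t (Suc N)" for i x N
    using ix[OF that] by (simp add: w_def)
  have w_left: "w i x = V N i x" if "t N \<le> x" "x \<le> t (Suc N)" "i \<le> N" for i x N
  proof (cases "x = t (Suc N)")
    case True
    have "w i x = V (Suc N) i x" using True t_Suc[of "Suc N"] by (intro w) auto
    then show ?thesis using V_Suc[OF that(3)] True by simp
  qed (use w that in auto)
  \<comment> \<open>At a junction \<open>x = t N\<close> the left derivative comes from stage
    \<open>N - 1\<close>, where level \<open>i\<close> has to lie strictly below the top; hence the
    index \<open>Suc (Suc i)\<close>. Levels \<open>i\<close> and \<open>Suc i\<close> take the same
    values in both stages at \<open>x\<close>, so the one-sided derivatives agree.\<close>
  have main: "0 < w i x \<and> 4 * w (Suc i) x \<le> w i x \<and>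
      (w i has_real_derivative w i x * (\<phi> i x + \<epsilon> i * w (Suc i) x)) (at x)"
    if x: "t (Suc (Suc i)) < x" for i x
  proof -
    obtain N where N: "Suc (Suc i) \<le> N" "t N \<le> x" "x < t (Suc N)"
      using ex_ix[of "Suc (Suc i)" x] x by auto
    then obtain M where M: "N = Suc M" "Suc i \<le> M" by (metis Suc_le_D Suc_le_mono)
    let ?D = "w i x * (\<phi> i x + \<epsilon> i * w (Suc i) x)"
    have wx: "w i x = V N i x" "w (Suc i) x = V N (Suc i) x" using w N by auto
    have right: "(w i has_real_derivative ?D) (at x within {x..})"
    proof (rule has_field_derivative_transform_within)
      show "(V N i has_real_derivative ?D) (at x within {x..})"
        unfolding wx using N by (intro DERIV_subset[OF der]) auto
      show "0 < t (Suc N) - x" using N by simp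
      show "V N i y = w i y" if "y \<in> {x..}" "dist y x < t (Suc N) - x" for y
        using w[of N y i] that N by (auto simp: dist_real_def)
    qed auto
    have left: "(w i has_real_derivative ?D) (at x within {..x})"
    proof (cases "x = t N")
      case False
      then have x': "t N < x" using N by simp
      have at: "(V N i has_real_derivative ?D) (at x)"
        using der[of i N x] N wx at_within_interior[of x "{t N..}"] x' by simp
      show ?thesis
      proof (rule has_field_derivative_transform_within)
        show "(V N i has_real_derivative ?D) (at x within {..x})"
          using at by (rule DERIV_subset) simp
        show "0 < x - t N" using x' by simp
        show "V N i y = w i y" if "y \<in> {..x}" "dist y x < x - t N" for y
          using w[of N y i] that N by (auto simp: dist_real_def)
      qed auto
    next
      case True
      have wM: "w i x = V M i x" "w (Suc i) x = V M (Suc i) x"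
        using w_left[of M x] M True t_Suc[of M] by auto
      have x': "t M < x" using True M t_Suc[of M] by simp
      have at: "(V M i has_real_derivative ?D) (at x)"
        using der[of i M x] M wM at_within_interior[of x "{t M..}"] x' by simp
      show ?thesis
      proof (rule has_field_derivative_transform_within)
        show "(V M i has_real_derivative ?D) (at x within {..x})"
          using at by (rule DERIV_subset) simp
        show "0 < x - t M" using x' by simp
        show "V M i y = w i y" if "y \<in> {..x}" "dist y x < x - t M" for y
          using w_left[of M y i] that M True by (auto simp: dist_real_def)
      qed auto
    qed
    have "{..x} \<union> {x..} = UNIV" by auto
    moreover have "((\<lambda>y. (w i y - w i x) / (y - x)) \<longlongrightarrow> ?D) (at x within {..x} \<union> {x..})"
      using left right unfolding has_field_derivative_iff at_within_union by (rule filterlim_sup)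
    ultimately have "(w i has_real_derivative ?D) (at x)"
      by (simp add: has_field_derivative_iff)
    moreover have "0 < w i x" "4 * w (Suc i) x \<le> w i x"
      unfolding wx using pos[of i N x] rat[of i N x] N by auto
    ultimately show ?thesis by blast
  qed
  \<comment> \<open>Stage \<open>N\<close> keeps the constraints of \<open>S (N - 1)\<close> on the
    levels below \<open>N\<close>, so \<open>N\<close> must exceed both \<open>n\<close> and
    \<open>i\<close>.\<close>
  have strips: "0 < \<sigma> * (w i x - h x)"
    if h: "(\<sigma>, h) \<in> S n i" and x: "t (Suc (max n i)) \<le> x" for \<sigma> h n i x
  proof -
    obtain N where N: "Suc (max n i) \<le> N" "t N \<le> x" "x < t (Suc N)"
      using ex_ix[OF x] by blast
    have "n \<le> N - 1" using N by simp
    then have "S n i \<subseteq> S (N - 1) i"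
      by (rule lift_Suc_mono_le[of "\<lambda>n. S n i", OF mono_S])
    then show ?thesis using strip[of i N x \<sigma> h] w[of N x i] N h by auto
  qed
  have "\<forall>\<^sub>F x in at_top. t (Suc (Suc i)) < x" for i by (rule eventually_gt_at_top)
  then have 1: "\<forall>\<^sub>F x in at_top. 0 < w i x \<and> 4 * w (Suc i) x \<le> w i x \<and>
      (w i has_real_derivative w i x * (\<phi> i x + \<epsilon> i * w (Suc i) x)) (at x)" for i
    by (rule eventually_mono) (rule main)
  have 2: "\<forall>\<^sub>F x in at_top. 0 < \<sigma> * (w i x - h x)" if "(\<sigma>, h) \<in> S n i" for \<sigma> h n i
    using eventually_ge_at_top[of "t (Suc (max n i))"]
    by (rule eventually_mono) (rule strips[OF that])
  show ?thesis
  proof (intro exI[of _ w] allI conjI ballI)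
    show "\<forall>\<^sub>F x in at_top. 0 < w i x \<and>
        (w i has_real_derivative w i x * (\<phi> i x + \<epsilon> i * w (Suc i) x)) (at x)" for i
      using 1[of i] by (rule eventually_mono) blast
    show "\<forall>\<^sub>F x in at_top. 4 * w (Suc i) x \<le> w i x" for i
      using 1[of i] by (rule eventually_mono) blast
    show "case p of (\<sigma>, h) \<Rightarrow> \<forall>\<^sub>F x in at_top. 0 < \<sigma> * (w i x - h x)" if "p \<in> S N i" for i N p
      using 2 that by (cases p) simp
  qed
qed

end

section \<open>Liouville closed Hardy fields as sets of functions\<close>

lemma log_growth:
  fixes f A :: "real \<Rightarrow> real"
  assumes f: "\<forall>\<^sub>F x in at_top. 0 < f x \<and> (f has_real_derivative f x * A x) (at x)"
    and A: "\<forall>\<^sub>F x in at_top. 1 \<le> \<sigma> * A x"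
  shows "filterlim (\<lambda>x. \<sigma> * ln (f x)) at_top at_top"
proof -
  obtain t where t: "\<And>x. t \<le> x \<Longrightarrow> (0 < f x \<and> (f has_real_derivative f x * A x) (at x)) \<and> 1 \<le> \<sigma> * A x"
    using eventually_conj[OF f A] by (rule eventually_at_topE) blast
  have ineq: "\<sigma> * (ln (f t) - ln 1) + 1 * (x - t) \<le> \<sigma> * (ln (f x) - ln 1)" if "t \<le> x" for x
  proof (rule log_ratio_lower_bound[OF _ _ _ that, where A = A and B = "\<lambda>_. 0"])
    fix s assume "t \<le> s"
    from t[OF this] show "0 < f s \<and> (f has_real_derivative f s * A s) (at s within {t..})"
      by (blast intro: DERIV_subset)
    show "1 \<le> \<sigma> * (A s - 0)" using t[OF \<open>t \<le> s\<close>] by simp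
  qed auto
  have "filterlim (\<lambda>x. (\<sigma> * ln (f t) - t) + x) at_top at_top"
    by (rule filterlim_tendsto_add_at_top[OF tendsto_const filterlim_ident])
  moreover have "\<forall>\<^sub>F x in at_top. (\<sigma> * ln (f t) - t) + x \<le> \<sigma> * ln (f x)"
    using eventually_ge_at_top[of t]
  proof eventually_elim
    case (elim x)
    then show ?case using ineq[OF elim] by simp
  qed
  ultimately show ?thesis by (rule filterlim_at_top_mono)
qed

lemma eventually_DERIV_zero_imp_const:
  fixes f :: "real \<Rightarrow> real"
  assumes "\<forall>\<^sub>F x in at_top. (f has_real_derivative 0) (at x)"
  obtains c where "\<forall>\<^sub>F x in at_top. f x = c"
proof -
  obtain t where t: "\<And>x. t \<le> x \<Longrightarrow> (f has_real_derivative 0) (at x)"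
    using assms by (rule eventually_at_topE) blast
  have d: "(f has_real_derivative 0) (at x within {t..})"
    "((\<lambda>x. - f x) has_real_derivative 0) (at x within {t..})" if "t \<le> x" for x
    using DERIV_subset[OF t[OF that]] DERIV_minus[OF DERIV_subset[OF t[OF that]]] by auto
  have "f x = f t" if "t \<le> x" for x
    using slope_lower_bound[OF d(1) _ that, of 0] slope_lower_bound[OF d(2) _ that, of 0] by simp
  then have "\<forall>\<^sub>F x in at_top. f x = f t"
    using eventually_ge_at_top[of t] by (rule eventually_mono[rotated])
  then show ?thesis by (rule that)
qed

definition dlog :: "(real \<Rightarrow> real) \<Rightarrow> real \<Rightarrow> real" where
  "dlog f x = deriv f x / f x"

section \<open>Germs and their representatives\<close>

lemma abs_germ_eq_iff: "abs_germ f = abs_germ g \<longleftrightarrow> (\<forall>\<^sub>F x in at_top. f x = g x)"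
  by (rule germ.abs_eq_iff)

lemma abs_germ_zero_iff: "abs_germ f = 0 \<longleftrightarrow> (\<forall>\<^sub>F x in at_top. f x = 0)"
  unfolding zero_germ_def by (rule abs_germ_eq_iff)

lemma of_real_germ: "of_real c = abs_germ (\<lambda>_. c)"
  unfolding of_real_def one_germ_def by (simp add: scaleR_germ.abs_eq)

lemma germ_exhaust: obtains f where "h = abs_germ f"
proof -
  have "\<exists>f. h = abs_germ f" by (rule germ.abs_induct) blast
  then show ?thesis using that by blast
qed

locale liouville_closed_field =
  fixes H :: "germ set"
  assumes liouville: "Liouville_closed H"
begin

text \<open>All representatives of all elements of H, so that germs can be compared with functions
  outside H, such as the levels of the ladder, by eventual inequalities.\<close>

definition funs :: "(real \<Rightarrow> real) set" where
  "funs = {f. abs_germ f \<in> H}"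

lemma hardy: "hardy_field H"
  using liouville by (simp add: Liouville_closed_def)

lemma funs_cong:
  assumes "f \<in> funs" "\<forall>\<^sub>F x in at_top. f x = g x"
  shows "g \<in> funs"
  using assms abs_germ_eq_iff[of f g] by (simp add: funs_def)

lemma funs_const: "(\<lambda>_. c) \<in> funs"
proof -
  have "of_real c \<in> H" using liouville by (auto simp: Liouville_closed_def)
  then show ?thesis by (simp add: funs_def of_real_germ)
qed

lemma funs_add: "f \<in> funs \<Longrightarrow> g \<in> funs \<Longrightarrow> (\<lambda>x. f x + g x) \<in> funs"
  and funs_diff: "f \<in> funs \<Longrightarrow> g \<in> funs \<Longrightarrow> (\<lambda>x. f x - g x) \<in> funs"
  and funs_mult: "f \<in> funs \<Longrightarrow> g \<in> funs \<Longrightarrow> (\<lambda>x. f x * g x) \<in> funs"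
  using hardy by (auto simp: funs_def hardy_field_def
      plus_germ.abs_eq[symmetric] minus_germ.abs_eq[symmetric] times_germ.abs_eq[symmetric])

lemma funs_uminus: "f \<in> funs \<Longrightarrow> (\<lambda>x. - f x) \<in> funs"
  using funs_diff[OF funs_const[of 0]] by simp

text \<open>The zero germ causes no exception, because \<open>inverse 0 = 0\<close>.\<close>

lemma funs_inverse:
  assumes "f \<in> funs"
  shows "(\<lambda>x. inverse (f x)) \<in> funs"
proof (cases "abs_germ f = 0")
  case True
  then have "\<forall>\<^sub>F x in at_top. 0 = inverse (f x)"
    unfolding abs_germ_zero_iff by eventually_elim simp
  then show ?thesis using funs_cong[OF funs_const[of 0]] by simp
next
  case False
  then show ?thesis
    using hardy_field_inverse(1)[OF hardy, of "abs_germ f"] assms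
    by (simp add: funs_def inverse_germ.abs_eq)
qed

lemma funs_divide: "f \<in> funs \<Longrightarrow> g \<in> funs \<Longrightarrow> (\<lambda>x. f x / g x) \<in> funs"
  unfolding divide_inverse by (intro funs_mult funs_inverse)

lemma funs_deriv: "f \<in> funs \<Longrightarrow> deriv f \<in> funs"
  using hardy by (simp add: funs_def hardy_field_def flip: germ_deriv.abs_eq)

lemma funs_dlog: "f \<in> funs \<Longrightarrow> dlog f \<in> funs"
  unfolding dlog_def [abs_def] by (intro funs_divide funs_deriv)

lemma funs_exp: "f \<in> funs \<Longrightarrow> (\<lambda>x. exp (f x)) \<in> funs"
  using liouville by (simp add: funs_def Liouville_closed_def flip: germ_exp.abs_eq)

lemma eventually_deriv:
  assumes "f \<in> funs"
  shows "\<forall>\<^sub>F x in at_top. (f has_real_derivative deriv f x) (at x)"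
proof -
  have "germ_differentiable (abs_germ f)"
    using hardy assms by (simp add: funs_def hardy_field_def)
  then have "\<forall>\<^sub>F x in at_top. f differentiable at x"
    by (simp add: germ_differentiable.abs_eq)
  then show ?thesis
    by eventually_elim (simp add: DERIV_deriv_iff_real_differentiable)
qed

lemma eventually_isCont: "f \<in> funs \<Longrightarrow> \<forall>\<^sub>F x in at_top. isCont f x"
  by (rule eventually_mono[OF eventually_deriv]) (auto intro: DERIV_isCont)

lemma funs_primitive:
  assumes "f \<in> funs"
  obtains g where "g \<in> funs" "\<forall>\<^sub>F x in at_top. (g has_real_derivative f x) (at x)"
proof -
  obtain h where h: "h \<in> H" "germ_deriv h = abs_germ f"
    using liouville assms by (auto simp: funs_def Liouville_closed_def)
  obtain g where g: "h = abs_germ g" by (rule germ_exhaust)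
  have "g \<in> funs" using h g by (simp add: funs_def)
  moreover have "\<forall>\<^sub>F x in at_top. deriv g x = f x"
    using h g by (simp add: germ_deriv.abs_eq abs_germ_eq_iff)
  then have "\<forall>\<^sub>F x in at_top. (g has_real_derivative f x) (at x)"
    using eventually_deriv[OF \<open>g \<in> funs\<close>] by eventually_elim simp
  ultimately show ?thesis by (rule that)
qed

lemma funs_trichotomy:
  assumes f: "f \<in> funs"
  shows "(\<forall>\<^sub>F x in at_top. f x = 0) \<or> (\<forall>\<^sub>F x in at_top. 0 < f x) \<or> (\<forall>\<^sub>F x in at_top. f x < 0)"
proof (cases "abs_germ f = 0")
  case False
  have fH: "abs_germ f \<in> H" using f by (simp add: funs_def)
  have "abs_germ (\<lambda>x. f x * inverse (f x)) = abs_germ (\<lambda>_. 1)"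
    using hardy_field_inverse(2)[OF hardy fH False]
    by (simp add: inverse_germ.abs_eq times_germ.abs_eq one_germ_def)
  then have nz: "\<forall>\<^sub>F x in at_top. f x \<noteq> 0"
    unfolding abs_germ_eq_iff by eventually_elim auto
  have "abs_germ (\<lambda>_. 0) \<le> abs_germ f \<or> abs_germ f \<le> abs_germ (\<lambda>_. 0)"
    using hardy_field_sign[OF hardy fH] by (simp add: zero_germ_def)
  then have "(\<forall>\<^sub>F x in at_top. 0 \<le> f x) \<or> (\<forall>\<^sub>F x in at_top. f x \<le> 0)"
    by (simp add: less_eq_germ.abs_eq)
  then show ?thesis
  proof (elim disjE)
    assume "\<forall>\<^sub>F x in at_top. 0 \<le> f x"
    with nz have "\<forall>\<^sub>F x in at_top. 0 < f x" by eventually_elim simp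
    then show ?thesis by simp
  next
    assume "\<forall>\<^sub>F x in at_top. f x \<le> 0"
    with nz have "\<forall>\<^sub>F x in at_top. f x < 0" by eventually_elim simp
    then show ?thesis by simp
  qed
qed (simp add: abs_germ_zero_iff)

lemma funs_linear:
  assumes "f \<in> funs" "g \<in> funs"
  shows "(\<forall>\<^sub>F x in at_top. f x \<le> g x) \<or> (\<forall>\<^sub>F x in at_top. g x < f x)"
  using funs_trichotomy[OF funs_diff[OF assms]] by (auto elim: eventually_mono)

definition pos :: "(real \<Rightarrow> real) set" where
  "pos = {f \<in> funs. \<forall>\<^sub>F x in at_top. 0 < f x}"

lemma pos_funs: "f \<in> pos \<Longrightarrow> f \<in> funs"
  and pos_eventually: "f \<in> pos \<Longrightarrow> \<forall>\<^sub>F x in at_top. 0 < f x"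
  by (simp_all add: pos_def)

lemma pos_const: "0 < c \<Longrightarrow> (\<lambda>_. c) \<in> pos"
  by (simp add: pos_def funs_const)

lemma pos_add: "f \<in> pos \<Longrightarrow> g \<in> pos \<Longrightarrow> (\<lambda>x. f x + g x) \<in> pos"
  and pos_mult: "f \<in> pos \<Longrightarrow> g \<in> pos \<Longrightarrow> (\<lambda>x. f x * g x) \<in> pos"
  and pos_divide: "f \<in> pos \<Longrightarrow> g \<in> pos \<Longrightarrow> (\<lambda>x. f x / g x) \<in> pos"
  by (auto simp: pos_def funs_add funs_mult funs_divide elim: eventually_elim2)

lemma pos_exp: "f \<in> funs \<Longrightarrow> (\<lambda>x. exp (f x)) \<in> pos"
  by (simp add: pos_def funs_exp)

lemma pos_cong: "f \<in> pos \<Longrightarrow> \<forall>\<^sub>F x in at_top. f x = g x \<Longrightarrow> g \<in> pos"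
  unfolding pos_def using funs_cong by (auto elim: eventually_elim2)

lemma funs_abs: assumes "f \<in> funs" shows "(\<lambda>x. \<bar>f x\<bar>) \<in> funs"
  using funs_trichotomy[OF assms]
proof (elim disjE)
  assume "\<forall>\<^sub>F x in at_top. f x < 0"
  then have "\<forall>\<^sub>F x in at_top. - f x = \<bar>f x\<bar>" by eventually_elim simp
  with funs_uminus[OF assms] show ?thesis by (rule funs_cong)
next
  assume "\<forall>\<^sub>F x in at_top. f x = 0"
  then have "\<forall>\<^sub>F x in at_top. f x = \<bar>f x\<bar>" by eventually_elim simp
  with assms show ?thesis by (rule funs_cong)
next
  assume "\<forall>\<^sub>F x in at_top. 0 < f x"
  then have "\<forall>\<^sub>F x in at_top. f x = \<bar>f x\<bar>" by eventually_elim simp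
  with assms show ?thesis by (rule funs_cong)
qed

lemma pos_abs: assumes "f \<in> funs" "\<not> (\<forall>\<^sub>F x in at_top. f x = 0)" shows "(\<lambda>x. \<bar>f x\<bar>) \<in> pos"
  using funs_trichotomy[OF assms(1)] assms funs_abs
  by (auto simp: pos_def elim: eventually_mono)

lemma pos_deriv:
  assumes "f \<in> pos"
  shows "\<forall>\<^sub>F x in at_top. 0 < f x \<and> (f has_real_derivative f x * dlog f x) (at x)"
  using pos_eventually[OF assms] eventually_deriv[OF pos_funs[OF assms]]
  by eventually_elim (simp add: dlog_def)

text \<open>H contains a primitive of the logarithmic derivative of \<open>f\<close>. It differs
  from \<open>ln f\<close> by a constant, and constants lie in H.\<close>

lemma funs_ln:
  assumes f: "f \<in> pos"
  shows "(\<lambda>x. ln (f x)) \<in> funs"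
proof -
  obtain g where g: "g \<in> funs" "\<forall>\<^sub>F x in at_top. (g has_real_derivative dlog f x) (at x)"
    using funs_primitive[OF funs_dlog[OF pos_funs[OF f]]] by blast
  have "\<forall>\<^sub>F x in at_top. ((\<lambda>x. ln (f x) - g x) has_real_derivative 0) (at x)"
    using g(2) pos_deriv[OF f]
    by eventually_elim (auto intro!: derivative_eq_intros)
  then obtain c where "\<forall>\<^sub>F x in at_top. ln (f x) - g x = c"
    by (rule eventually_DERIV_zero_imp_const)
  then have "\<forall>\<^sub>F x in at_top. g x + c = ln (f x)" by eventually_elim simp
  with funs_add[OF g(1) funs_const] show ?thesis by (rule funs_cong)
qed

lemma pos_powr:
  assumes "f \<in> pos" shows "(\<lambda>x. f x powr c) \<in> pos"
proof -
  have "\<forall>\<^sub>F x in at_top. exp (c * ln (f x)) = f x powr c"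
    using pos_eventually[OF assms] by eventually_elim (simp add: powr_def)
  then show ?thesis
    by (rule pos_cong[OF pos_exp[OF funs_mult[OF funs_const funs_ln[OF assms]]]])
qed

lemma dlog_unbounded:
  assumes f: "f \<in> pos" and A: "\<forall>\<^sub>F x in at_top. 1 \<le> \<sigma> * dlog f x"
  shows "\<forall>\<^sub>F x in at_top. C < \<sigma> * ln (f x)"
  using log_growth[OF pos_deriv[OF f] A] by (simp add: filterlim_at_top_dense)

text \<open>In a Hardy field, failure of the bound means \<open>dlog f > 1\<close> or
  \<open>dlog f < - 1\<close> eventually. Then \<open>\<bar>ln f\<bar>\<close> would be unbounded,
  while the two bounds on \<open>f\<close> confine \<open>ln f\<close>.\<close>

lemma dlog_bounded:
  assumes f: "f \<in> pos" and bounds: "\<forall>\<^sub>F x in at_top. f x \<le> C" "\<forall>\<^sub>F x in at_top. 1 \<le> C' * f x"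
  shows "\<forall>\<^sub>F x in at_top. \<bar>dlog f x\<bar> \<le> 1"
proof -
  have "\<forall>\<^sub>F x in at_top. \<sigma> * dlog f x \<le> 1" if \<sigma>: "\<sigma> \<in> {1, - 1}" for \<sigma> :: real
  proof (rule ccontr)
    assume "\<not> ?thesis"
    then have "\<forall>\<^sub>F x in at_top. 1 < \<sigma> * dlog f x"
      using funs_linear[OF funs_mult[OF funs_const[of \<sigma>] funs_dlog[OF pos_funs[OF f]]] funs_const[of 1]]
      by blast
    then have "\<forall>\<^sub>F x in at_top. \<bar>ln \<bar>C\<bar>\<bar> + \<bar>ln \<bar>C'\<bar>\<bar> < \<sigma> * ln (f x)"
      by (intro dlog_unbounded[OF f]) (auto elim: eventually_mono)
    with bounds pos_eventually[OF f] have "\<forall>\<^sub>F x in at_top :: real filter. False"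
    proof eventually_elim
      case (elim x)
      have "0 < C" using elim by linarith
      then have 1: "ln (f x) \<le> ln \<bar>C\<bar>" using elim(1,3) by (intro ln_mono) auto
      have "0 < C' * f x" using elim by linarith
      then have C': "0 < C'" using elim by (simp add: zero_less_mult_iff)
      have "ln 1 \<le> ln (C' * f x)" using elim C' by (intro ln_mono) auto
      also have "\<dots> = ln \<bar>C'\<bar> + ln (f x)" using elim C' by (simp add: ln_mult)
      finally have 2: "0 \<le> ln \<bar>C'\<bar> + ln (f x)" by simp
      have "\<bar>ln (f x)\<bar> \<le> \<bar>ln \<bar>C\<bar>\<bar> + \<bar>ln \<bar>C'\<bar>\<bar>" using 1 2 by linarith
      moreover have "\<sigma> * ln (f x) \<le> \<bar>ln (f x)\<bar>" using \<sigma> by auto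
      ultimately show False using elim(4) by linarith
    qed
    then show False by simp
  qed
  from this[of 1] this[of "- 1"] show ?thesis
    by simp (auto elim: eventually_elim2)
qed

lemma dlog_divide:
  assumes "f \<in> pos" "g \<in> pos"
  shows "\<forall>\<^sub>F x in at_top. dlog (\<lambda>x. f x / g x) x = dlog f x - dlog g x"
  using pos_deriv[OF assms(1)] pos_deriv[OF assms(2)]
proof eventually_elim
  case (elim x)
  then have "((\<lambda>x. f x / g x) has_real_derivative f x / g x * (dlog f x - dlog g x)) (at x)"
    by (auto intro!: derivative_eq_intros simp: field_simps)
  then show ?case using elim by (simp add: dlog_def[of "\<lambda>x. f x / g x"] DERIV_imp_deriv)
qed

end

section \<open>H-couples\<close>

\<comment> \<open>The class assumes only \<open>abs_if\<close>; this makes the general facts on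
  absolute values available.\<close>
subclass (in linordered_real_vector) ordered_ab_group_add_abs
proof
  fix a b :: 'a
  have "x \<le> \<bar>x\<bar>" "- x \<le> \<bar>x\<bar>" for x :: 'a
    by (auto simp: abs_if not_less intro: order_trans less_imp_le)
  then have "a + b \<le> \<bar>a\<bar> + \<bar>b\<bar>" "- a + - b \<le> \<bar>a\<bar> + \<bar>b\<bar>"
    by (blast intro: add_mono)+
  then show "\<bar>a + b\<bar> \<le> \<bar>a\<bar> + \<bar>b\<bar>" by (simp add: abs_if[of "a + b"])
qed (auto simp: abs_if not_less algebra_simps intro: order_trans less_imp_le)

lemma H_couple_ultrametric:
  "H_couple \<psi> \<Longrightarrow> \<alpha> \<noteq> 0 \<Longrightarrow> \<beta> \<noteq> 0 \<Longrightarrow> \<alpha> + \<beta> \<noteq> 0 \<Longrightarrow> min (\<psi> \<alpha>) (\<psi> \<beta>) \<le> \<psi> (\<alpha> + \<beta>)"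
  by (simp add: H_couple_def)

lemma H_couple_less: "H_couple \<psi> \<Longrightarrow> 0 < \<alpha> \<Longrightarrow> \<beta> \<noteq> 0 \<Longrightarrow> \<psi> \<beta> < \<alpha> + \<psi> \<alpha>"
  by (metis H_couple_def less_irrefl)

lemma H_couple_antimono:
  "H_couple \<psi> \<Longrightarrow> \<alpha> \<noteq> 0 \<Longrightarrow> \<beta> \<noteq> 0 \<Longrightarrow> 0 < c \<Longrightarrow> \<bar>\<alpha>\<bar> \<le> c *\<^sub>R \<bar>\<beta>\<bar> \<Longrightarrow> \<psi> \<beta> \<le> \<psi> \<alpha>"
  unfolding H_couple_def by blast

lemma H_couple_antimono_abs:
  "H_couple \<psi> \<Longrightarrow> \<alpha> \<noteq> 0 \<Longrightarrow> \<beta> \<noteq> 0 \<Longrightarrow> \<bar>\<alpha>\<bar> \<le> \<bar>\<beta>\<bar> \<Longrightarrow> \<psi> \<beta> \<le> \<psi> \<alpha>"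
  using H_couple_antimono[of \<psi> \<alpha> \<beta> 1] by simp

lemma H_couple_uminus:
  assumes "H_couple \<psi>" shows "\<psi> (- \<alpha>) = \<psi> \<alpha>"
proof (cases "\<alpha> = 0")
  case False
  then show ?thesis
    using H_couple_antimono_abs[OF assms, of \<alpha> "- \<alpha>"] H_couple_antimono_abs[OF assms, of "- \<alpha>" \<alpha>]
    by simp
qed simp

lemma H_couple_abs: "H_couple \<psi> \<Longrightarrow> \<psi> \<bar>\<alpha>\<bar> = \<psi> \<alpha>"
  by (simp add: abs_if H_couple_uminus)

lemma H_couple_abs_less:
  "H_couple \<psi> \<Longrightarrow> \<alpha> \<noteq> 0 \<Longrightarrow> \<beta> \<noteq> 0 \<Longrightarrow> \<psi> \<alpha> < \<psi> \<beta> \<Longrightarrow> \<bar>\<beta>\<bar> < \<bar>\<alpha>\<bar>"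
  using H_couple_antimono_abs[of \<psi> \<alpha> \<beta>] by (meson leD leI)

lemma abs_less_add_sign:
  fixes \<alpha> \<beta> :: "'g::linordered_real_vector"
  assumes "\<bar>\<beta>\<bar> < \<bar>\<alpha>\<bar>"
  shows "\<alpha> + \<beta> < 0 \<longleftrightarrow> \<alpha> < 0" "\<alpha> + \<beta> \<noteq> 0"
proof -
  have "\<alpha> \<noteq> 0" using assms abs_ge_zero[of \<beta>] by (metis abs_zero leD)
  then consider "0 < \<alpha>" | "\<alpha> < 0" by (meson linorder_neqE)
  then have "(\<alpha> + \<beta> < 0 \<longleftrightarrow> \<alpha> < 0) \<and> \<alpha> + \<beta> \<noteq> 0"
  proof cases
    case 1
    then have "- \<beta> < \<alpha>" using assms by (metis abs_minus_cancel abs_of_pos abs_ge_self order_le_less_trans)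
    then have "0 < \<alpha> + \<beta>" by (metis add.commute add_strict_right_mono left_minus add.right_inverse)
    then show ?thesis using 1 by auto
  next
    case 2
    then have "\<beta> < - \<alpha>" using assms by (metis abs_of_neg abs_ge_self order_le_less_trans)
    then have "\<alpha> + \<beta> < 0" by (metis add_strict_left_mono add.right_inverse)
    then show ?thesis using 2 by auto
  qed
  then show "\<alpha> + \<beta> < 0 \<longleftrightarrow> \<alpha> < 0" "\<alpha> + \<beta> \<noteq> 0" by auto
qed

text \<open>The upper bound for \<open>\<psi> (\<alpha> + \<beta>)\<close> is the ultrametric
  inequality for \<open>\<alpha> = (\<alpha> + \<beta>) + (- \<beta>)\<close>: a value above
  \<open>\<psi> \<alpha>\<close> would push both terms of the minimum above
  \<open>\<psi> \<alpha>\<close>.\<close>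

lemma H_couple_add_eq:
  assumes \<psi>: "H_couple \<psi>" and nz: "\<alpha> \<noteq> 0" "\<beta> \<noteq> 0" and less: "\<psi> \<alpha> < \<psi> \<beta>"
  shows "\<psi> (\<alpha> + \<beta>) = \<psi> \<alpha>"
proof -
  have nz': "\<alpha> + \<beta> \<noteq> 0"
    by (rule abs_less_add_sign(2)[OF H_couple_abs_less[OF \<psi> nz less]])
  have "\<psi> \<alpha> \<le> \<psi> (\<alpha> + \<beta>)"
    using H_couple_ultrametric[OF \<psi> nz nz'] less by (simp add: min_def split: if_splits)
  moreover have "min (\<psi> (\<alpha> + \<beta>)) (\<psi> (- \<beta>)) \<le> \<psi> (\<alpha> + \<beta> + - \<beta>)"
    by (rule H_couple_ultrametric[OF \<psi>]) (use nz nz' in auto)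
  then have "\<psi> (\<alpha> + \<beta>) \<le> \<psi> \<alpha>"
    using less H_couple_uminus[OF \<psi>, of \<beta>] by (auto simp: min_def split: if_splits)
  ultimately show ?thesis by simp
qed

section \<open>The valuation of a Liouville closed Hardy field\<close>

text \<open>For positive functions domination of germs is the relation O of Landau. The functions
  are arbitrary, since one of them will be \<open>W 0\<close>, which need not represent an element
  of H.\<close>

lemma germ_val_pos_le_iff:
  assumes f: "\<forall>\<^sub>F x in at_top. 0 < f x" and g: "\<forall>\<^sub>F x in at_top. 0 < g x"
  shows "germ_val (abs_germ f) \<le> germ_val (abs_germ g) \<longleftrightarrow> (\<exists>C. \<forall>\<^sub>F x in at_top. g x \<le> C * f x)"
  unfolding germ_val_le_iff_dominated
proof
  assume "dominated (abs_germ g) (abs_germ f)"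
  then obtain u c where u: "abs_germ g = u * abs_germ f" "u \<le> of_real c"
    by (auto simp: dominated_def valuation_ring_UNIV_iff)
  obtain U where U: "u = abs_germ U" by (rule germ_exhaust)
  have "\<forall>\<^sub>F x in at_top. g x = U x * f x" "\<forall>\<^sub>F x in at_top. U x \<le> c"
    using u by (simp_all add: U of_real_germ times_germ.abs_eq abs_germ_eq_iff less_eq_germ.abs_eq)
  with f have "\<forall>\<^sub>F x in at_top. g x \<le> c * f x"
    by eventually_elim simp
  then show "\<exists>C. \<forall>\<^sub>F x in at_top. g x \<le> C * f x" by blast
next
  assume "\<exists>C. \<forall>\<^sub>F x in at_top. g x \<le> C * f x"
  then obtain C where C: "\<forall>\<^sub>F x in at_top. g x \<le> C * f x" by blast
  have bounds: "\<forall>\<^sub>F x in at_top. - C \<le> g x / f x \<and> g x / f x \<le> C"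
    using C f g
  proof eventually_elim
    case (elim x)
    have "0 \<le> g x / f x" "g x / f x \<le> C" using elim by (auto simp: divide_le_eq)
    then show ?case by linarith
  qed
  then have "- of_real C \<le> abs_germ (\<lambda>x. g x / f x) \<and> abs_germ (\<lambda>x. g x / f x) \<le> of_real C"
    by (simp add: of_real_germ uminus_germ.abs_eq less_eq_germ.abs_eq eventually_conj_iff)
  moreover have "abs_germ g = abs_germ (\<lambda>x. g x / f x) * abs_germ f"
    unfolding times_germ.abs_eq abs_germ_eq_iff using f by eventually_elim simp
  ultimately show "dominated (abs_germ g) (abs_germ f)"
    unfolding dominated_def
    by (intro bexI[of _ "abs_germ (\<lambda>x. g x / f x)"]) (auto simp: valuation_ring_UNIV_iff)
qed

lemma germ_val_uminus: "germ_val (- h) = germ_val h"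
proof -
  have m: "- 1 \<in> valuation_ring UNIV"
    unfolding valuation_ring_UNIV_iff
    by (rule exI[of _ 1]) (simp add: one_germ_def uminus_germ.abs_eq less_eq_germ.abs_eq)
  have "dominated (- h) h" for h
    unfolding dominated_def by (rule bexI[OF _ m]) simp
  from this[of h] this[of "- h"] show ?thesis by (simp add: germ_val_eq_iff)
qed

locale hardy_H_couple = liouville_closed_field H for H :: "germ set" +
  fixes \<iota> :: "gval \<Rightarrow> 'g::linordered_real_vector" and \<psi> :: "'g \<Rightarrow> 'g"
  assumes extension: "H_couple_extension H \<iota> \<psi>"
begin

definition V :: "(real \<Rightarrow> real) \<Rightarrow> 'g" where
  "V f = \<iota> (germ_val (abs_germ f))"

definition G :: "'g set" where "G = \<iota> ` value_group H"

lemma couple: "H_couple \<psi>"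
  using extension by (simp add: H_couple_extension_def)

lemma pos_nonzero: "f \<in> pos \<Longrightarrow> abs_germ f \<in> H - {0}"
proof -
  assume f: "f \<in> pos"
  have "\<not> (\<forall>\<^sub>F x in at_top. f x = 0)"
  proof
    assume "\<forall>\<^sub>F x in at_top. f x = 0"
    with pos_eventually[OF f] have "\<forall>\<^sub>F x in at_top :: real filter. False" by eventually_elim simp
    then show False by simp
  qed
  then show ?thesis using pos_funs[OF f] by (simp add: abs_germ_zero_iff funs_def)
qed

lemma pos_value: "f \<in> pos \<Longrightarrow> germ_val (abs_germ f) \<in> value_group H"
  using pos_nonzero by (auto simp: value_group_def)

lemma germ_val_abs:
  assumes "f \<in> funs"
  shows "germ_val (abs_germ (\<lambda>x. \<bar>f x\<bar>)) = germ_val (abs_germ f)"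
  using funs_trichotomy[OF assms]
proof (elim disjE)
  assume "\<forall>\<^sub>F x in at_top. f x = 0"
  then have "\<forall>\<^sub>F x in at_top. \<bar>f x\<bar> = f x" by eventually_elim simp
  then show ?thesis by (simp add: abs_germ_eq_iff[symmetric])
next
  assume "\<forall>\<^sub>F x in at_top. 0 < f x"
  then have "\<forall>\<^sub>F x in at_top. \<bar>f x\<bar> = f x" by eventually_elim simp
  then show ?thesis by (simp add: abs_germ_eq_iff[symmetric])
next
  assume "\<forall>\<^sub>F x in at_top. f x < 0"
  then have "\<forall>\<^sub>F x in at_top. \<bar>f x\<bar> = - f x" by eventually_elim simp
  then have "abs_germ (\<lambda>x. \<bar>f x\<bar>) = - abs_germ f"
    by (simp add: abs_germ_eq_iff[symmetric] uminus_germ.abs_eq)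
  then show ?thesis by (simp add: germ_val_uminus)
qed

lemma value_group_pos:
  assumes "\<gamma> \<in> value_group H"
  obtains f where "f \<in> pos" "\<gamma> = germ_val (abs_germ f)"
proof -
  obtain h where h: "h \<in> H" "h \<noteq> 0" "\<gamma> = germ_val h" using assms by (auto simp: value_group_def)
  obtain f where f: "h = abs_germ f" by (rule germ_exhaust)
  have "f \<in> funs" using h f by (simp add: funs_def)
  moreover have "\<not> (\<forall>\<^sub>F x in at_top. f x = 0)" using h f by (simp add: abs_germ_zero_iff)
  ultimately have "(\<lambda>x. \<bar>f x\<bar>) \<in> pos" by (rule pos_abs)
  then show ?thesis
    by (rule that) (simp add: germ_val_abs[OF \<open>f \<in> funs\<close>] h f)
qed

lemma G_eq: "G = V ` pos"
proof -
  have "\<iota> \<gamma> \<in> V ` pos" if "\<gamma> \<in> value_group H" for \<gamma>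
    using value_group_pos[OF that] by (auto simp: V_def)
  then show ?thesis using pos_value by (auto simp: V_def G_def)
qed

lemma V_mem: "f \<in> pos \<Longrightarrow> V f \<in> G"
  by (simp add: G_eq)

lemma V_mult: "f \<in> pos \<Longrightarrow> g \<in> pos \<Longrightarrow> V (\<lambda>x. f x * g x) = V f + V g"
  using extension pos_value
  by (simp add: V_def H_couple_extension_def germ_val_mult flip: times_germ.abs_eq)

lemma V_le_iff: "f \<in> pos \<Longrightarrow> g \<in> pos \<Longrightarrow> V f \<le> V g \<longleftrightarrow> (\<exists>C. \<forall>\<^sub>F x in at_top. g x \<le> C * f x)"
  using extension pos_value germ_val_pos_le_iff[OF pos_eventually pos_eventually]
  by (simp add: V_def H_couple_extension_def)

lemma V_leI: "f \<in> pos \<Longrightarrow> g \<in> pos \<Longrightarrow> \<forall>\<^sub>F x in at_top. g x \<le> C * f x \<Longrightarrow> V f \<le> V g"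
  using V_le_iff by blast

lemma V_lessD:
  assumes "f \<in> pos" "g \<in> pos" "V f < V g"
  shows "\<forall>\<^sub>F x in at_top. C * g x < f x"
proof -
  have "\<not> (\<forall>\<^sub>F x in at_top. f x \<le> C * g x)"
    using V_leI[OF assms(2,1)] assms(3) by fastforce
  then show ?thesis
    using funs_linear[OF pos_funs[OF assms(1)] funs_mult[OF funs_const[of C] pos_funs[OF assms(2)]]] by blast
qed

lemma V_cong: "\<forall>\<^sub>F x in at_top. f x = g x \<Longrightarrow> V f = V g"
  using abs_germ_eq_iff[of f g] by (simp add: V_def)

text \<open>The axioms on \<open>\<iota>\<close> state additivity and order, not
  \<open>\<iota> 0 = 0\<close>. But \<open>c * c\<close> and \<open>c\<close> have the same value,
  so \<open>V c + V c = V c\<close>.\<close>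

lemma V_const: assumes "0 < c" shows "V (\<lambda>_. c) = 0"
proof -
  have "V (\<lambda>x. c * c) = V (\<lambda>_. c)"
  proof (rule antisym)
    show "V (\<lambda>x. c * c) \<le> V (\<lambda>_. c)"
      by (rule V_leI[of _ _ "1 / c"]) (use assms in \<open>auto intro: pos_const\<close>)
    show "V (\<lambda>x. c) \<le> V (\<lambda>_. c * c)"
      by (rule V_leI[of _ _ c]) (use assms in \<open>auto intro: pos_const\<close>)
  qed
  then show ?thesis using V_mult[OF pos_const[OF assms] pos_const[OF assms]] by simp
qed

lemma V_divide:
  assumes "f \<in> pos" "g \<in> pos" shows "V (\<lambda>x. f x / g x) = V f - V g"
proof -
  have "V f = V (\<lambda>x. f x / g x * g x)"
    by (rule V_cong) (use pos_eventually[OF assms(2)] in \<open>auto elim!: eventually_mono\<close>)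
  also have "\<dots> = V (\<lambda>x. f x / g x) + V g"
    by (rule V_mult[OF pos_divide[OF assms] assms(2)])
  finally show ?thesis by simp
qed

text \<open>The logarithmic derivative of \<open>f powr c\<close> is \<open>c * dlog f\<close>, and
  this relation is how scalar multiplication is defined on values.\<close>

lemma V_powr:
  assumes f: "f \<in> pos" shows "V (\<lambda>x. f x powr c) = c *\<^sub>R V f"
proof -
  note fc = pos_powr[OF f, of c]
  have "\<forall>\<^sub>F x in at_top. dlog (\<lambda>x. f x powr c) x = c * dlog f x"
    using pos_deriv[OF f]
  proof eventually_elim
    case (elim x)
    have "((\<lambda>x. f x powr c) has_real_derivative f x powr c * (c * dlog f x)) (at x)"
      using elim by (auto intro!: derivative_eq_intros simp: field_simps powr_diff)
    then show ?case using elim by (simp add: dlog_def[of "\<lambda>x. f x powr c"] DERIV_imp_deriv)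
  qed
  then have "c *\<^sub>R germ_dlog (abs_germ f) = germ_dlog (abs_germ (\<lambda>x. f x powr c))"
    unfolding germ_dlog_def germ_deriv.abs_eq divide_germ.abs_eq scaleR_germ.abs_eq abs_germ_eq_iff dlog_def
    by eventually_elim simp
  then show ?thesis
    using extension pos_nonzero[OF f] pos_nonzero[OF fc] by (simp add: V_def H_couple_extension_def)
qed

text \<open>If \<open>dlog f\<close> vanished eventually, \<open>f\<close> would be a positive
  constant, of value 0. The absolute value does not change the value and makes the function eligible
  for \<open>pos\<close>.\<close>

lemma psi_V:
  assumes f: "f \<in> pos" and nz: "V f \<noteq> 0"
  shows "(\<lambda>x. \<bar>dlog f x\<bar>) \<in> pos" "\<psi> (V f) = V (\<lambda>x. \<bar>dlog f x\<bar>)"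
proof -
  have "\<not> (\<forall>\<^sub>F x in at_top. dlog f x = 0)"
  proof
    assume "\<forall>\<^sub>F x in at_top. dlog f x = 0"
    with pos_deriv[OF f] have "\<forall>\<^sub>F x in at_top. (f has_real_derivative 0) (at x)"
      by eventually_elim simp
    then obtain c where c: "\<forall>\<^sub>F x in at_top. f x = c" by (rule eventually_DERIV_zero_imp_const)
    with pos_eventually[OF f] have "\<forall>\<^sub>F x in at_top :: real filter. 0 < c" by eventually_elim simp
    then have "0 < c" by simp
    then show False using V_cong[OF c] V_const nz by simp
  qed
  then show "(\<lambda>x. \<bar>dlog f x\<bar>) \<in> pos"
    using pos_abs[OF funs_dlog[OF pos_funs[OF f]]] by blast
  have "germ_val (abs_germ f) \<noteq> 0"
  proof
    assume "germ_val (abs_germ f) = 0"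
    then have "V f = V (\<lambda>_. 1)" by (simp add: V_def germ_val_one flip: one_germ_def)
    then show False using V_const nz by simp
  qed
  then have "\<psi> (V f) = \<iota> (germ_val (germ_dlog (abs_germ f)))"
    using extension pos_nonzero[OF f] by (simp add: V_def H_couple_extension_def)
  also have "germ_dlog (abs_germ f) = abs_germ (dlog f)"
    by (simp add: germ_dlog_def germ_deriv.abs_eq divide_germ.abs_eq dlog_def [abs_def])
  finally show "\<psi> (V f) = V (\<lambda>x. \<bar>dlog f x\<bar>)"
    by (simp add: V_def germ_val_abs[OF funs_dlog[OF pos_funs[OF f]]])
qed

lemma psi_mem: "\<gamma> \<in> G \<Longrightarrow> \<gamma> \<noteq> 0 \<Longrightarrow> \<psi> \<gamma> \<in> G"
  using psi_V V_mem unfolding G_eq by force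

lemma G_zero: "0 \<in> G"
  using V_mem[OF pos_const[of 1]] V_const[of 1] by simp

lemma G_scaleR: assumes "\<gamma> \<in> G" shows "c *\<^sub>R \<gamma> \<in> G"
proof -
  obtain f where "f \<in> pos" "\<gamma> = V f" using assms unfolding G_eq by blast
  then show ?thesis using V_mem[OF pos_powr[of f c]] by (simp add: V_powr)
qed

lemma G_add: assumes "\<gamma> \<in> G" "\<delta> \<in> G" shows "\<gamma> + \<delta> \<in> G"
proof -
  obtain f g where "f \<in> pos" "\<gamma> = V f" "g \<in> pos" "\<delta> = V g" using assms unfolding G_eq by blast
  then show ?thesis using V_mem[OF pos_mult[of f g]] by (simp add: V_mult)
qed

lemma G_uminus: "\<gamma> \<in> G \<Longrightarrow> - \<gamma> \<in> G"
  using G_scaleR[of \<gamma> "- 1"] by simp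

lemma G_diff: "\<gamma> \<in> G \<Longrightarrow> \<delta> \<in> G \<Longrightarrow> \<gamma> - \<delta> \<in> G"
  using G_add[of \<gamma> "- \<delta>"] G_uminus by simp

lemma G_abs: "\<gamma> \<in> G \<Longrightarrow> \<bar>\<gamma>\<bar> \<in> G"
  by (simp add: abs_if G_uminus)

section \<open>Size and sign of logarithmic derivatives, and the range of \<open>\<psi>\<close> on
  the value group\<close>

lemma V_less_zeroD:
  assumes "f \<in> pos" "V f < 0" shows "\<forall>\<^sub>F x in at_top. C < f x"
  using V_lessD[OF assms(1) pos_const[of 1], of C] assms(2) by (simp add: V_const)

lemma V_zero_dlog:
  assumes f: "f \<in> pos" and V: "V f = 0"
  shows "\<forall>\<^sub>F x in at_top. \<bar>dlog f x\<bar> \<le> 1"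
proof -
  have one: "(\<lambda>_. 1 :: real) \<in> pos" by (rule pos_const) simp
  have "V (\<lambda>_. 1) \<le> V f" "V f \<le> V (\<lambda>_. 1)" using V by (simp_all add: V_const)
  then obtain C C' where "\<forall>\<^sub>F x in at_top. f x \<le> C * 1" "\<forall>\<^sub>F x in at_top. 1 \<le> C' * f x"
    using V_le_iff[OF f one] V_le_iff[OF one f] by blast
  then show ?thesis using dlog_bounded[OF f] by simp
qed

text \<open>Otherwise \<open>f\<close> would eventually be nonincreasing, hence bounded, but a
  negative value means that \<open>f\<close> exceeds every constant.\<close>

lemma V_neg_dlog:
  assumes f: "f \<in> pos" and V: "V f < 0"
  shows "\<forall>\<^sub>F x in at_top. 0 < dlog f x"
proof (rule ccontr)
  assume "\<not> ?thesis"
  then have "\<forall>\<^sub>F x in at_top. dlog f x \<le> 0"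
    using funs_linear[OF funs_dlog[OF pos_funs[OF f]] funs_const[of 0]] by blast
  from eventually_conj[OF pos_deriv[OF f] this] obtain t where
    t: "\<And>x. t \<le> x \<Longrightarrow> (0 < f x \<and> (f has_real_derivative f x * dlog f x) (at x)) \<and> dlog f x \<le> 0"
    by (rule eventually_at_topE) blast
  have "f x \<le> f t" if x: "t \<le> x" for x
  proof -
    have "- 1 * (ln (f t) - ln 1) + 0 * (x - t) \<le> - 1 * (ln (f x) - ln 1)"
    proof (rule log_ratio_lower_bound[OF _ _ _ x, where A = "dlog f" and B = "\<lambda>_. 0"])
      fix s assume "t \<le> s"
      from t[OF this] show "0 < f s \<and> (f has_real_derivative f s * dlog f s) (at s within {t..})"
        by (blast intro: DERIV_subset)
      show "0 \<le> - 1 * (dlog f s - 0)" using t[OF \<open>t \<le> s\<close>] by simp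
    qed auto
    then show ?thesis using t[OF x] t[of t] by simp
  qed
  then have "\<forall>\<^sub>F x in at_top. f x \<le> f t"
    using eventually_ge_at_top[of t] by (rule eventually_mono[rotated])
  with V_less_zeroD[OF f V, of "f t"] have "\<forall>\<^sub>F x in at_top :: real filter. False"
    by eventually_elim simp
  then show False by simp
qed

lemma V_pos_dlog:
  assumes f: "f \<in> pos" and V: "0 < V f"
  shows "\<forall>\<^sub>F x in at_top. dlog f x < 0"
proof -
  have one: "(\<lambda>_. 1 :: real) \<in> pos" by (rule pos_const) simp
  have "V (\<lambda>x. 1 / f x) < 0" using V by (simp add: V_divide[OF one f] V_const)
  from V_neg_dlog[OF pos_divide[OF one f] this] dlog_divide[OF one f]
  show ?thesis by eventually_elim (simp add: dlog_def[of "\<lambda>_. 1"])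
qed

text \<open>Take \<open>g\<close> of value \<open>\<gamma>\<close>, scaled so that
  \<open>g \<ge> 1\<close>, and \<open>e = exp F\<close> with \<open>F' = g\<close>. Then
  \<open>dlog e = g\<close>, and \<open>e\<close> is unbounded since \<open>F\<close> is. So
  \<open>V e \<noteq> 0\<close> and \<open>\<bar>V e\<bar>\<close> can serve as
  \<open>\<delta>\<close>.\<close>

lemma psi_surj:
  assumes \<gamma>: "\<gamma> \<in> G" "\<gamma> \<le> 0"
  obtains \<delta> where "\<delta> \<in> G" "0 < \<delta>" "\<psi> \<delta> = \<gamma>"
proof -
  obtain g0 where g0: "g0 \<in> pos" "\<gamma> = V g0" using \<gamma> unfolding G_eq by blast
  have "V (\<lambda>_. 1) \<ge> V g0" using \<gamma> g0 by (simp add: V_const)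
  then obtain C where C: "\<forall>\<^sub>F x in at_top. 1 \<le> C * g0 x"
    using V_le_iff[OF g0(1) pos_const[of 1]] by auto
  define g where "g = (\<lambda>x. \<bar>C\<bar> * g0 x)"
  have "C \<noteq> 0" using C by auto
  then have g: "g \<in> pos" "\<gamma> = V g"
    using g0 pos_mult[OF pos_const[of "\<bar>C\<bar>"] g0(1)] V_mult[OF pos_const[of "\<bar>C\<bar>"] g0(1)]
    by (auto simp: g_def V_const)
  have g1: "\<forall>\<^sub>F x in at_top. 1 \<le> g x"
    using C pos_eventually[OF g0(1)]
  proof eventually_elim
    case (elim x)
    have "C * g0 x \<le> \<bar>C\<bar> * g0 x" using elim by (intro mult_right_mono) auto
    then show ?case using elim unfolding g_def by linarith
  qed
  obtain F where F: "F \<in> funs" "\<forall>\<^sub>F x in at_top. (F has_real_derivative g x) (at x)"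
    using funs_primitive[OF pos_funs[OF g(1)]] by blast
  define e where "e = (\<lambda>x. exp (F x))"
  have e: "e \<in> pos" unfolding e_def by (rule pos_exp[OF F(1)])
  have dl: "\<forall>\<^sub>F x in at_top. dlog e x = g x"
    using F(2)
  proof eventually_elim
    case (elim x)
    have "(e has_real_derivative exp (F x) * g x) (at x)"
      unfolding e_def using elim by (auto intro!: derivative_eq_intros)
    then show ?case by (simp add: dlog_def DERIV_imp_deriv) (simp add: e_def)
  qed
  have nz: "V e \<noteq> 0"
  proof
    assume "V e = 0"
    then have "V (\<lambda>_. 1) \<le> V e" by (simp add: V_const)
    then obtain C where C: "\<forall>\<^sub>F x in at_top. e x \<le> C * 1"
      using V_le_iff[OF pos_const[of 1] e] by auto
    have "\<forall>\<^sub>F x in at_top. 1 \<le> 1 * dlog e x" using dl g1 by eventually_elim simp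
    from dlog_unbounded[OF e this, of "\<bar>C\<bar>"] C
    have "\<forall>\<^sub>F x in at_top :: real filter. False"
    proof eventually_elim
      case (elim x)
      have "F x < exp (F x)" using exp_ge_add_one_self[of "F x"] by linarith
      then show ?case using elim by (simp add: e_def)
    qed
    then show False by simp
  qed
  have "\<psi> (V e) = V g"
    unfolding psi_V(2)[OF e nz] by (rule V_cong) (use dl g1 in \<open>eventually_elim; simp\<close>)
  then have "\<psi> \<bar>V e\<bar> = \<gamma>" using g(2) couple by (simp add: H_couple_abs)
  then show ?thesis using that[of "\<bar>V e\<bar>"] G_abs[OF V_mem[OF e]] nz by simp
qed

text \<open>Choose \<open>\<delta> > 0\<close> with \<open>\<psi> \<delta> = 0\<close>. The second
  axiom of H-couples for \<open>- x\<close> and \<open>\<delta>\<close> reads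
  \<open>0 < - x + \<psi> (- x)\<close>. Together with \<open>\<psi> (b i) < 0\<close> this makes
  the values of the levels increase with the index.\<close>

lemma psi_greater:
  assumes "x < 0" shows "x < \<psi> x"
proof -
  obtain \<delta> where \<delta>: "0 < \<delta>" "\<psi> \<delta> = 0" using psi_surj[OF G_zero] by auto
  have "\<psi> \<delta> < - x + \<psi> (- x)"
    by (rule H_couple_less[OF couple]) (use assms \<delta> in auto)
  then show ?thesis using \<delta> H_couple_uminus[OF couple, of x] by simp
qed

lemma dlog_small:
  assumes f: "f \<in> pos" "V f < 0"
  shows "\<forall>\<^sub>F x in at_top. C * \<bar>dlog f x\<bar> < f x"
  using V_lessD[OF f(1) psi_V(1)[OF f(1)]] psi_V(2)[OF f(1)] psi_greater[OF f(2)] f(2) by auto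

end

section \<open>The cuts of the iterated logarithmic derivatives\<close>

lemma countable_type_overE:
  assumes "countable_type_over G x"
  obtains C D where "x \<notin> G"
    "countable C" "C \<subseteq> {\<gamma>\<in>G. \<gamma> < x}" "\<And>\<gamma>. \<gamma> \<in> G \<Longrightarrow> \<gamma> < x \<Longrightarrow> \<exists>\<delta>\<in>C. \<gamma> \<le> \<delta>"
    "countable D" "D \<subseteq> {\<gamma>\<in>G. \<gamma> > x}" "\<And>\<gamma>. \<gamma> \<in> G \<Longrightarrow> x < \<gamma> \<Longrightarrow> \<exists>\<delta>\<in>D. \<delta> \<le> \<gamma>"
proof -
  obtain C where C: "countable C" "C \<subseteq> {\<gamma>\<in>G. \<gamma> < x}" "\<forall>\<gamma>\<in>G. \<gamma> < x \<longrightarrow> (\<exists>\<delta>\<in>C. \<gamma> \<le> \<delta>)"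
    using assms unfolding countable_type_over_def by (elim conjE exE) assumption
  obtain D where D: "countable D" "D \<subseteq> {\<gamma>\<in>G. \<gamma> > x}" "\<forall>\<gamma>\<in>G. \<gamma> > x \<longrightarrow> (\<exists>\<delta>\<in>D. \<delta> \<le> \<gamma>)"
    using assms unfolding countable_type_over_def by (elim conjE exE) assumption
  show ?thesis
    by (rule that[of C D]) (use C D assms in \<open>simp_all add: countable_type_over_def\<close>)
qed

lemma countable_type_overI:
  assumes "x \<notin> G"
    "countable C" "C \<subseteq> {\<gamma>\<in>G. \<gamma> < x}" "\<And>\<gamma>. \<gamma> \<in> G \<Longrightarrow> \<gamma> < x \<Longrightarrow> \<exists>\<delta>\<in>C. \<gamma> \<le> \<delta>"
    "countable D" "D \<subseteq> {\<gamma>\<in>G. \<gamma> > x}" "\<And>\<gamma>. \<gamma> \<in> G \<Longrightarrow> x < \<gamma> \<Longrightarrow> \<exists>\<delta>\<in>D. \<delta> \<le> \<gamma>"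
  shows "countable_type_over G x"
  unfolding countable_type_over_def
  by (intro conjI exI[of _ C] exI[of _ D] ballI impI) (fact assms | rule assms; assumption)+

lemma countable_type_over_uminus:
  fixes G :: "'g::linordered_real_vector set"
  assumes x: "countable_type_over G x" and G: "\<And>\<gamma>. \<gamma> \<in> G \<Longrightarrow> - \<gamma> \<in> G"
  shows "countable_type_over G (- x)"
proof -
  have "x \<notin> G" using x by (simp add: countable_type_over_def)
  then have 1: "- x \<notin> G" using G[of "- x"] by auto
  obtain C D where C: "countable C" "C \<subseteq> {\<gamma>\<in>G. \<gamma> < x}" "\<And>\<gamma>. \<gamma> \<in> G \<Longrightarrow> \<gamma> < x \<Longrightarrow> \<exists>\<delta>\<in>C. \<gamma> \<le> \<delta>"
    and D: "countable D" "D \<subseteq> {\<gamma>\<in>G. \<gamma> > x}" "\<And>\<gamma>. \<gamma> \<in> G \<Longrightarrow> x < \<gamma> \<Longrightarrow> \<exists>\<delta>\<in>D. \<delta> \<le> \<gamma>"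
    using x by (rule countable_type_overE) blast
  have 2: "\<exists>\<delta>\<in>uminus ` D. \<gamma> \<le> \<delta>" if "\<gamma> \<in> G" "\<gamma> < - x" for \<gamma>
    using D(3)[of "- \<gamma>"] G[OF that(1)] that(2) by (auto simp: less_minus_iff minus_le_iff le_minus_iff)
  have 3: "\<exists>\<delta>\<in>uminus ` C. \<delta> \<le> \<gamma>" if "\<gamma> \<in> G" "- x < \<gamma>" for \<gamma>
    using C(3)[of "- \<gamma>"] G[OF that(1)] that(2) by (auto simp: minus_less_iff minus_le_iff le_minus_iff)
  have "uminus ` D \<subseteq> {\<gamma>\<in>G. \<gamma> < - x}" "uminus ` C \<subseteq> {\<gamma>\<in>G. \<gamma> > - x}" using C(2) D(2) G by auto
  moreover have "countable (uminus ` C)" "countable (uminus ` D)" using C(1) D(1) by auto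
  ultimately show ?thesis
    by (intro countable_type_overI[OF 1 _ _ 2 _ _ 3])
qed

lemma countable_type_over_diff:
  fixes G :: "'g::linordered_real_vector set"
  assumes x: "countable_type_over G x" and a: "a \<in> G"
    and G: "\<And>\<gamma> \<delta>. \<gamma> \<in> G \<Longrightarrow> \<delta> \<in> G \<Longrightarrow> \<gamma> + \<delta> \<in> G" "\<And>\<gamma>. \<gamma> \<in> G \<Longrightarrow> - \<gamma> \<in> G"
  shows "countable_type_over G (x - a)"
proof -
  have G': "\<gamma> - a \<in> G" if "\<gamma> \<in> G" for \<gamma> using G(1)[OF that G(2)[OF a]] by simp
  have "x \<notin> G" using x by (simp add: countable_type_over_def)
  then have 1: "x - a \<notin> G" using G(1)[OF _ a, of "x - a"] by auto
  obtain C D where C: "countable C" "C \<subseteq> {\<gamma>\<in>G. \<gamma> < x}" "\<And>\<gamma>. \<gamma> \<in> G \<Longrightarrow> \<gamma> < x \<Longrightarrow> \<exists>\<delta>\<in>C. \<gamma> \<le> \<delta>"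
    and D: "countable D" "D \<subseteq> {\<gamma>\<in>G. \<gamma> > x}" "\<And>\<gamma>. \<gamma> \<in> G \<Longrightarrow> x < \<gamma> \<Longrightarrow> \<exists>\<delta>\<in>D. \<delta> \<le> \<gamma>"
    using x by (rule countable_type_overE) blast
  have 2: "\<exists>\<delta>\<in>(\<lambda>\<gamma>. \<gamma> - a) ` C. \<gamma> \<le> \<delta>" if "\<gamma> \<in> G" "\<gamma> < x - a" for \<gamma>
    using C(3)[of "\<gamma> + a"] G(1)[OF that(1) a] that(2) by (auto simp: less_diff_eq le_diff_eq)
  have 3: "\<exists>\<delta>\<in>(\<lambda>\<gamma>. \<gamma> - a) ` D. \<delta> \<le> \<gamma>" if "\<gamma> \<in> G" "x - a < \<gamma>" for \<gamma>
    using D(3)[of "\<gamma> + a"] G(1)[OF that(1) a] that(2) by (auto simp: diff_less_eq diff_le_eq)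
  have "(\<lambda>\<gamma>. \<gamma> - a) ` C \<subseteq> {\<gamma>\<in>G. \<gamma> < x - a}" "(\<lambda>\<gamma>. \<gamma> - a) ` D \<subseteq> {\<gamma>\<in>G. \<gamma> > x - a}"
    using C(2) D(2) G' by auto
  moreover have "countable ((\<lambda>\<gamma>. \<gamma> - a) ` C)" "countable ((\<lambda>\<gamma>. \<gamma> - a) ` D)" using C(1) D(1) by auto
  ultimately show ?thesis
    by (intro countable_type_overI[OF 1 _ _ 2 _ _ 3])
qed

text \<open>The size of \<open>e + \<mu>\<close> lies between half and twice that of
  \<open>\<mu>\<close>, so the third axiom applies in both directions.\<close>

lemma H_couple_perturb:
  assumes \<psi>: "H_couple \<psi>" and nz: "\<mu> \<noteq> 0" "e + \<mu> \<noteq> 0" and e: "0 < e" "e \<le> (1 / 2) *\<^sub>R \<bar>\<mu>\<bar>"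
  shows "\<psi> (e + \<mu>) = \<psi> \<mu>"
proof (rule antisym)
  have half: "(1 / 2) *\<^sub>R \<bar>\<mu>\<bar> + (1 / 2) *\<^sub>R \<bar>\<mu>\<bar> = \<bar>\<mu>\<bar>"
    using scaleR_left.add[of "1 / 2" "1 / 2" "\<bar>\<mu>\<bar>"] by simp
  have abs_e: "\<bar>e\<bar> = e" using e(1) by (simp add: abs_of_pos)
  have "(1 / 2) *\<^sub>R \<bar>\<mu>\<bar> \<le> 1 *\<^sub>R \<bar>\<mu>\<bar>" by (rule scaleR_right_mono) auto
  then have "e \<le> \<bar>\<mu>\<bar>" using order_trans[OF e(2)] by simp
  then have "\<bar>e + \<mu>\<bar> \<le> \<bar>\<mu>\<bar> + \<bar>\<mu>\<bar>"
    using order_trans[OF abs_triangle_ineq[of e \<mu>] add_right_mono[of "\<bar>e\<bar>" "\<bar>\<mu>\<bar>" "\<bar>\<mu>\<bar>"]] abs_e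
    by simp
  then have "\<bar>e + \<mu>\<bar> \<le> 2 *\<^sub>R \<bar>\<mu>\<bar>" unfolding scaleR_2 .
  then show "\<psi> \<mu> \<le> \<psi> (e + \<mu>)"
    by (rule H_couple_antimono[OF \<psi> nz(2,1) zero_less_numeral])
  have "\<bar>(e + \<mu>) + - e\<bar> \<le> \<bar>e + \<mu>\<bar> + \<bar>- e\<bar>" by (rule abs_triangle_ineq)
  then have "\<bar>\<mu>\<bar> \<le> \<bar>e + \<mu>\<bar> + e" using abs_e by simp
  also have "\<dots> \<le> \<bar>e + \<mu>\<bar> + (1 / 2) *\<^sub>R \<bar>\<mu>\<bar>" using e(2) by (rule add_left_mono)
  finally have "(1 / 2) *\<^sub>R \<bar>\<mu>\<bar> + (1 / 2) *\<^sub>R \<bar>\<mu>\<bar> \<le> \<bar>e + \<mu>\<bar> + (1 / 2) *\<^sub>R \<bar>\<mu>\<bar>"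
    unfolding half .
  then have "(1 / 2) *\<^sub>R \<bar>\<mu>\<bar> \<le> \<bar>e + \<mu>\<bar>" by (rule add_le_imp_le_right)
  then have "2 *\<^sub>R (1 / 2) *\<^sub>R \<bar>\<mu>\<bar> \<le> 2 *\<^sub>R \<bar>e + \<mu>\<bar>" by (rule scaleR_left_mono) simp
  then have "\<bar>\<mu>\<bar> \<le> 2 *\<^sub>R \<bar>e + \<mu>\<bar>" unfolding scaleR_scaleR by simp
  then show "\<psi> (e + \<mu>) \<le> \<psi> \<mu>"
    by (rule H_couple_antimono[OF \<psi> nz zero_less_numeral])
qed

context hardy_H_couple
begin

text \<open>On positive elements \<open>\<psi>\<close> is decreasing, and on the positive part of
  \<open>G\<close> it attains all elements of \<open>G\<close> that are at most 0. Hence the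
  countable sets on the two sides of \<open>\<bar>x\<bar>\<close> are carried to countable sets on
  the opposite sides of \<open>\<psi> x\<close>.\<close>

lemma countable_type_over_psi:
  assumes x: "countable_type_over G x" and \<psi>x: "\<psi> x < 0" "\<psi> x \<notin> G"
  shows "countable_type_over G (\<psi> x)"
proof -
  have "countable_type_over G \<bar>x\<bar>"
    using x countable_type_over_uminus[OF x G_uminus] by (simp add: abs_if)
  moreover have "\<psi> \<bar>x\<bar> = \<psi> x" using couple by (rule H_couple_abs)
  moreover have "x \<noteq> 0" using x G_zero by (auto simp: countable_type_over_def)
  ultimately obtain y where y: "countable_type_over G y" "0 < y" "\<psi> y = \<psi> x"
    by (intro that[of "\<bar>x\<bar>"]) auto
  note cp = H_couple_antimono_abs[OF couple]
  obtain C D where C: "countable C" "C \<subseteq> {\<gamma>\<in>G. \<gamma> < y}" "\<And>\<gamma>. \<gamma> \<in> G \<Longrightarrow> \<gamma> < y \<Longrightarrow> \<exists>\<delta>\<in>C. \<gamma> \<le> \<delta>"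
    and D: "countable D" "D \<subseteq> {\<gamma>\<in>G. \<gamma> > y}" "\<And>\<gamma>. \<gamma> \<in> G \<Longrightarrow> y < \<gamma> \<Longrightarrow> \<exists>\<delta>\<in>D. \<delta> \<le> \<gamma>"
    using y(1) by (rule countable_type_overE) blast
  have yG: "y \<notin> G" using y(1) by (simp add: countable_type_over_def)
  have ne: "\<psi> \<delta> \<noteq> \<psi> x" if "\<delta> \<in> G" "\<delta> \<noteq> 0" for \<delta> using psi_mem[OF that] \<psi>x(2) by auto
  have D': "\<psi> ` D \<subseteq> {\<gamma>\<in>G. \<gamma> < \<psi> x}"
  proof clarify
    fix \<delta> assume "\<delta> \<in> D"
    then have \<delta>: "\<delta> \<in> G" "y < \<delta>" using D(2) by auto
    then have "\<psi> \<delta> \<le> \<psi> y" using cp[of y \<delta>] y(2) by simp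
    moreover have "\<delta> \<noteq> 0" using \<delta> y(2) by auto
    ultimately show "\<psi> \<delta> \<in> G \<and> \<psi> \<delta> < \<psi> x"
      using y(3) ne[OF \<delta>(1)] psi_mem[OF \<delta>(1)] by simp
  qed
  have D'': "\<exists>\<delta>\<in>\<psi> ` D. \<gamma> \<le> \<delta>" if \<gamma>: "\<gamma> \<in> G" "\<gamma> < \<psi> x" for \<gamma>
  proof -
    have "\<gamma> \<le> 0" using \<gamma> \<psi>x(1) by simp
    then obtain \<delta> where \<delta>: "\<delta> \<in> G" "0 < \<delta>" "\<psi> \<delta> = \<gamma>" using psi_surj[OF \<gamma>(1)] by blast
    have "y < \<delta>"
    proof (rule ccontr)
      assume "\<not> y < \<delta>"
      then have "\<psi> y \<le> \<psi> \<delta>" using cp[of \<delta> y] \<delta> y by simp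
      then show False using \<delta> \<gamma> y by simp
    qed
    then obtain c where c: "c \<in> D" "c \<le> \<delta>" using D(3) \<delta> by blast
    then have "y < c" using D(2) by auto
    then have "\<psi> \<delta> \<le> \<psi> c" using cp[of c \<delta>] c y \<delta> by simp
    then show ?thesis using c \<delta> by auto
  qed
  \<comment> \<open>The element 0 takes care of the nonnegative \<open>\<gamma>\<close>, for which
    \<open>psi_surj\<close> gives no preimage except at 0.\<close>
  let ?C = "insert 0 (\<psi> ` (C \<inter> {0<..}))"
  have C': "?C \<subseteq> {\<gamma>\<in>G. \<gamma> > \<psi> x}"
  proof -
    have "\<psi> \<delta> \<in> G \<and> \<psi> x < \<psi> \<delta>" if "\<delta> \<in> C" "0 < \<delta>" for \<delta>
    proof -
      have \<delta>: "\<delta> \<in> G" "\<delta> < y" using C(2) that by auto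
      then have "\<psi> y \<le> \<psi> \<delta>" using cp[of \<delta> y] y(2) that by simp
      then show ?thesis
        using y(3) ne[OF \<delta>(1)] psi_mem[OF \<delta>(1)] that(2) by (auto simp: less_le)
    qed
    then show ?thesis using G_zero \<psi>x by auto
  qed
  have C'': "\<exists>\<delta>\<in>?C. \<delta> \<le> \<gamma>" if \<gamma>: "\<gamma> \<in> G" "\<psi> x < \<gamma>" for \<gamma>
  proof (cases "0 \<le> \<gamma>")
    case False
    then have "\<gamma> \<le> 0" by simp
    then obtain \<delta> where \<delta>: "\<delta> \<in> G" "0 < \<delta>" "\<psi> \<delta> = \<gamma>" using psi_surj[OF \<gamma>(1)] by blast
    have "\<delta> < y"
    proof (rule ccontr)
      assume "\<not> \<delta> < y"
      then have "\<psi> \<delta> \<le> \<psi> y" using cp[of y \<delta>] \<delta> y by simp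
      then show False using \<delta> \<gamma> y by simp
    qed
    then obtain c where c: "c \<in> C" "\<delta> \<le> c" using C(3) \<delta> by blast
    then have "\<psi> c \<le> \<psi> \<delta>" using cp[of \<delta> c] \<delta> by simp
    then show ?thesis using c \<delta> by auto
  qed auto
  have "countable ?C" "countable (\<psi> ` D)" using C(1) D(1) by auto
  then show ?thesis
    by (intro countable_type_overI[OF \<psi>x(2) _ D' D'' _ C' C''])
qed

text \<open>Both \<open>\<bar>dlog f\<bar>\<close> and 1 have value above the negative
  \<open>t\<close>; if \<open>V f = 0\<close>, then \<open>\<bar>dlog f\<bar>\<close> is bounded by
  1. The summand 1 makes the bound positive even where \<open>dlog f\<close> vanishes.\<close>

lemma V_abs_dlog_plus_one_greater:
  assumes f: "f \<in> pos" and t: "t < 0" and V: "V f = 0 \<or> t < \<psi> (V f)"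
  shows "(\<lambda>x. \<bar>dlog f x\<bar> + 1) \<in> pos" "t < V (\<lambda>x. \<bar>dlog f x\<bar> + 1)"
proof -
  have one: "(\<lambda>_. 1 :: real) \<in> pos" by (rule pos_const) simp
  have "(\<lambda>x. \<bar>dlog f x\<bar> + 1) \<in> funs"
    by (intro funs_add funs_abs funs_const funs_dlog pos_funs f)
  then show K: "(\<lambda>x. \<bar>dlog f x\<bar> + 1) \<in> pos" by (simp add: pos_def add_nonneg_pos)
  have "0 \<le> V (\<lambda>x. \<bar>dlog f x\<bar> + 1)" if b: "\<forall>\<^sub>F x in at_top. \<bar>dlog f x\<bar> \<le> 1"
  proof -
    have "V (\<lambda>_. 1) \<le> V (\<lambda>x. \<bar>dlog f x\<bar> + 1)"
      by (rule V_leI[OF one K, of 2]) (use b in \<open>auto elim: eventually_mono\<close>)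
    then show ?thesis by (simp add: V_const)
  qed
  moreover have "\<psi> (V f) \<le> V (\<lambda>x. \<bar>dlog f x\<bar> + 1)"
    if nz: "V f \<noteq> 0" and b: "\<not> (\<forall>\<^sub>F x in at_top. \<bar>dlog f x\<bar> \<le> 1)"
    unfolding psi_V(2)[OF f nz]
  proof (rule V_leI[OF psi_V(1)[OF f nz] K, of 2])
    have "\<forall>\<^sub>F x in at_top. 1 < \<bar>dlog f x\<bar>"
      using b funs_linear[OF funs_abs[OF funs_dlog[OF pos_funs[OF f]]] funs_const[of 1]] by blast
    then show "\<forall>\<^sub>F x in at_top. \<bar>dlog f x\<bar> + 1 \<le> 2 * \<bar>dlog f x\<bar>" by eventually_elim simp
  qed
  ultimately show "t < V (\<lambda>x. \<bar>dlog f x\<bar> + 1)"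
    using V_zero_dlog[OF f] V t by (meson less_le_trans)
qed

lemma V_abs_dlog_plus_one_le:
  assumes f: "f \<in> pos" and V: "V f \<noteq> 0"
  shows "V (\<lambda>x. \<bar>dlog f x\<bar> + 1) \<le> \<psi> (V f)"
proof -
  have "(\<lambda>x. \<bar>dlog f x\<bar> + 1) \<in> funs"
    by (intro funs_add funs_abs funs_const funs_dlog pos_funs f)
  then have K: "(\<lambda>x. \<bar>dlog f x\<bar> + 1) \<in> pos" by (simp add: pos_def add_nonneg_pos)
  show ?thesis
    unfolding psi_V(2)[OF f V] by (rule V_leI[OF K psi_V(1)[OF f V], of 1]) simp
qed

lemma V_add_greater:
  assumes "f \<in> pos" "g \<in> pos" "t < V f" "t < V g"
  shows "t < V (\<lambda>x. f x + g x)"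
proof -
  have "min (V f) (V g) \<le> V (\<lambda>x. f x + g x)"
    using funs_linear[OF pos_funs[OF assms(1)] pos_funs[OF assms(2)]]
  proof
    assume "\<forall>\<^sub>F x in at_top. f x \<le> g x"
    then have "V g \<le> V (\<lambda>x. f x + g x)"
      by (intro V_leI[OF assms(2) pos_add[OF assms(1,2)], of 2]) (auto elim: eventually_mono)
    then show ?thesis by (simp add: min.coboundedI2)
  next
    assume "\<forall>\<^sub>F x in at_top. g x < f x"
    then have "V f \<le> V (\<lambda>x. f x + g x)"
      by (intro V_leI[OF assms(1) pos_add[OF assms(1,2)], of 2]) (auto elim: eventually_mono)
    then show ?thesis by (simp add: min.coboundedI1)
  qed
  moreover have "t < min (V f) (V g)" using assms by simp
  ultimately show ?thesis by (rule less_le_trans[rotated])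
qed

lemma V_scale:
  assumes "f \<in> pos" "0 < c" shows "(\<lambda>x. c * f x) \<in> pos" "V (\<lambda>x. c * f x) = V f"
  using pos_mult[OF pos_const[OF assms(2)] assms(1)] V_mult[OF pos_const[OF assms(2)] assms(1)]
  by (simp_all add: V_const assms)

end

locale case_b_over_hardy = hardy_H_couple H \<iota> \<psi>
  for H :: "germ set" and \<iota> :: "gval \<Rightarrow> 'g::linordered_real_vector" and \<psi> :: "'g \<Rightarrow> 'g" +
  fixes \<beta> :: 'g and a b :: "nat \<Rightarrow> 'g"
  assumes ctype: "countable_type_over (\<iota> ` value_group H) \<beta>"
    and case_b: "case_b (\<iota> ` value_group H) \<psi> \<beta> a b"
    and psi_neg: "\<psi> (b i) < 0"
begin

text \<open>The intended value of the function at level \<open>i\<close> of the ladder whose level \<open>0\<close> is to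
  realize the cut of \<open>\<beta>\<close>.\<close>

primrec q :: "nat \<Rightarrow> 'g" where
  "q 0 = \<beta>"
| "q (Suc i) = \<psi> (b i)"

section \<open>The intended values of the levels\<close>

lemma a_mem: "a i \<in> G"
  using case_b by (simp add: case_b_def G_def)

lemma b_eq: "b i = q i - a i"
  using case_b by (cases i) (simp_all add: case_b_def)

lemma b_notin: "b i \<notin> G"
proof
  assume b: "b i \<in> G"
  have *: "(\<Sum>j\<in>F. c j *\<^sub>R b j) \<in> G \<Longrightarrow> \<forall>j\<in>F. c j = 0" if "finite F" for F c
    using case_b that by (simp add: case_b_def independent_over_def G_def)
  have "\<forall>j\<in>{i}. (1::real) = 0" by (rule *[of "{i}" "\<lambda>_. 1"]) (use b in simp_all)
  then show False by simp
qed

lemma b_nonzero: "b i \<noteq> 0"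
  using b_notin[of i] G_zero by auto

lemma q_notin: "q i \<notin> G"
  using b_notin[of i] G_diff[OF _ a_mem, of "q i" i] by (auto simp: b_eq)

lemma q_neg: "q (Suc i) < 0"
  by (simp add: psi_neg)

text \<open>Otherwise \<open>\<psi> (a (Suc i))\<close> lies below
  \<open>\<psi> (q (Suc i))\<close>, so \<open>b (Suc i) = q (Suc i) - a (Suc i)\<close> has the
  same image under \<open>\<psi>\<close> as \<open>a (Suc i)\<close>. That image is in
  \<open>G\<close>, but \<open>q (Suc (Suc i))\<close> is not.\<close>

lemma psi_a_greater: assumes "a (Suc i) \<noteq> 0" shows "q (Suc i) < \<psi> (a (Suc i))"
proof (rule ccontr)
  assume "\<not> ?thesis"
  then have "\<psi> (a (Suc i)) < \<psi> (q (Suc i))"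
    using psi_greater[OF q_neg[of i]] by (meson le_less_trans not_less)
  then have "\<psi> (- a (Suc i) + q (Suc i)) = \<psi> (- a (Suc i))"
    by (intro H_couple_add_eq[OF couple]) (use assms q_neg[of i] H_couple_uminus[OF couple] in auto)
  then have "q (Suc (Suc i)) = \<psi> (a (Suc i))"
    using H_couple_uminus[OF couple] by (simp add: b_eq)
  then show False using q_notin[of "Suc (Suc i)"] psi_mem[OF a_mem assms] by simp
qed

lemma q_strict: "q (Suc i) < q (Suc (Suc i))"
proof (cases "a (Suc i) = 0")
  case True
  then show ?thesis using psi_greater[OF q_neg[of i]] by (simp add: b_eq)
next
  case False
  have "min (\<psi> (q (Suc i))) (\<psi> (- a (Suc i))) \<le> \<psi> (q (Suc i) + - a (Suc i))"
    by (rule H_couple_ultrametric[OF couple]) (use False q_neg[of i] b_nonzero[of "Suc i"] in \<open>auto simp: b_eq\<close>)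
  moreover have "q (Suc i) < min (\<psi> (q (Suc i))) (\<psi> (- a (Suc i)))"
    using psi_greater[OF q_neg[of i]] psi_a_greater[OF False] H_couple_uminus[OF couple] by simp
  ultimately have "q (Suc i) < \<psi> (q (Suc i) + - a (Suc i))" by (rule less_le_trans[rotated])
  then show ?thesis using b_eq[of "Suc i"] by simp
qed

text \<open>If \<open>\<gamma>\<close> were the largest element of \<open>G\<close> below
  \<open>q i\<close>, then \<open>e = q i - \<gamma>\<close> would be smaller than every positive
  element of \<open>G\<close>, and \<open>b i = e + \<mu>\<close> with \<open>\<mu> \<in> G\<close>.
  For \<open>\<mu> = 0\<close> smallness gives \<open>\<psi> (b i) \<ge> 0\<close>; for
  \<open>\<mu> \<noteq> 0\<close> the perturbation \<open>e\<close> has no effect and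
  \<open>\<psi> (b i) = \<psi> \<mu>\<close> is in \<open>G\<close>.\<close>

lemma density:
  assumes \<gamma>: "\<gamma> \<in> G" "\<gamma> < q i"
  shows "\<exists>\<gamma>'\<in>G. \<gamma> < \<gamma>' \<and> \<gamma>' < q i"
proof (rule ccontr)
  assume no: "\<not> ?thesis"
  define e where "e = q i - \<gamma>"
  have e: "0 < e" using \<gamma> by (simp add: e_def)
  have small: "e < \<delta>" if \<delta>: "\<delta> \<in> G" "0 < \<delta>" for \<delta>
  proof -
    have "\<gamma> + \<delta> \<in> G" using G_add \<gamma> \<delta> by blast
    then have "q i \<noteq> \<gamma> + \<delta>" "\<not> \<gamma> + \<delta> < q i" using q_notin[of i] no \<delta> by auto
    then show ?thesis by (simp add: e_def diff_less_eq add.commute not_less)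
  qed
  define \<mu> where "\<mu> = \<gamma> - a i"
  have \<mu>: "\<mu> \<in> G" using G_diff \<gamma> a_mem by (simp add: \<mu>_def)
  have be: "b i = e + \<mu>" by (simp add: b_eq e_def \<mu>_def)
  show False
  proof (cases "\<mu> = 0")
    case True
    obtain \<delta> where \<delta>: "\<delta> \<in> G" "0 < \<delta>" "\<psi> \<delta> = 0" using psi_surj[OF G_zero] by auto
    have "\<psi> \<delta> \<le> \<psi> e"
      by (rule H_couple_antimono_abs[OF couple]) (use e \<delta> small[of \<delta>] in auto)
    then show False using psi_neg[of i] be True \<delta> by simp
  next
    case False
    have half: "(1 / 2) *\<^sub>R \<bar>\<mu>\<bar> \<in> G" by (intro G_scaleR G_abs \<mu>)
    have "0 < \<bar>\<mu>\<bar>" using False by simp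
    then have "0 < (1 / 2) *\<^sub>R \<bar>\<mu>\<bar>" by (simp add: less_le scaleR_nonneg_nonneg)
    then have "e \<le> (1 / 2) *\<^sub>R \<bar>\<mu>\<bar>" using small[OF half] by (intro less_imp_le)
    then have "q (Suc i) = \<psi> \<mu>"
      using H_couple_perturb[OF couple False _ e] b_nonzero[of i] be by simp
    then show False using q_notin[of "Suc i"] psi_mem[OF \<mu> False] by simp
  qed
qed

lemma q_ctype: "countable_type_over G (q i)"
proof (induction i)
  case 0
  then show ?case using ctype by (simp add: G_def)
next
  case (Suc i)
  have "countable_type_over G (b i)"
    by (subst b_eq) (rule countable_type_over_diff[OF Suc a_mem]; use G_add G_uminus in blast)
  from countable_type_over_psi[OF this psi_neg] q_notin[of "Suc i"] show ?case by simp
qed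

section \<open>Representing functions, and transfer of constraints from one level to the
  next\<close>

definition F :: "nat \<Rightarrow> real \<Rightarrow> real" where
  "F i = (SOME f. f \<in> pos \<and> V f = a i)"

lemma F: "F i \<in> pos" "V (F i) = a i"
proof -
  have "\<exists>f. f \<in> pos \<and> V f = a i" using a_mem[of i] unfolding G_eq by auto
  from someI_ex[OF this] show "F i \<in> pos" "V (F i) = a i" by (simp_all add: F_def)
qed

text \<open>The sign of the logarithmic derivative of a positive function of value
  \<open>b i\<close>: functions of negative value grow, those of positive value decay.\<close>

definition \<epsilon> :: "nat \<Rightarrow> real" where
  "\<epsilon> i = (if b i < 0 then 1 else - 1)"

text \<open>The order of values is opposite to that of functions: if \<open>q i < V h\<close>, then
  level \<open>i\<close> has to exceed \<open>h\<close>.\<close>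

definition side :: "nat \<Rightarrow> (real \<Rightarrow> real) \<Rightarrow> real" where
  "side i h = (if q i < V h then 1 else - 1)"

lemma side_cases: "side i h \<in> {1, - 1}"
  by (simp add: side_def)

lemma V_cut: "h \<in> pos \<Longrightarrow> q i < V h \<or> V h < q i"
  using V_mem[of h] q_notin[of i] by (metis linorder_neqE)

text \<open>The quotient of level \<open>i\<close> by \<open>h\<close> should have value
  \<open>b i + V g\<close>, where \<open>g = F i / h\<close>, and its logarithmic derivative is
  \<open>dlog g + \<epsilon> i * w\<close>. The summand with the smaller \<open>\<psi>\<close>
  decides the sign of this value. If it is \<open>b i\<close>, then \<open>w\<close> has to beat
  \<open>dlog g\<close>; if it is \<open>V g\<close>, then \<open>w\<close> has to stay below.
  Either demand is a one-sided bound on \<open>w\<close>, and \<open>h'\<close> is chosen on the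
  matching side of the cut of \<open>q (Suc i)\<close>.\<close>

lemma transfer_exists:
  assumes h: "h \<in> pos"
  shows "\<exists>h'\<in>pos. \<forall>\<^sub>F x in at_top. \<forall>w>0. 0 < side (Suc i) h' * (w - h' x) \<longrightarrow>
    1 \<le> side i h * (dlog (F i) x + \<epsilon> i * w - dlog h x)"
proof -
  define g where "g = (\<lambda>x. F i x / h x)"
  have g: "g \<in> pos" unfolding g_def using F(1) h by (rule pos_divide)
  have Vg: "V g = a i - V h" unfolding g_def using V_divide[OF F(1) h] by (simp add: F)
  have dl: "\<forall>\<^sub>F x in at_top. dlog g x = dlog (F i) x - dlog h x"
    unfolding g_def using F(1) h by (rule dlog_divide)
  have side_iff: "q i < V h \<longleftrightarrow> b i + V g < 0" by (simp add: b_eq Vg)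
  have VgG: "V g \<in> G" using V_mem g by blast
  show ?thesis
  proof (cases "V g = 0 \<or> q (Suc i) < \<psi> (V g)")
    case True
    have "side i h = \<epsilon> i"
    proof (cases "V g = 0")
      case False
      then have "\<bar>V g\<bar> < \<bar>b i\<bar>"
        using H_couple_abs_less[OF couple b_nonzero] True by simp
      from abs_less_add_sign(1)[OF this] show ?thesis by (simp add: side_def side_iff \<epsilon>_def)
    qed (simp add: side_def side_iff \<epsilon>_def)
    note K = V_abs_dlog_plus_one_greater[OF g q_neg True]
    show ?thesis
    proof (rule bexI[OF _ K(1)])
      have sd: "side (Suc i) (\<lambda>x. \<bar>dlog g x\<bar> + 1) = 1" using K(2) by (simp add: side_def)
      show "\<forall>\<^sub>F x in at_top. \<forall>w>0. 0 < side (Suc i) (\<lambda>x. \<bar>dlog g x\<bar> + 1) * (w - (\<bar>dlog g x\<bar> + 1)) \<longrightarrow>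
          1 \<le> side i h * (dlog (F i) x + \<epsilon> i * w - dlog h x)"
        using dl
      proof eventually_elim
        case (elim x)
        have "dlog (F i) x + \<epsilon> i * w - dlog h x = dlog g x + \<epsilon> i * w" for w using elim by simp
        then show ?case unfolding sd \<open>side i h = \<epsilon> i\<close> by (auto simp: \<epsilon>_def)
      qed
    qed
  next
    case False
    then have nz: "V g \<noteq> 0" by simp
    have less: "\<psi> (V g) < q (Suc i)"
      using False psi_mem[OF VgG nz] q_notin[of "Suc i"] by (metis linorder_neqE)
    then have abs: "\<bar>b i\<bar> < \<bar>V g\<bar>"
      using H_couple_abs_less[OF couple nz b_nonzero] by simp
    have sgn: "side i h = (if V g < 0 then 1 else - 1)"
      using abs_less_add_sign(1)[OF abs] by (simp add: side_def side_iff add.commute)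
    have dg: "\<forall>\<^sub>F x in at_top. 0 < side i h * dlog g x"
      using V_neg_dlog[OF g] V_pos_dlog[OF g] nz sgn by auto
    \<comment> \<open>A bound by half of \<open>\<bar>dlog g\<bar>\<close> leaves the other half for
      the slope, and this is at least 1 because \<open>\<bar>dlog g\<bar>\<close>, having negative
      value, eventually exceeds 2.\<close>
    note K = V_scale[OF psi_V(1)[OF g nz], of "1 / 2"]
    have "V (\<lambda>x. \<bar>dlog g x\<bar>) < 0"
      using less q_neg[of i] psi_V(2)[OF g nz] by simp
    from V_less_zeroD[OF psi_V(1)[OF g nz] this, of 2]
    have big: "\<forall>\<^sub>F x in at_top. 2 < \<bar>dlog g x\<bar>" .
    show ?thesis
    proof (rule bexI[OF _ K(1)])
      have sd: "side (Suc i) (\<lambda>x. 1 / 2 * \<bar>dlog g x\<bar>) = - 1"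
        using less K(2) psi_V(2)[OF g nz] by (simp add: side_def)
      show "\<forall>\<^sub>F x in at_top. \<forall>w>0. 0 < side (Suc i) (\<lambda>x. 1 / 2 * \<bar>dlog g x\<bar>) * (w - 1 / 2 * \<bar>dlog g x\<bar>) \<longrightarrow>
          1 \<le> side i h * (dlog (F i) x + \<epsilon> i * w - dlog h x)"
        using dl dg big
      proof eventually_elim
        case (elim x)
        have eq: "dlog (F i) x + \<epsilon> i * w - dlog h x = dlog g x + \<epsilon> i * w" for w using elim(1) by simp
        show ?case
        proof (intro allI impI)
          fix w :: real assume w: "0 < w"
            "0 < side (Suc i) (\<lambda>x. 1 / 2 * \<bar>dlog g x\<bar>) * (w - 1 / 2 * \<bar>dlog g x\<bar>)"
          then have "w < 1 / 2 * \<bar>dlog g x\<bar>" unfolding sd by simp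
          moreover have "side i h * dlog g x = \<bar>dlog g x\<bar>"
            using elim(2) side_cases[of i h] by auto
          moreover have "- w \<le> side i h * (\<epsilon> i * w)"
            using side_cases[of i h] w(1) by (auto simp: \<epsilon>_def)
          ultimately show "1 \<le> side i h * (dlog (F i) x + \<epsilon> i * w - dlog h x)"
            unfolding eq distrib_left using elim(3) by linarith
        qed
      qed
    qed simp
  qed
qed

definition star :: "nat \<Rightarrow> (real \<Rightarrow> real) \<Rightarrow> real \<Rightarrow> real" where
  "star i h = (SOME h'. h' \<in> pos \<and> (\<forall>\<^sub>F x in at_top. \<forall>w>0. 0 < side (Suc i) h' * (w - h' x) \<longrightarrow>
    1 \<le> side i h * (dlog (F i) x + \<epsilon> i * w - dlog h x)))"

lemma star:
  assumes "h \<in> pos"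
  shows "star i h \<in> pos" "\<forall>\<^sub>F x in at_top. \<forall>w>0. 0 < side (Suc i) (star i h) * (w - star i h x) \<longrightarrow>
    1 \<le> side i h * (dlog (F i) x + \<epsilon> i * w - dlog h x)"
  using someI_ex[OF transfer_exists[OF assms, of i, unfolded Bex_def]] by (simp_all add: star_def)

lemma cut_basis_exists:
  "\<exists>d. \<forall>k::nat. d k \<in> pos \<and> (\<forall>\<gamma>\<in>G. \<exists>k. (q i < \<gamma> \<longrightarrow> q i < V (d k) \<and> V (d k) \<le> \<gamma>) \<and>
    (\<gamma> < q i \<longrightarrow> V (d k) < q i \<and> \<gamma> \<le> V (d k)))"
proof -
  obtain C D where C: "countable C" "C \<subseteq> {\<gamma>\<in>G. \<gamma> < q i}" "\<And>\<gamma>. \<gamma> \<in> G \<Longrightarrow> \<gamma> < q i \<Longrightarrow> \<exists>\<delta>\<in>C. \<gamma> \<le> \<delta>"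
    and D: "countable D" "D \<subseteq> {\<gamma>\<in>G. \<gamma> > q i}" "\<And>\<gamma>. \<gamma> \<in> G \<Longrightarrow> q i < \<gamma> \<Longrightarrow> \<exists>\<delta>\<in>D. \<delta> \<le> \<gamma>"
    using q_ctype[of i] by (rule countable_type_overE) blast
  \<comment> \<open>One enumeration serves both sides of the cut, as \<open>side\<close> recovers
    the side of each member. The element 0 makes \<open>E\<close> visibly nonempty, as
    \<open>from_nat_into\<close> requires.\<close>
  define E where "E = insert 0 (C \<union> D)"
  have E: "countable E" "E \<noteq> {}" "E \<subseteq> G" using C D G_zero by (auto simp: E_def)
  have "\<exists>f. \<forall>\<gamma>\<in>E. f \<gamma> \<in> pos \<and> V (f \<gamma>) = \<gamma>"
    by (rule bchoice) (use E(3) in \<open>auto simp: G_eq\<close>)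
  then obtain f where f: "\<And>\<gamma>. \<gamma> \<in> E \<Longrightarrow> f \<gamma> \<in> pos \<and> V (f \<gamma>) = \<gamma>" by blast
  define d where "d k = f (from_nat_into E k)" for k
  have mem: "from_nat_into E k \<in> E" for k using E(2) by (rule from_nat_into)
  have sur: "\<exists>k. V (d k) = \<delta>" if "\<delta> \<in> E" for \<delta>
    using from_nat_into_surj[OF E(1) that] f[OF that] by (auto simp: d_def)
  show ?thesis
  proof (intro exI[of _ d] allI conjI ballI)
    show "d k \<in> pos" for k using f mem by (simp add: d_def)
    fix \<gamma> assume \<gamma>: "\<gamma> \<in> G"
    show "\<exists>k. (q i < \<gamma> \<longrightarrow> q i < V (d k) \<and> V (d k) \<le> \<gamma>) \<and> (\<gamma> < q i \<longrightarrow> V (d k) < q i \<and> \<gamma> \<le> V (d k))"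
    proof (cases "q i < \<gamma>")
      case True
      then obtain \<delta> where \<delta>: "\<delta> \<in> D" "\<delta> \<le> \<gamma>" using D(3) \<gamma> by blast
      then obtain k where "V (d k) = \<delta>" using sur[of \<delta>] by (auto simp: E_def)
      then show ?thesis using \<delta> D(2) True by (intro exI[of _ k]) auto
    next
      case False
      then have "\<gamma> < q i" using \<gamma> q_notin[of i] by (metis linorder_neqE)
      then obtain \<delta> where \<delta>: "\<delta> \<in> C" "\<gamma> \<le> \<delta>" using C(3) \<gamma> by blast
      then obtain k where "V (d k) = \<delta>" using sur[of \<delta>] by (auto simp: E_def)
      then show ?thesis using \<delta> C(2) False by (intro exI[of _ k]) auto
    qed
  qed
qed

definition cut_basis :: "nat \<Rightarrow> nat \<Rightarrow> real \<Rightarrow> real" where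
  "cut_basis i = (SOME d. \<forall>k::nat. d k \<in> pos \<and> (\<forall>\<gamma>\<in>G. \<exists>k. (q i < \<gamma> \<longrightarrow> q i < V (d k) \<and> V (d k) \<le> \<gamma>) \<and>
    (\<gamma> < q i \<longrightarrow> V (d k) < q i \<and> \<gamma> \<le> V (d k))))"

lemma cut_basis_pos: "cut_basis i k \<in> pos"
  and cut_basis_above: "\<gamma> \<in> G \<Longrightarrow> q i < \<gamma> \<Longrightarrow> \<exists>k. q i < V (cut_basis i k) \<and> V (cut_basis i k) \<le> \<gamma>"
  and cut_basis_below: "\<gamma> \<in> G \<Longrightarrow> \<gamma> < q i \<Longrightarrow> \<exists>k. V (cut_basis i k) < q i \<and> \<gamma> \<le> V (cut_basis i k)"
  using someI_ex[OF cut_basis_exists[of i]] unfolding cut_basis_def by blast+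

section \<open>The finite families of constraints\<close>

definition K :: "nat \<Rightarrow> real \<Rightarrow> real" where
  "K i x = \<bar>dlog (F i) x\<bar> + 1"

lemma K_pos: "K i \<in> pos"
proof -
  have "K i \<in> funs"
    unfolding K_def [abs_def] by (intro funs_add funs_abs funs_const funs_dlog pos_funs F)
  then show ?thesis by (simp add: pos_def K_def add_nonneg_pos)
qed

lemma K_greater: "q (Suc i) < V (K (Suc i))"
  unfolding K_def [abs_def]
  by (rule V_abs_dlog_plus_one_greater[OF F(1) q_neg]) (use psi_a_greater in \<open>auto simp: F\<close>)

text \<open>Here \<open>\<psi> (b (Suc i)) < V (K (Suc i)) \<le> \<psi> (a (Suc i))\<close> if
  \<open>a (Suc i) \<noteq> 0\<close>. So \<open>b (Suc i)\<close> outweighs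
  \<open>a (Suc i)\<close> and has the sign of their sum \<open>q (Suc i)\<close>, which is
  negative.\<close>

lemma \<epsilon>_eq_one:
  assumes "q (Suc (Suc i)) < V (K (Suc i))"
  shows "\<epsilon> (Suc i) = 1"
proof (cases "a (Suc i) = 0")
  case True
  then show ?thesis using q_neg[of i] by (simp add: \<epsilon>_def b_eq)
next
  case False
  have "V (K (Suc i)) \<le> \<psi> (a (Suc i))"
    using V_abs_dlog_plus_one_le[OF F(1), of "Suc i"] False by (simp add: K_def [abs_def] F)
  then have "\<psi> (b (Suc i)) < \<psi> (a (Suc i))" using assms by simp
  then have "\<bar>a (Suc i)\<bar> < \<bar>b (Suc i)\<bar>"
    by (rule H_couple_abs_less[OF couple b_nonzero False])
  from abs_less_add_sign(1)[OF this] q_neg[of i] have "b (Suc i) < 0" by (simp add: b_eq)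
  then show ?thesis by (simp add: \<epsilon>_def)
qed

text \<open>The bounds needed for the two alternatives of \<open>ratio\<close>. In one,
  \<open>K i\<close> separates the levels: level \<open>i\<close> exceeds \<open>4 * K i\<close> and
  the next level, whose \<open>extras\<close> contain it as \<open>K (i - 1)\<close>, stays below
  it. The third function is the \<open>g\<close> of the other alternative. Only indices
  \<open>Suc i\<close> are used, so \<open>i - 1\<close> is never truncated.\<close>

definition extras :: "nat \<Rightarrow> (real \<Rightarrow> real) set" where
  "extras i = {\<lambda>x. 4 * K i x, K (i - 1), \<lambda>x. 4 * K (i - 1) x + 4 * K i x}"

lemma extras_pos: "extras i \<subseteq> pos"
  using V_scale(1)[OF K_pos, of 4] K_pos by (auto simp: extras_def intro: pos_add)

text \<open>Closed under \<open>star\<close> from one level to the next, so every constraint is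
  protected by a constraint on the following level. Each stage admits one more member of every
  \<open>cut_basis\<close>; the sets stay finite, and their union over \<open>N\<close> is cofinal
  in every cut.\<close>

primrec bounds :: "nat \<Rightarrow> nat \<Rightarrow> (real \<Rightarrow> real) set" where
  "bounds N 0 = cut_basis 0 ` {..N}"
| "bounds N (Suc i) = star i ` bounds N i \<union> cut_basis (Suc i) ` {..N} \<union> extras (Suc i)"

lemma bounds_pos: "bounds N i \<subseteq> pos"
  by (induction i) (use cut_basis_pos star(1) extras_pos in auto)

lemma finite_bounds: "finite (bounds N i)"
  by (induction i) (auto simp: extras_def)

lemma bounds_mono: "bounds N i \<subseteq> bounds (Suc N) i"
  by (induction i) auto

lemma cut_basis_bounds: "cut_basis i k \<in> bounds k i"
  by (cases i) auto

end

section \<open>Top levels of the ladder\<close>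

text \<open>Averaging over \<open>{x..x + 1}\<close> lies between \<open>u (x + 1)\<close> and
  \<open>u x\<close>. As \<open>u\<close> will be a step function, the first average
  \<open>P1\<close> is only continuous; averaging again gives a differentiable \<open>P\<close> with
  derivative \<open>P1 (x + 1) - P1 x\<close>, which is bounded below by
  \<open>- u x\<close>.\<close>

lemma twice_averaged_antimono:
  fixes u :: "real \<Rightarrow> real"
  assumes anti: "\<And>x y. x \<le> y \<Longrightarrow> u y \<le> u x" and pos: "\<And>x. 0 < u x" and le1: "\<And>x. u x \<le> 1"
  obtains P P' :: "real \<Rightarrow> real" where
    "\<And>x. 0 < x \<Longrightarrow> 0 < P x \<and> P x \<le> u x \<and> (P has_real_derivative P' x) (at x) \<and> - 1 \<le> P' x"
proof -
  have int_u: "u integrable_on {x..y}" for x y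
  proof -
    have "(\<lambda>x. - u x) integrable_on {x..y}"
      by (rule integrable_on_mono_on) (auto simp: mono_on_def anti)
    then show ?thesis using integrable_neg_iff by blast
  qed
  define I where "I x = integral {0..x} u" for x
  define P1 where "P1 x = I (x + 1) - I x" for x
  have P1: "P1 x = integral {x..x + 1} u" if "0 \<le> x" for x
    using Henstock_Kurzweil_Integration.integral_combine[OF that, of "x + 1" u] int_u
    by (simp add: P1_def I_def)
  have P1_bounds: "u (x + 1) \<le> P1 x" "P1 x \<le> u x" if "0 \<le> x" for x
  proof -
    have "integral {x..x + 1} (\<lambda>_. u (x + 1)) \<le> integral {x..x + 1} u"
      by (rule integral_le) (auto intro: int_u anti)
    then show "u (x + 1) \<le> P1 x" by (simp add: P1[OF that])
    have "integral {x..x + 1} u \<le> integral {x..x + 1} (\<lambda>_. u x)"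
      by (rule integral_le) (auto intro: int_u anti)
    then show "P1 x \<le> u x" by (simp add: P1[OF that])
  qed
  have I_cont: "continuous_on {0..} I"
  proof (rule continuous_on_subset[of "\<Union>n::nat. {..<real n} \<inter> {0..}"])
    show "{0..} \<subseteq> (\<Union>n::nat. {..<real n} \<inter> {0..})"
      using reals_Archimedean2 by auto
    have "continuous_on {0..x} I" for x
      unfolding I_def [abs_def] by (rule indefinite_integral_continuous_1[OF int_u])
    then have loc: "continuous (at x within {0..}) I" if "0 \<le> x" for x
    proof -
      have "continuous (at x within {0..x + 1}) I"
        using \<open>\<And>x. continuous_on {0..x} I\<close>[of "x + 1"] that by (simp add: continuous_on_eq_continuous_within)
      moreover have "at x within {0..x + 1} = at x within {0..}"
        by (rule at_within_nhd[of x "{..<x + 1}"]) (use that in auto)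
      ultimately show ?thesis by simp
    qed
    have "(\<Union>n::nat. {..<real n} \<inter> {0..}) = {0::real..}"
      using reals_Archimedean2 by auto
    then show "continuous_on (\<Union>n::nat. {..<real n} \<inter> {0..}) I"
      using loc by (simp add: continuous_on_eq_continuous_within)
  qed
  have P1_cont: "continuous_on {0..} P1"
  proof -
    have "continuous_on {0..} (\<lambda>x. I (x + 1))"
      by (rule continuous_on_compose2[OF I_cont]) (auto intro!: continuous_intros)
    then show ?thesis unfolding P1_def [abs_def] using I_cont by (intro continuous_intros)
  qed
  have int_P1: "P1 integrable_on {x..y}" if "0 \<le> x" for x y
    by (rule integrable_continuous_interval, rule continuous_on_subset[OF P1_cont]) (use that in auto)
  define J where "J x = integral {0..x} P1" for x
  define P where "P x = J (x + 1) - J x" for x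
  have P: "P x = integral {x..x + 1} P1" if "0 \<le> x" for x
    using Henstock_Kurzweil_Integration.integral_combine[OF that, of "x + 1" P1] int_P1[of 0 "x + 1"]
    by (simp add: P_def J_def)
  have J_der: "(J has_real_derivative P1 x) (at x)" if "0 < x" for x
    using integral_has_real_derivative_atLeast[OF P1_cont, of x] at_within_interior[of x "{0..}"] that
    by (simp add: J_def [abs_def])
  have P_der: "(P has_real_derivative P1 (x + 1) - P1 x) (at x)" if "0 < x" for x
  proof -
    have "((\<lambda>x. J (x + 1)) has_real_derivative P1 (x + 1) * 1) (at x)"
      by (rule DERIV_chain2[OF J_der]) (use that in \<open>auto intro!: derivative_eq_intros\<close>)
    then show ?thesis unfolding P_def [abs_def] using J_der[OF that] by (auto intro!: DERIV_diff)
  qed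
  have "0 < P x \<and> P x \<le> u x \<and> (P has_real_derivative P1 (x + 1) - P1 x) (at x) \<and>
      - 1 \<le> P1 (x + 1) - P1 x" if x: "0 < x" for x
  proof (intro conjI P_der[OF x])
    have "integral {x..x + 1} (\<lambda>_. u (x + 2)) \<le> integral {x..x + 1} P1"
    proof (rule integral_le)
      show "u (x + 2) \<le> P1 y" if "y \<in> {x..x + 1}" for y
        using P1_bounds(1)[of y] anti[of "y + 1" "x + 2"] that x by simp
    qed (use int_P1 x in auto)
    then have "u (x + 2) \<le> P x" using P[of x] x by simp
    then show "0 < P x" using pos[of "x + 2"] by linarith
    have "integral {x..x + 1} P1 \<le> integral {x..x + 1} (\<lambda>_. u x)"
    proof (rule integral_le)
      show "P1 y \<le> u x" if "y \<in> {x..x + 1}" for y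
        using P1_bounds(2)[of y] anti[of x y] that x by simp
    qed (use int_P1 x in auto)
    then show "P x \<le> u x" using P[of x] x by simp
    show "- 1 \<le> P1 (x + 1) - P1 x"
      using P1_bounds(1)[of "x + 1"] P1_bounds(2)[of x] pos[of "x + 1 + 1"] le1[of x] x by simp
  qed
  then show ?thesis by (rule that)
qed

text \<open>The condition on \<open>Q'\<close> is harmless, as it allows \<open>Q\<close> to explode in finite time.\<close>

lemma slow_dominating_function:
  fixes f :: "nat \<Rightarrow> real \<Rightarrow> real"
  assumes mono: "\<And>k. \<exists>t. \<forall>x y. t \<le> x \<longrightarrow> x \<le> y \<longrightarrow> f k x \<le> f k y"
  obtains Q Q' :: "real \<Rightarrow> real" where
    "\<And>x. 0 < x \<Longrightarrow> 0 < Q x \<and> (Q has_real_derivative Q' x) (at x) \<and> Q' x \<le> (Q x)\<^sup>2"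
    "\<And>k. \<forall>\<^sub>F x in at_top. f k x \<le> Q x"
proof -
  \<comment> \<open>A diagonal bound: it majorizes \<open>f k\<close> at \<open>n + 1\<close> for
    all \<open>k \<le> n\<close>. As \<open>f k\<close> eventually increases, its value at the next
    integer controls it on the whole unit interval.\<close>
  define c where "c n = 1 + (\<Sum>m\<le>n. \<Sum>k\<le>m. \<bar>f k (real m + 1)\<bar>)" for n
  have c1: "1 \<le> c n" for n by (simp add: c_def sum_nonneg)
  have c_mono: "c m \<le> c n" if "m \<le> n" for m n
    unfolding c_def using that by (intro add_left_mono sum_mono2) (auto intro: sum_nonneg)
  have f_le: "f k (real n + 1) \<le> c n" if "k \<le> n" for k n
  proof -
    have "f k (real n + 1) \<le> \<bar>f k (real n + 1)\<bar>" by simp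
    also have "\<dots> \<le> (\<Sum>k\<le>n. \<bar>f k (real n + 1)\<bar>)" using that by (intro member_le_sum) auto
    also have "\<dots> \<le> (\<Sum>m\<le>n. \<Sum>k\<le>m. \<bar>f k (real m + 1)\<bar>)"
      by (rule member_le_sum[of n "{..n}" "\<lambda>m. \<Sum>k\<le>m. \<bar>f k (real m + 1)\<bar>"]) (auto intro: sum_nonneg)
    finally show ?thesis by (simp add: c_def)
  qed
  \<comment> \<open>For \<open>Q = 1 / P\<close> the inequality \<open>Q' \<le> Q * Q\<close>
    amounts to \<open>P' \<ge> - 1\<close>. So the step function is smoothed after passing to its
    reciprocal, which is bounded by 1.\<close>
  define u where "u x = 1 / c (nat \<lfloor>x\<rfloor>)" for x :: real
  have cp: "0 < c n" for n using c1[of n] by linarith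
  have u_anti: "u y \<le> u x" if "x \<le> y" for x y
    unfolding u_def using that by (intro divide_left_mono c_mono nat_mono floor_mono mult_pos_pos cp) auto
  have u_bounds: "0 < u x" "u x \<le> 1" for x using cp c1 by (simp_all add: u_def)
  obtain P P' where P: "\<And>x. 0 < x \<Longrightarrow>
      0 < P x \<and> P x \<le> u x \<and> (P has_real_derivative P' x) (at x) \<and> - 1 \<le> P' x"
    using twice_averaged_antimono[of u, OF u_anti u_bounds] by blast
  define Q Q' where "Q x = 1 / P x" and "Q' x = - P' x / (P x)\<^sup>2" for x
  show ?thesis
  proof (rule that[of Q Q'])
    fix x :: real assume x: "0 < x"
    note Px = P[OF x]
    have "(Q has_real_derivative Q' x) (at x)"
      unfolding Q_def [abs_def] Q'_def using Px
      by (auto intro!: derivative_eq_intros simp: power2_eq_square)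
    moreover have "Q' x \<le> (Q x)\<^sup>2"
    proof -
      have "- P' x / (P x)\<^sup>2 \<le> 1 / (P x)\<^sup>2" by (rule divide_right_mono) (use Px in auto)
      then show ?thesis by (simp add: Q_def Q'_def power_divide)
    qed
    ultimately show "0 < Q x \<and> (Q has_real_derivative Q' x) (at x) \<and> Q' x \<le> (Q x)\<^sup>2"
      using Px by (simp add: Q_def)
  next
    fix k
    obtain t where t: "\<And>x y. t \<le> x \<Longrightarrow> x \<le> y \<Longrightarrow> f k x \<le> f k y" using mono by blast
    show "\<forall>\<^sub>F x in at_top. f k x \<le> Q x"
      using eventually_ge_at_top[of t] eventually_gt_at_top[of 0] eventually_ge_at_top[of "real k"]
    proof eventually_elim
      case (elim x)
      have n: "k \<le> nat \<lfloor>x\<rfloor>" "x \<le> real (nat \<lfloor>x\<rfloor>) + 1" using elim by linarith+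
      have "f k x \<le> f k (real (nat \<lfloor>x\<rfloor>) + 1)" by (rule t) (use elim n in auto)
      also have "\<dots> \<le> c (nat \<lfloor>x\<rfloor>)" by (rule f_le[OF n(1)])
      also have "\<dots> \<le> Q x"
        using P[OF elim(2)] cp[of "nat \<lfloor>x\<rfloor>"] by (simp add: u_def Q_def field_simps)
      finally show ?case .
    qed
  qed
qed

context case_b_over_hardy
begin

text \<open>Level \<open>j\<close> of the ladder is level \<open>Suc j\<close> of the sequence
  \<open>q\<close>. Level 0 is left out, because \<open>\<beta>\<close>, unlike the later
  \<open>q\<close>, may have either sign; it is recovered by a last integration.\<close>

definition strips :: "nat \<Rightarrow> nat \<Rightarrow> (real \<times> (real \<Rightarrow> real)) set" where
  "strips N j = (\<lambda>h. (side (Suc j) h, h)) ` bounds N (Suc j)"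

definition tops :: "(nat \<Rightarrow> real \<Rightarrow> real) \<Rightarrow> bool" where
  "tops Z \<longleftrightarrow> (\<forall>j.
     (\<forall>\<^sub>F x in at_top. 0 < Z j x \<and> (Z j has_real_derivative deriv (Z j) x) (at x)) \<and>
     (\<forall>h\<in>bounds j (Suc j). \<forall>\<^sub>F x in at_top. 0 < side (Suc j) h * (Z j x - h x)) \<and>
     (\<forall>\<^sub>F x in at_top. deriv (Z j) x \<le> Z j x * (Z j x / 4)) \<and>
     (\<forall>\<^sub>F x in at_top. 4 * Z (Suc j) x \<le> Z j x))"

lemma finite_density:
  assumes "finite A" "A \<subseteq> G" "\<And>\<delta>. \<delta> \<in> A \<Longrightarrow> \<delta> < q i" "A \<noteq> {}"
  shows "\<exists>\<gamma>\<in>G. \<gamma> < q i \<and> (\<forall>\<delta>\<in>A. \<delta> < \<gamma>)"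
proof -
  have "Max A \<in> A" using assms by simp
  then obtain \<gamma> where "\<gamma> \<in> G" "Max A < \<gamma>" "\<gamma> < q i" using density[of "Max A" i] assms by blast
  moreover have "\<delta> < \<gamma>" if "\<delta> \<in> A" for \<delta>
    using Max_ge[OF assms(1) that] \<open>Max A < \<gamma>\<close> by (rule le_less_trans)
  ultimately show ?thesis by blast
qed

text \<open>By density there is an element of \<open>G\<close> below \<open>q (Suc j)\<close> and
  above the finitely many values of bounds lying below it. A function of H with this value satisfies
  all constraints of the stage. Its logarithmic derivative is small since its value is negative, and
  increasing values produce the factor 4.\<close>

lemma tops_bounded:
  assumes \<gamma>: "\<gamma> \<in> G" "\<gamma> < q 1"
  shows "\<exists>Z. tops Z"
proof -
  define A where "A j = {\<delta> \<in> V ` bounds j (Suc j). \<delta> < q (Suc j)}" for j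
  have A: "finite (A j)" "A j \<subseteq> G" "\<And>\<delta>. \<delta> \<in> A j \<Longrightarrow> \<delta> < q (Suc j)" for j
    using finite_bounds[of j "Suc j"] bounds_pos[of j "Suc j"] V_mem by (auto simp: A_def simp del: bounds.simps)
  define P where "P j z \<longleftrightarrow> z \<in> G \<and> z < q (Suc j) \<and> (\<forall>\<delta>\<in>A j. \<delta> < z)" for j z
  have "\<exists>z. P 0 z"
  proof -
    \<comment> \<open>\<open>finite_density\<close> asks for a nonempty set, and \<open>A 0\<close>
      may be empty. At later levels the previous value \<open>z\<close> is inserted instead, which
      also makes the sequence increase.\<close>
    have "\<exists>z\<in>G. z < q (Suc 0) \<and> (\<forall>\<delta>\<in>insert \<gamma> (A 0). \<delta> < z)"
      by (rule finite_density) (use A(1,2)[of 0] A(3) \<gamma> in \<open>auto simp del: q.simps\<close>)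
    then show ?thesis unfolding P_def by blast
  qed
  moreover have "\<exists>z'. P (Suc j) z' \<and> z < z'" if "P j z" for j z
  proof -
    have "z < q (Suc (Suc j))" using that q_strict[of j] unfolding P_def by (meson less_trans)
    then have "\<exists>z'\<in>G. z' < q (Suc (Suc j)) \<and> (\<forall>\<delta>\<in>insert z (A (Suc j)). \<delta> < z')"
      by (intro finite_density) (use A(1,2)[of "Suc j"] A(3) that in \<open>auto simp: P_def simp del: q.simps\<close>)
    then show ?thesis unfolding P_def by blast
  qed
  ultimately obtain z where z: "\<And>j. P j (z j)" "\<And>j. z j < z (Suc j)"
    using dependent_nat_choice[of P "\<lambda>_. (<)"] by blast
  have "\<forall>j. \<exists>f. f \<in> pos \<and> V f = z j"
  proof
    fix j
    have "z j \<in> V ` pos" using z(1)[of j] by (simp add: P_def G_eq)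
    then show "\<exists>f. f \<in> pos \<and> V f = z j" by auto
  qed
  from choice[OF this] obtain Z where Z: "\<And>j. Z j \<in> pos" "\<And>j. V (Z j) = z j" by blast
  have Vq: "V (Z j) < q (Suc j)" for j using z(1)[of j] Z by (simp add: P_def)
  have V0: "V (Z j) < 0" for j using Vq[of j] q_neg[of j] by (rule less_trans)
  have "tops Z"
    unfolding tops_def
  proof (intro allI conjI ballI)
    fix j
    show "\<forall>\<^sub>F x in at_top. 0 < Z j x \<and> (Z j has_real_derivative deriv (Z j) x) (at x)"
      using pos_eventually[OF Z(1)] eventually_deriv[OF pos_funs[OF Z(1)]] by eventually_elim simp
    show "\<forall>\<^sub>F x in at_top. deriv (Z j) x \<le> Z j x * (Z j x / 4)"
      using dlog_small[OF Z(1) V0, of 4 j] pos_eventually[OF Z(1)[of j]]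
    proof eventually_elim
      case (elim x)
      then have "deriv (Z j) x / Z j x \<le> Z j x / 4" unfolding dlog_def by linarith
      then show ?case using elim by (simp add: divide_le_eq mult.commute)
    qed
    have "V (Z j) < V (Z (Suc j))" using z(2) Z by simp
    from V_lessD[OF Z(1) Z(1) this, of 4]
    show "\<forall>\<^sub>F x in at_top. 4 * Z (Suc j) x \<le> Z j x" by eventually_elim simp
    fix h assume h: "h \<in> bounds j (Suc j)"
    then have hp: "h \<in> pos" using bounds_pos by blast
    show "\<forall>\<^sub>F x in at_top. 0 < side (Suc j) h * (Z j x - h x)"
      using V_cut[OF hp, of "Suc j"]
    proof
      assume less: "q (Suc j) < V h"
      then have "V (Z j) < V h" using Vq[of j] by (meson less_trans)
      from V_lessD[OF Z(1) hp this, of 1] less show ?thesis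
        by (simp add: side_def del: q.simps)
    next
      assume less: "V h < q (Suc j)"
      then have "V h < V (Z j)" using h z(1)[of j] Z by (simp add: P_def A_def)
      moreover have "side (Suc j) h = - 1" using less by (auto simp: side_def simp del: q.simps)
      ultimately show ?thesis using V_lessD[OF hp Z(1), of j 1] by simp
    qed
  qed
  then show ?thesis by blast
qed

text \<open>If \<open>q (Suc i)\<close> lies below \<open>G\<close>, then so does
  \<open>b (Suc i)\<close>, and its absolute value exceeds all of \<open>G\<close>. Hence
  \<open>\<psi> (b (Suc i))\<close> is at most every \<open>\<psi> \<delta>\<close>, and these
  exhaust the elements of \<open>G\<close> up to 0.\<close>

lemma q_below_all:
  assumes "\<forall>\<gamma>\<in>G. q 1 < \<gamma>" "\<gamma> \<in> G"
  shows "q (Suc i) < \<gamma>"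
  using assms(2)
proof (induction i arbitrary: \<gamma>)
  case 0
  then show ?case using assms(1) by simp
next
  case (Suc i)
  show ?case
  proof (cases "\<gamma> \<le> 0")
    case True
    then obtain \<delta> where \<delta>: "\<delta> \<in> G" "0 < \<delta>" "\<psi> \<delta> = \<gamma>" using psi_surj[OF Suc.prems] by blast
    have "q (Suc i) < a (Suc i) - \<delta>" by (rule Suc.IH[OF G_diff[OF a_mem \<delta>(1)]])
    then have "\<delta> < - b (Suc i)" unfolding b_eq[of "Suc i"] by (simp add: algebra_simps)
    also have "\<dots> \<le> \<bar>b (Suc i)\<bar>" by (rule abs_ge_minus_self)
    finally have "\<bar>\<delta>\<bar> \<le> \<bar>b (Suc i)\<bar>" using \<delta> by simp
    then have "\<psi> (b (Suc i)) \<le> \<psi> \<delta>"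
      by (intro H_couple_antimono_abs[OF couple]) (use \<delta> b_nonzero in auto)
    moreover have "\<psi> (b (Suc i)) \<noteq> \<gamma>" using q_notin[of "Suc (Suc i)"] Suc.prems by auto
    ultimately show ?thesis using \<delta> by simp
  next
    case False
    then have "0 < \<gamma>" by simp
    with q_neg[of "Suc i"] show ?thesis by (rule less_trans)
  qed
qed

lemma pos_eventually_mono:
  assumes f: "f \<in> pos" "V f < 0"
  shows "\<exists>t. \<forall>x y. t \<le> x \<longrightarrow> x \<le> y \<longrightarrow> f x \<le> f y"
proof -
  from eventually_conj[OF pos_deriv[OF f(1)] V_neg_dlog[OF f]] obtain t where
    t: "\<And>x. t \<le> x \<Longrightarrow> (0 < f x \<and> (f has_real_derivative f x * dlog f x) (at x)) \<and> 0 < dlog f x"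
    by (rule eventually_at_topE) blast
  have "f x \<le> f y" if "t \<le> x" "x \<le> y" for x y
  proof (rule DERIV_nonneg_imp_nondecreasing[OF that(2)])
    fix s assume "x \<le> s" "s \<le> y"
    then show "\<exists>y. (f has_real_derivative y) (at s) \<and> 0 \<le> y"
      using t[of s] that by (intro exI[of _ "f s * dlog f s"]) (auto intro: less_imp_le)
  qed
  then show ?thesis by blast
qed

lemma cube_le_exp: "0 \<le> u \<Longrightarrow> (u / 3) ^ 3 \<le> exp (u::real)"
  by (rule order_trans[OF power_mono[of "u / 3" "1 + u / 3" 3]])
    (use exp_ge_one_plus_x_over_n_power_n[of 3 u] in auto)

text \<open>All bounds are lower bounds here, and \<open>cut_basis 1\<close> is coinitial in
  \<open>G\<close>. A function \<open>Q\<close> dominating this sequence dominates all of H. The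
  functions \<open>exp (Q / 4 ^ j)\<close> still do so, decrease quickly with \<open>j\<close>, and
  absorb the quadratic bound on the derivative of \<open>Q\<close>.\<close>

lemma tops_unbounded:
  assumes unb: "\<forall>\<gamma>\<in>G. q 1 < \<gamma>"
  shows "\<exists>Z. tops Z"
proof -
  obtain \<delta>0 where \<delta>0: "\<delta>0 \<in> G" "0 < \<delta>0" using psi_surj[OF G_zero] by auto
  then obtain E where E: "E \<in> pos" "V E = - \<delta>0" using G_uminus[of \<delta>0] unfolding G_eq by auto
  \<comment> \<open>Entries of nonnegative value need not increase eventually and are replaced by
    \<open>E\<close>. What remains is still coinitial.\<close>
  define f where "f k = (if V (cut_basis 1 k) < 0 then cut_basis 1 k else E)" for k
  have f: "f k \<in> pos" "V (f k) < 0" for k using cut_basis_pos E \<delta>0 by (auto simp: f_def)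
  obtain Q Q' where Q: "\<And>x. 0 < x \<Longrightarrow> 0 < Q x \<and> (Q has_real_derivative Q' x) (at x) \<and> Q' x \<le> (Q x)\<^sup>2"
    and fQ: "\<And>k. \<forall>\<^sub>F x in at_top. f k x \<le> Q x"
    using slow_dominating_function[of f] pos_eventually_mono[OF f] by blast
  have Q_dom: "\<forall>\<^sub>F x in at_top. C * h x \<le> Q x" if h: "h \<in> pos" for h C
  proof -
    \<comment> \<open>Strictly below both \<open>V h\<close> and 0. The basis member with value at
      most \<open>\<gamma>\<close> therefore survives in \<open>f\<close> and exceeds every multiple
      of \<open>h\<close>.\<close>
    define \<gamma> where "\<gamma> = - \<bar>V h\<bar> - \<delta>0"
    have \<gamma>: "\<gamma> \<in> G" unfolding \<gamma>_def using V_mem[OF h] \<delta>0 by (intro G_diff G_uminus G_abs)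
    have "\<gamma> < - \<bar>V h\<bar>" using \<delta>0 by (simp add: \<gamma>_def)
    moreover have "- \<bar>V h\<bar> \<le> V h" by (metis abs_ge_minus_self minus_le_iff)
    ultimately have \<gamma>h: "\<gamma> < V h" "\<gamma> < 0" by (auto intro: less_le_trans)
    obtain k where k: "V (cut_basis 1 k) \<le> \<gamma>" using cut_basis_above[OF \<gamma>] unb \<gamma> by blast
    have fk: "f k = cut_basis 1 k" using le_less_trans[OF k \<gamma>h(2)] by (simp add: f_def)
    have "V (f k) < V h" unfolding fk using k \<gamma>h by simp
    from V_lessD[OF f(1) h this, of C] fQ[of k] show ?thesis by eventually_elim simp
  qed
  define Z where "Z j x = exp (Q x / 4 ^ j)" for j :: nat and x
  have Z_dom: "\<forall>\<^sub>F x in at_top. h x < Z j x" if h: "h \<in> pos" for h j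
    using Q_dom[OF h, of "4 ^ j"]
  proof eventually_elim
    case (elim x)
    then have "h x \<le> Q x / 4 ^ j" by (simp add: field_simps)
    also have "\<dots> < exp (Q x / 4 ^ j)" using exp_ge_add_one_self[of "Q x / 4 ^ j"] by linarith
    finally show ?case by (simp add: Z_def)
  qed
  have Q_large: "\<forall>\<^sub>F x in at_top. C \<le> Q x" for C
    using Q_dom[OF pos_const[of 1], of C] by simp
  have Z_der: "(Z j has_real_derivative Z j x * (Q' x / 4 ^ j)) (at x)" if "0 < x" for j x
    unfolding Z_def [abs_def] using Q[OF that] by (auto intro!: derivative_eq_intros)
  have "tops Z"
    unfolding tops_def
  proof (intro allI conjI ballI)
    fix j
    show "\<forall>\<^sub>F x in at_top. 0 < Z j x \<and> (Z j has_real_derivative deriv (Z j) x) (at x)"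
      using eventually_gt_at_top[of 0]
    proof eventually_elim
      case (elim x)
      then show ?case using Z_der[OF elim, of j] by (simp add: DERIV_imp_deriv) (simp add: Z_def)
    qed
    show "\<forall>\<^sub>F x in at_top. deriv (Z j) x \<le> Z j x * (Z j x / 4)"
      \<comment> \<open>Here 108 is \<open>4 * 3 ^ 3\<close>: the cubic lower bound for
        \<open>exp u / 4\<close> is \<open>u ^ 3 / 108\<close>, and it majorizes
        \<open>4 ^ j * u ^ 2\<close> as soon as \<open>u = Q / 4 ^ j\<close> is at least
        \<open>108 * 4 ^ j\<close>.\<close>
      using eventually_gt_at_top[of 0] Q_large[of "108 * 4 ^ j * 4 ^ j"]
    proof eventually_elim
      case (elim x)
      define u where "u = Q x / 4 ^ j"
      have u: "108 * 4 ^ j \<le> u" using elim(2) by (simp add: u_def field_simps)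
      have Qu: "Q x = 4 ^ j * u" by (simp add: u_def)
      have u0: "0 < u" using Q[OF elim(1)] by (simp add: u_def)
      have "Q' x / 4 ^ j \<le> (Q x)\<^sup>2 / 4 ^ j" using Q[OF elim(1)] by (intro divide_right_mono) auto
      also have "\<dots> = 4 ^ j * u\<^sup>2" by (simp add: Qu power2_eq_square)
      also have "\<dots> \<le> (u / 108) * u\<^sup>2" using u by (intro mult_right_mono) auto
      also have "\<dots> = (u / 3) ^ 3 / 4" by (simp add: power2_eq_square power3_eq_cube)
      also have "\<dots> \<le> exp u / 4" using cube_le_exp[of u] u0 by simp
      finally have "Q' x / 4 ^ j \<le> Z j x / 4" by (simp add: Z_def u_def)
      then have "Z j x * (Q' x / 4 ^ j) \<le> Z j x * (Z j x / 4)"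
        by (intro mult_left_mono) (auto simp: Z_def)
      then show ?case using DERIV_imp_deriv[OF Z_der[OF elim(1), of j]] by simp
    qed
    show "\<forall>\<^sub>F x in at_top. 4 * Z (Suc j) x \<le> Z j x"
      using Q_large[of "4 * 4 ^ j"]
    proof eventually_elim
      case (elim x)
      define u where "u = Q x / 4 ^ Suc j"
      have u: "1 \<le> u" using elim by (simp add: u_def field_simps)
      have "4 \<le> exp (3 * u)" using exp_ge_add_one_self[of "3 * u"] u by linarith
      then have "4 * exp u \<le> exp (3 * u) * exp u" by (intro mult_right_mono) auto
      also have "\<dots> = exp (Q x / 4 ^ j)" by (simp add: u_def flip: exp_add)
      finally show ?case by (simp add: Z_def u_def)
    qed
    fix h assume "h \<in> bounds j (Suc j)"
    then have h: "h \<in> pos" using bounds_pos by blast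
    have "side (Suc j) h = 1"
      using q_below_all[OF unb V_mem[OF h], of j] by (simp add: side_def)
    then show "\<forall>\<^sub>F x in at_top. 0 < side (Suc j) h * (Z j x - h x)"
      using Z_dom[OF h, of j] by simp
  qed
  then show ?thesis by blast
qed

lemma tops_exists: "\<exists>Z. tops Z"
proof (cases "\<forall>\<gamma>\<in>G. q 1 < \<gamma>")
  case False
  then obtain \<gamma> where "\<gamma> \<in> G" "\<not> q 1 < \<gamma>" by blast
  moreover have "\<gamma> \<noteq> q 1" using \<open>\<gamma> \<in> G\<close> q_notin[of 1] by auto
  ultimately have "\<gamma> < q 1" by simp
  with \<open>\<gamma> \<in> G\<close> show ?thesis by (rule tops_bounded)
qed (rule tops_unbounded)

text \<open>The alternatives of \<open>ratio\<close> correspond to the position of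
  \<open>V (K (Suc j))\<close> relative to \<open>q (Suc (Suc j))\<close>. Below the cut,
  \<open>K (Suc j)\<close> exceeds level \<open>Suc (Suc j)\<close>, while
  \<open>4 * K (Suc j)\<close> stays below level \<open>Suc j\<close>. Above the cut, the
  logarithmic derivatives of the \<open>F\<close> are small against level
  \<open>Suc (Suc j)\<close>, and \<open>\<epsilon> (Suc j) = 1\<close>.\<close>

lemma ladder_strips:
  assumes "tops Z"
  shows "ladder (\<lambda>j. dlog (F (Suc j))) (\<lambda>j. \<epsilon> (Suc j)) Z strips"
proof
  fix N j
  show "finite (strips N j)" using finite_bounds by (simp add: strips_def del: bounds.simps)
  show "strips N j \<subseteq> strips (Suc N) j"
    unfolding strips_def by (rule image_mono[OF bounds_mono])
  show "\<forall>\<^sub>F x in at_top. isCont (dlog (F (Suc j))) x"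
    by (intro eventually_isCont funs_dlog pos_funs F)
  show "\<forall>\<^sub>F x in at_top. 0 < Z j x \<and> (Z j has_real_derivative deriv (Z j) x) (at x)"
    using assms by (simp add: tops_def del: bounds.simps)
next
  fix \<sigma> h N j assume "(\<sigma>, h) \<in> strips N j"
  then have \<sigma>: "\<sigma> = side (Suc j) h" and hN: "h \<in> bounds N (Suc j)" by (auto simp: strips_def simp del: bounds.simps)
  have h: "h \<in> pos" using hN bounds_pos by blast
  show "\<sigma> \<in> {1, - 1}" unfolding \<sigma> by (rule side_cases)
  show "\<forall>\<^sub>F x in at_top. 0 < h x \<and> (h has_real_derivative deriv h x) (at x)"
    using pos_eventually[OF h] eventually_deriv[OF pos_funs[OF h]] by eventually_elim simp
  have st: "(side (Suc (Suc j)) (star (Suc j) h), star (Suc j) h) \<in> strips N (Suc j)"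
    unfolding strips_def bounds.simps(2)[of N "Suc j"] using hN by blast
  show "\<forall>\<^sub>F x in at_top. \<forall>w>0. (\<forall>(\<sigma>', h')\<in>strips N (Suc j). 0 < \<sigma>' * (w - h' x)) \<longrightarrow>
      1 \<le> \<sigma> * (dlog (F (Suc j)) x + \<epsilon> (Suc j) * w - deriv h x / h x)"
    using star(2)[OF h, of "Suc j"]
  proof eventually_elim
    case (elim x)
    show ?case
    proof (intro allI impI)
      fix w :: real assume w: "0 < w" "\<forall>(\<sigma>', h')\<in>strips N (Suc j). 0 < \<sigma>' * (w - h' x)"
      from bspec[OF w(2) st] have "0 < side (Suc (Suc j)) (star (Suc j) h) * (w - star (Suc j) h x)" by simp
      with elim w(1) show "1 \<le> \<sigma> * (dlog (F (Suc j)) x + \<epsilon> (Suc j) * w - deriv h x / h x)"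
        unfolding \<sigma> dlog_def[of h] by blast
    qed
  qed
next
  fix \<sigma> h N assume "(\<sigma>, h) \<in> strips N N"
  then have "\<sigma> = side (Suc N) h" "h \<in> bounds N (Suc N)" by (auto simp: strips_def simp del: bounds.simps)
  then show "\<forall>\<^sub>F x in at_top. 0 < \<sigma> * (Z N x - h x)"
    using assms unfolding tops_def by blast
next
  fix j
  have mem: "(side (Suc i) h, h) \<in> strips N i" if "h \<in> extras (Suc i)" for i h N
    using that by (simp add: strips_def)
  note K4 = V_scale[OF K_pos, of 4]
  show "(\<exists>k. \<forall>N. (1, \<lambda>x. 4 * k x) \<in> strips N j \<and> (- 1, k) \<in> strips N (Suc j)) \<or>
      \<epsilon> (Suc j) = 1 \<and> (\<exists>g. (\<forall>N. (1, g) \<in> strips N (Suc j)) \<and>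
         (\<forall>\<^sub>F x in at_top. 4 * \<bar>dlog (F (Suc j)) x\<bar> + 4 * \<bar>dlog (F (Suc (Suc j))) x\<bar> + 4 \<le> g x)) \<and>
       (\<forall>\<^sub>F x in at_top. deriv (Z (Suc j)) x \<le> Z (Suc j) x * (Z (Suc j) x / 4)) \<and>
       (\<forall>\<^sub>F x in at_top. 4 * Z (Suc j) x \<le> Z j x) \<and> \<epsilon> (Suc (Suc j)) \<in> {1, - 1}"
    using V_cut[OF K_pos, of "Suc (Suc j)" "Suc j"]
  proof
    assume less: "q (Suc (Suc j)) < V (K (Suc j))"
    let ?g = "\<lambda>x. 4 * K (Suc j) x + 4 * K (Suc (Suc j)) x"
    have "q (Suc (Suc j)) < V ?g"
      by (rule V_add_greater) (use K4 less K_greater[of "Suc j"] in \<open>simp_all del: q.simps\<close>)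
    then have "side (Suc (Suc j)) ?g = 1" by (simp add: side_def del: q.simps)
    moreover have "?g \<in> extras (Suc (Suc j))" by (simp add: extras_def)
    ultimately have "\<forall>N. (1, ?g) \<in> strips N (Suc j)" using mem[of ?g "Suc j"] by simp
    moreover have "\<forall>\<^sub>F x in at_top. 4 * \<bar>dlog (F (Suc j)) x\<bar> + 4 * \<bar>dlog (F (Suc (Suc j))) x\<bar> + 4 \<le> ?g x"
      by (simp add: K_def)
    ultimately show ?thesis
      using \<epsilon>_eq_one[OF less] assms unfolding tops_def by (intro disjI2 conjI) (blast | simp add: \<epsilon>_def)+
  next
    assume less: "V (K (Suc j)) < q (Suc (Suc j))"
    have "side (Suc j) (\<lambda>x. 4 * K (Suc j) x) = 1"
      using K4 K_greater[of j] by (simp add: side_def del: q.simps)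
    moreover have "side (Suc (Suc j)) (K (Suc j)) = - 1"
      using less by (auto simp: side_def simp del: q.simps)
    moreover have "(\<lambda>x. 4 * K (Suc j) x) \<in> extras (Suc j)" "K (Suc j) \<in> extras (Suc (Suc j))"
      by (simp_all add: extras_def)
    ultimately show ?thesis
      using mem[of "\<lambda>x. 4 * K (Suc j) x" j] mem[of "K (Suc j)" "Suc j"]
      by (intro disjI1 exI[of _ "K (Suc j)"]) simp
  qed
qed

section \<open>The ladder over H and the asymptotics of its levels\<close>

lemma ladder_solution:
  obtains W :: "nat \<Rightarrow> real \<Rightarrow> real" where
    "\<And>i. \<forall>\<^sub>F x in at_top. 0 < W i x \<and>
      (W i has_real_derivative W i x * (dlog (F i) x + \<epsilon> i * W (Suc i) x)) (at x)"
    "\<And>i. \<forall>\<^sub>F x in at_top. 4 * W (Suc (Suc i)) x \<le> W (Suc i) x"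
    "\<And>i N h. h \<in> bounds N (Suc i) \<Longrightarrow> \<forall>\<^sub>F x in at_top. 0 < side (Suc i) h * (W (Suc i) x - h x)"
proof -
  obtain Z where Z: "tops Z" using tops_exists by blast
  interpret ladder "\<lambda>j. dlog (F (Suc j))" "\<lambda>j. \<epsilon> (Suc j)" Z strips
    using Z by (rule ladder_strips)
  obtain w where w: "\<And>j. \<forall>\<^sub>F x in at_top. 0 < w j x \<and>
        (w j has_real_derivative w j x * (dlog (F (Suc j)) x + \<epsilon> (Suc j) * w (Suc j) x)) (at x)"
      "\<And>j. \<forall>\<^sub>F x in at_top. 4 * w (Suc j) x \<le> w j x"
      "\<And>j N. \<forall>(\<sigma>, h)\<in>strips N j. \<forall>\<^sub>F x in at_top. 0 < \<sigma> * (w j x - h x)"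
    using ladder_exists by blast
  have "\<forall>\<^sub>F x in at_top. isCont (\<lambda>x. dlog (F 0) x + \<epsilon> 0 * w 0 x) x"
    using w(1)[of 0] eventually_isCont[OF funs_dlog[OF pos_funs[OF F(1)[of 0]]]]
    by eventually_elim (intro continuous_intros; blast intro: DERIV_isCont)
  then obtain t where t: "\<And>x. t \<le> x \<Longrightarrow> isCont (\<lambda>x. dlog (F 0) x + \<epsilon> 0 * w 0 x) x"
    by (rule eventually_at_topE) blast
  \<comment> \<open>Any positive initial value would do: the constraints on the next level already
    drive level 0 into its cut.\<close>
  define y where "y = exp_primitive 1 t (\<lambda>x. dlog (F 0) x + \<epsilon> 0 * w 0 x)"
  have y: "\<forall>\<^sub>F x in at_top. 0 < y x \<and> (y has_real_derivative y x * (dlog (F 0) x + \<epsilon> 0 * w 0 x)) (at x)"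
    using eventually_gt_at_top[of t]
  proof eventually_elim
    case (elim x)
    have "(y has_real_derivative y x * (dlog (F 0) x + \<epsilon> 0 * w 0 x)) (at x within {t..})"
      unfolding y_def
      by (rule exp_primitive_has_derivative) (use t elim in \<open>auto intro!: continuous_at_imp_continuous_on\<close>)
    then show ?case
      using at_within_interior[of x "{t..}"] elim by (simp add: y_def exp_primitive_pos)
  qed
  show ?thesis
  proof (rule that[of "case_nat y w"])
    show "\<forall>\<^sub>F x in at_top. 0 < case_nat y w i x \<and> (case_nat y w i has_real_derivative
        case_nat y w i x * (dlog (F i) x + \<epsilon> i * case_nat y w (Suc i) x)) (at x)" for i
      by (cases i) (use w(1) y in auto)
    show "\<forall>\<^sub>F x in at_top. 4 * case_nat y w (Suc (Suc i)) x \<le> case_nat y w (Suc i) x" for i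
      using w(2) by simp
    fix i N h assume "h \<in> bounds N (Suc i)"
    then have "(side (Suc i) h, h) \<in> strips N i" unfolding strips_def by (rule imageI)
    from bspec[OF w(3) this]
    show "\<forall>\<^sub>F x in at_top. 0 < side (Suc i) h * (case_nat y w (Suc i) x - h x)" by simp
  qed
qed

lemma realization:
  obtains W :: "nat \<Rightarrow> real \<Rightarrow> real" where
    "\<And>i. \<forall>\<^sub>F x in at_top. 0 < W i x \<and>
      (W i has_real_derivative W i x * (dlog (F i) x + \<epsilon> i * W (Suc i) x)) (at x)"
    "\<And>i h. h \<in> pos \<Longrightarrow> filterlim (\<lambda>x. side i h * (ln (W i x) - ln (h x))) at_top at_top"
    "\<And>i. filterlim (\<lambda>x. ln (W (Suc i) x) - ln (W (Suc (Suc i)) x)) at_top at_top"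
proof -
  obtain W where W: "\<And>i. \<forall>\<^sub>F x in at_top. 0 < W i x \<and>
      (W i has_real_derivative W i x * (dlog (F i) x + \<epsilon> i * W (Suc i) x)) (at x)"
    and W4: "\<And>i. \<forall>\<^sub>F x in at_top. 4 * W (Suc (Suc i)) x \<le> W (Suc i) x"
    and strip: "\<And>i N h. h \<in> bounds N (Suc i) \<Longrightarrow> \<forall>\<^sub>F x in at_top. 0 < side (Suc i) h * (W (Suc i) x - h x)"
    by (rule ladder_solution) blast
  \<comment> \<open>The constraint \<open>star i h\<close> on level \<open>Suc i\<close> bounds the
    slope by 1 from below, so \<open>W i / h\<close> tends to infinity or to 0 instead of merely
    staying on one side of 1.\<close>
  have growth: "filterlim (\<lambda>x. side i h * (ln (W i x) - ln (h x))) at_top at_top"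
    if h: "h \<in> bounds N i" for i N h
  proof -
    have hp: "h \<in> pos" using h bounds_pos by blast
    have "star i h \<in> bounds N (Suc i)" using h by simp
    from star(2)[OF hp, of i] strip[OF this] W[of "Suc i"]
    have A: "\<forall>\<^sub>F x in at_top. 1 \<le> side i h * (dlog (F i) x + \<epsilon> i * W (Suc i) x - dlog h x)"
      by eventually_elim blast
    have "\<forall>\<^sub>F x in at_top. 0 < W i x / h x \<and> ((\<lambda>x. W i x / h x) has_real_derivative
        W i x / h x * (dlog (F i) x + \<epsilon> i * W (Suc i) x - dlog h x)) (at x)"
      using W[of i] pos_deriv[OF hp]
      by eventually_elim (auto intro!: derivative_eq_intros simp: field_simps)
    from log_growth[OF this A] show ?thesis
      by (rule filterlim_mono_eventually[OF _ order_refl order_refl])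
        (use W[of i] pos_eventually[OF hp] in \<open>eventually_elim; simp add: ln_div\<close>)
  qed
  have cut: "filterlim (\<lambda>x. side i h * (ln (W i x) - ln (h x))) at_top at_top" if h: "h \<in> pos" for i h
  proof -
    \<comment> \<open>A member of \<open>cut_basis\<close> lies on the same side as \<open>h\<close>
      but no farther from the cut. In terms of functions this costs a multiplicative constant, hence
      an additive constant after taking logarithms.\<close>
    obtain k C where k: "side i (cut_basis i k) = side i h"
      and C: "\<forall>\<^sub>F x in at_top. side i h * (ln (W i x) - ln (cut_basis i k x)) \<le>
        side i h * (ln (W i x) - ln (h x)) + C"
      using V_cut[OF h, of i]
    proof
      assume less: "q i < V h"
      from cut_basis_above[OF V_mem[OF h] this] obtain k where
        k: "q i < V (cut_basis i k)" "V (cut_basis i k) \<le> V h" by blast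
      then obtain C where C: "\<forall>\<^sub>F x in at_top. h x \<le> C * cut_basis i k x"
        using V_le_iff[OF cut_basis_pos h] by blast
      show ?thesis
      proof (rule that[of k "ln \<bar>C\<bar>"])
        show "side i (cut_basis i k) = side i h" using less k by (simp add: side_def)
        show "\<forall>\<^sub>F x in at_top. side i h * (ln (W i x) - ln (cut_basis i k x)) \<le>
            side i h * (ln (W i x) - ln (h x)) + ln \<bar>C\<bar>"
          using C pos_eventually[OF h] pos_eventually[OF cut_basis_pos[of i k]]
        proof eventually_elim
          case (elim x)
          then have "0 < C * cut_basis i k x" by linarith
          then have "0 < C" using elim by (simp add: zero_less_mult_iff)
          then have "ln (h x) \<le> ln \<bar>C\<bar> + ln (cut_basis i k x)"
            using elim ln_mono[of "h x" "C * cut_basis i k x"] by (simp add: ln_mult)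
          then show ?case using less by (simp add: side_def)
        qed
      qed
    next
      assume less: "V h < q i"
      from cut_basis_below[OF V_mem[OF h] this] obtain k where
        k: "V (cut_basis i k) < q i" "V h \<le> V (cut_basis i k)" by blast
      then obtain C where C: "\<forall>\<^sub>F x in at_top. cut_basis i k x \<le> C * h x"
        using V_le_iff[OF h cut_basis_pos] by blast
      have sd: "side i h = - 1" "side i (cut_basis i k) = - 1" using less k by (auto simp: side_def)
      show ?thesis
      proof (rule that[of k "ln \<bar>C\<bar>"])
        show "side i (cut_basis i k) = side i h" using sd by simp
        show "\<forall>\<^sub>F x in at_top. side i h * (ln (W i x) - ln (cut_basis i k x)) \<le>
            side i h * (ln (W i x) - ln (h x)) + ln \<bar>C\<bar>"
          using C pos_eventually[OF h] pos_eventually[OF cut_basis_pos[of i k]]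
        proof eventually_elim
          case (elim x)
          then have "0 < C * h x" by linarith
          then have "0 < C" using elim by (simp add: zero_less_mult_iff)
          then have "ln (cut_basis i k x) \<le> ln \<bar>C\<bar> + ln (h x)"
            using elim ln_mono[of "cut_basis i k x" "C * h x"] by (simp add: ln_mult)
          then show ?case using sd by simp
        qed
      qed
    qed
    have "filterlim (\<lambda>x. - C + side i h * (ln (W i x) - ln (cut_basis i k x))) at_top at_top"
      using growth[OF cut_basis_bounds[of i k]] unfolding k
      by (rule filterlim_tendsto_add_at_top[OF tendsto_const])
    moreover have "\<forall>\<^sub>F x in at_top. - C + side i h * (ln (W i x) - ln (cut_basis i k x)) \<le>
        side i h * (ln (W i x) - ln (h x))"
      using C by eventually_elim simp
    ultimately show ?thesis by (rule filterlim_at_top_mono)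
  qed
  have ratio: "filterlim (\<lambda>x. ln (W (Suc i) x) - ln (W (Suc (Suc i)) x)) at_top at_top" for i
    using V_cut[OF K_pos, of "Suc (Suc i)" "Suc i"]
  proof
    assume less: "q (Suc (Suc i)) < V (K (Suc i))"
    let ?g = "\<lambda>x. 4 * K (Suc i) x + 4 * K (Suc (Suc i)) x"
    note K4 = V_scale[OF K_pos, of 4]
    have "q (Suc (Suc i)) < V ?g"
      by (rule V_add_greater) (use K4 less K_greater[of "Suc i"] in \<open>simp_all del: q.simps\<close>)
    then have sd: "side (Suc (Suc i)) ?g = 1" by (simp add: side_def del: q.simps)
    have "?g \<in> bounds 0 (Suc (Suc i))" by (simp add: extras_def)
    from strip[OF this] have big: "\<forall>\<^sub>F x in at_top. ?g x < W (Suc (Suc i)) x" unfolding sd by simp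
    have e: "\<epsilon> (Suc i) = 1" by (rule \<epsilon>_eq_one[OF less])
    \<comment> \<open>The two terms \<open>dlog\<close> together and the level
      \<open>Suc (Suc (Suc i))\<close> each use up at most a quarter of
      \<open>W (Suc (Suc i))\<close>; the summands 1 in the \<open>K\<close> leave more than the
      required slope.\<close>
    have A: "\<forall>\<^sub>F x in at_top. 1 \<le> 1 * ((dlog (F (Suc i)) x + \<epsilon> (Suc i) * W (Suc (Suc i)) x) -
        (dlog (F (Suc (Suc i))) x + \<epsilon> (Suc (Suc i)) * W (Suc (Suc (Suc i))) x))"
      using big W4[of "Suc i"] W[of "Suc (Suc (Suc i))"]
    proof eventually_elim
      case (elim x)
      have "\<epsilon> (Suc (Suc i)) * W (Suc (Suc (Suc i))) x \<le> W (Suc (Suc (Suc i))) x"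
        using elim(3) by (simp add: \<epsilon>_def)
      then show ?case
        using elim(1,2) conjunct1[OF elim(3)] abs_ge_minus_self[of "dlog (F (Suc i)) x"]
          abs_ge_self[of "dlog (F (Suc (Suc i))) x"] unfolding e K_def mult_1 distrib_left by linarith
    qed
    have "\<forall>\<^sub>F x in at_top. 0 < W (Suc i) x / W (Suc (Suc i)) x \<and>
        ((\<lambda>x. W (Suc i) x / W (Suc (Suc i)) x) has_real_derivative W (Suc i) x / W (Suc (Suc i)) x *
        ((dlog (F (Suc i)) x + \<epsilon> (Suc i) * W (Suc (Suc i)) x) -
        (dlog (F (Suc (Suc i))) x + \<epsilon> (Suc (Suc i)) * W (Suc (Suc (Suc i))) x))) (at x)"
      using W[of "Suc i"] W[of "Suc (Suc i)"]
      by eventually_elim (auto intro!: derivative_eq_intros simp: field_simps)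
    from log_growth[OF this A] show ?thesis
      by (rule filterlim_mono_eventually[OF _ order_refl order_refl])
        (use W[of "Suc i"] W[of "Suc (Suc i)"] in \<open>eventually_elim; simp add: ln_div\<close>)
  next
    assume less: "V (K (Suc i)) < q (Suc (Suc i))"
    then have sd: "side (Suc (Suc i)) (K (Suc i)) = - 1" by (auto simp: side_def simp del: q.simps)
    have sd': "side (Suc i) (K (Suc i)) = 1" using K_greater[of i] by (simp add: side_def del: q.simps)
    have "filterlim (\<lambda>x. (ln (W (Suc i) x) - ln (K (Suc i) x)) +
        (ln (K (Suc i) x) - ln (W (Suc (Suc i)) x))) at_top at_top"
      using cut[OF K_pos, of "Suc i" "Suc i"] cut[OF K_pos, of "Suc (Suc i)" "Suc i"]
      unfolding sd sd' by (intro filterlim_at_top_add_at_top) simp_all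
    then show ?thesis by simp
  qed
  show ?thesis by (rule that[of W]) (use W cut ratio in auto)
qed

end

section \<open>Adjoining a ladder to a Hardy field\<close>

text \<open>The relation o of Landau, written without a quotient so that zeros of \<open>g\<close>
  do no harm.\<close>

definition negligible :: "(real \<Rightarrow> real) \<Rightarrow> (real \<Rightarrow> real) \<Rightarrow> bool" where
  "negligible f g \<longleftrightarrow> (\<forall>C. \<forall>\<^sub>F x in at_top. C * \<bar>f x\<bar> \<le> \<bar>g x\<bar>)"

lemma negligible_trans:
  assumes "negligible f g" "negligible g h" shows "negligible f h"
  unfolding negligible_def
proof
  fix C
  have "\<forall>\<^sub>F x in at_top. C * \<bar>f x\<bar> \<le> \<bar>g x\<bar>" "\<forall>\<^sub>F x in at_top. 1 * \<bar>g x\<bar> \<le> \<bar>h x\<bar>"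
    using assms unfolding negligible_def by blast+
  then show "\<forall>\<^sub>F x in at_top. C * \<bar>f x\<bar> \<le> \<bar>h x\<bar>" by eventually_elim simp
qed

lemma negligible_ln:
  fixes f g :: "real \<Rightarrow> real"
  assumes pos: "\<forall>\<^sub>F x in at_top. 0 < f x" "\<forall>\<^sub>F x in at_top. 0 < g x"
    and lim: "filterlim (\<lambda>x. ln (g x) - ln (f x)) at_top at_top"
  shows "negligible f g"
  unfolding negligible_def
proof
  fix C :: real
  have "\<forall>\<^sub>F x in at_top. ln (\<bar>C\<bar> + 1) \<le> ln (g x) - ln (f x)"
    using lim unfolding filterlim_at_top by blast
  with pos show "\<forall>\<^sub>F x in at_top. C * \<bar>f x\<bar> \<le> \<bar>g x\<bar>"
  proof eventually_elim
    case (elim x)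
    then have "ln ((\<bar>C\<bar> + 1) * f x) \<le> ln (g x)" by (simp add: ln_mult)
    then have "(\<bar>C\<bar> + 1) * f x \<le> g x" using elim by (subst (asm) ln_le_cancel_iff) auto
    moreover have "C * f x \<le> (\<bar>C\<bar> + 1) * f x" using elim by (intro mult_right_mono) auto
    ultimately have "C * f x \<le> g x" by (rule order_trans[rotated])
    then show ?case using elim by simp
  qed
qed

lemma negligible_sum:
  assumes "finite E" "\<And>M. M \<in> E \<Longrightarrow> negligible (f M) g"
  shows "negligible (\<lambda>x. \<Sum>M\<in>E. f M x) g"
  using assms
proof (induction E rule: finite_induct)
  case empty
  then show ?case by (simp add: negligible_def)
next
  case (insert N E)
  show ?case
    unfolding negligible_def
  proof
    fix C
    have "negligible (f N) g" "negligible (\<lambda>x. \<Sum>M\<in>E. f M x) g" using insert by auto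
    then have "\<forall>\<^sub>F x in at_top. (2 * \<bar>C\<bar>) * \<bar>f N x\<bar> \<le> \<bar>g x\<bar>"
      "\<forall>\<^sub>F x in at_top. (2 * \<bar>C\<bar>) * \<bar>\<Sum>M\<in>E. f M x\<bar> \<le> \<bar>g x\<bar>"
      unfolding negligible_def by blast+
    then show "\<forall>\<^sub>F x in at_top. C * \<bar>\<Sum>M\<in>insert N E. f M x\<bar> \<le> \<bar>g x\<bar>"
    proof eventually_elim
      case (elim x)
      have "C * \<bar>\<Sum>M\<in>insert N E. f M x\<bar> \<le> \<bar>C\<bar> * \<bar>\<Sum>M\<in>insert N E. f M x\<bar>"
        by (intro mult_right_mono) auto
      also have "\<dots> \<le> \<bar>C\<bar> * (\<bar>f N x\<bar> + \<bar>\<Sum>M\<in>E. f M x\<bar>)"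
        using insert(1,2) by (intro mult_left_mono) auto
      also have "\<dots> \<le> \<bar>g x\<bar>" using elim by (simp add: distrib_left)
      finally show ?case .
    qed
  qed
qed

lemma dominating_member:
  assumes "finite E" "E \<noteq> {}"
    and "\<And>M N. M \<in> E \<Longrightarrow> N \<in> E \<Longrightarrow> M \<noteq> N \<Longrightarrow> negligible (f M) (f N) \<or> negligible (f N) (f M)"
  shows "\<exists>N\<in>E. \<forall>M\<in>E - {N}. negligible (f M) (f N)"
  using assms
proof (induction E rule: finite_ne_induct)
  case (insert L E)
  then obtain N where N: "N \<in> E" "\<forall>M\<in>E - {N}. negligible (f M) (f N)" by blast
  have "L \<noteq> N" using insert N by auto
  then have "negligible (f L) (f N) \<or> negligible (f N) (f L)" using insert.prems N by simp
  then show ?case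
  proof
    assume "negligible (f L) (f N)"
    then show ?thesis using N by (intro bexI[of _ N]) auto
  next
    assume NL: "negligible (f N) (f L)"
    have "negligible (f M) (f L)" if "M \<in> E" for M
      using N that NL negligible_trans[of "f M" "f N" "f L"] by (cases "M = N") auto
    then show ?thesis by (intro bexI[of _ L]) auto
  qed
qed simp

text \<open>The size conditions concern only the levels \<open>Suc i\<close>, since these are the
  ones that appear in logarithmic derivatives of monomials.\<close>

locale ladder_extension = liouville_closed_field H for H :: "germ set" +
  fixes X :: "nat \<Rightarrow> real \<Rightarrow> real" and \<phi> :: "nat \<Rightarrow> real \<Rightarrow> real" and \<epsilon> :: "nat \<Rightarrow> real"
  assumes X_deriv: "\<forall>\<^sub>F x in at_top. 0 < X i x \<and>
      (X i has_real_derivative X i x * (\<phi> i x + \<epsilon> i * X (Suc i) x)) (at x)"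
    and \<phi>_funs: "\<phi> i \<in> funs"
    and \<epsilon>_sign: "\<epsilon> i \<in> {1, - 1}"
    and X_cut: "h \<in> pos \<Longrightarrow> negligible h (X (Suc i)) \<or> negligible (X (Suc i)) h"
    and X_big: "negligible (\<lambda>_. 1) (X (Suc i))"
    and X_decreasing: "negligible (X (Suc (Suc i))) (X (Suc i))"
begin

text \<open>Multisets of indices encode exponent vectors of finite support in infinitely many
  variables.\<close>

definition mon :: "nat multiset \<Rightarrow> real \<Rightarrow> real" where
  "mon M x = (\<Prod>i\<in>#M. X i x)"

lemma mon_add: "mon (M + N) x = mon M x * mon N x"
  by (simp add: mon_def)

lemma X_decreasing': "i < j \<Longrightarrow> negligible (X (Suc j)) (X (Suc i))"
proof (induction j)
  case (Suc j)
  show ?case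
  proof (cases "i = j")
    case False
    then have "i < j" using Suc.prems by simp
    from negligible_trans[OF X_decreasing Suc.IH[OF this]] show ?thesis .
  qed (use X_decreasing in simp)
qed simp

lemma eventually_X_pos: "\<forall>\<^sub>F x in at_top. \<forall>i\<le>n. 0 < X i x"
proof -
  have "\<forall>\<^sub>F x in at_top. \<forall>i\<in>{..n}. 0 < X i x"
    by (intro eventually_ball_finite ballI eventually_mono[OF X_deriv]) auto
  then show ?thesis by eventually_elim simp
qed

lemma ln_mon:
  assumes "set_mset M \<subseteq> {..n}" "\<forall>i\<le>n. 0 < X i x"
  shows "0 < mon M x" "ln (mon M x) = (\<Sum>i\<le>n. real (count M i) * ln (X i x))"
proof -
  have "0 < mon M x \<and> ln (mon M x) = (\<Sum>i\<le>n. real (count M i) * ln (X i x))"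
    using assms(1)
  proof (induction M)
    case empty
    then show ?case by (simp add: mon_def)
  next
    case (add j M)
    then have j: "j \<le> n" and IH: "0 < mon M x" "ln (mon M x) = (\<Sum>i\<le>n. real (count M i) * ln (X i x))"
      by auto
    have Xj: "0 < X j x" using assms(2) j by blast
    have m: "mon (add_mset j M) x = X j x * mon M x" by (simp add: mon_def)
    have "(\<Sum>i\<le>n. real (count (add_mset j M) i) * ln (X i x)) =
        (\<Sum>i\<le>n. (if i = j then ln (X j x) else 0) + real (count M i) * ln (X i x))"
      by (rule sum.cong) (auto simp: distrib_right)
    also have "\<dots> = ln (X j x) + ln (mon M x)"
      using j by (simp add: sum.distrib IH)
    finally show ?case using m Xj IH by (simp add: ln_mult)
  qed
  then show "0 < mon M x" "ln (mon M x) = (\<Sum>i\<le>n. real (count M i) * ln (X i x))" by auto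
qed

lemma funs_sum: "finite E \<Longrightarrow> (\<And>M. M \<in> E \<Longrightarrow> c M \<in> funs) \<Longrightarrow> (\<lambda>x. \<Sum>M\<in>E. c M x) \<in> funs"
  by (induction E rule: finite_induct) (auto intro: funs_const[of 0, simplified] funs_add)

text \<open>The first level \<open>m\<close> which occurs with a nonzero coefficient governs the sum over the levels.\<close>

lemma linear_form_sign:
  assumes h: "h \<in> funs" and m: "m \<le> n" "k m \<noteq> (0::int)" "\<And>i. i < m \<Longrightarrow> k i = 0"
  shows "\<exists>\<sigma>\<in>{1, - 1}. \<forall>\<^sub>F x in at_top. 1 \<le> \<sigma> * (h x + (\<Sum>i\<le>n. real_of_int (k i) * (\<epsilon> i * X (Suc i) x)))"
proof -
  define Y where "Y = X (Suc m)"
  define s where "s = real_of_int (k m) * \<epsilon> m"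
  define r where "r = (\<lambda>x. \<Sum>i\<in>{m<..n}. real_of_int (k i) * (\<epsilon> i * X (Suc i) x))"
  have "1 \<le> \<bar>k m\<bar>" using m(2) by linarith
  then have "1 \<le> \<bar>real_of_int (k m)\<bar>" by linarith
  then have s: "1 \<le> \<bar>s\<bar>" using \<epsilon>_sign[of m] by (auto simp: s_def)
  have "(\<Sum>i\<le>n. real_of_int (k i) * (\<epsilon> i * X (Suc i) x)) = s * Y x + r x" for x
  proof -
    have "(\<Sum>i\<le>n. real_of_int (k i) * (\<epsilon> i * X (Suc i) x)) =
        (\<Sum>i\<in>{m..n}. real_of_int (k i) * (\<epsilon> i * X (Suc i) x))"
      by (rule sum.mono_neutral_right) (use m(3) in auto)
    also have "{m..n} = insert m {m<..n}" using m(1) by auto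
    finally show ?thesis by (simp add: s_def Y_def r_def mult.assoc)
  qed
  note eq = this
  have "negligible r Y"
    unfolding r_def
  proof (rule negligible_sum)
    fix i assume i: "i \<in> {m<..n}"
    show "negligible (\<lambda>x. real_of_int (k i) * (\<epsilon> i * X (Suc i) x)) Y"
      unfolding negligible_def
    proof
      fix C
      have "\<forall>\<^sub>F x in at_top. (\<bar>C\<bar> * \<bar>real_of_int (k i) * \<epsilon> i\<bar>) * \<bar>X (Suc i) x\<bar> \<le> \<bar>Y x\<bar>"
        using X_decreasing'[of m i] i unfolding negligible_def Y_def by simp
      then show "\<forall>\<^sub>F x in at_top. C * \<bar>real_of_int (k i) * (\<epsilon> i * X (Suc i) x)\<bar> \<le> \<bar>Y x\<bar>"
      proof eventually_elim
        case (elim x)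
        have "C * \<bar>real_of_int (k i) * (\<epsilon> i * X (Suc i) x)\<bar> \<le> \<bar>C\<bar> * \<bar>real_of_int (k i) * (\<epsilon> i * X (Suc i) x)\<bar>"
          by (intro mult_right_mono) auto
        also have "\<dots> = (\<bar>C\<bar> * \<bar>real_of_int (k i) * \<epsilon> i\<bar>) * \<bar>X (Suc i) x\<bar>" by (simp add: abs_mult)
        finally show ?case using elim by linarith
      qed
    qed
  qed simp
  then have r: "\<forall>\<^sub>F x in at_top. 4 * \<bar>r x\<bar> \<le> \<bar>Y x\<bar>" unfolding negligible_def by blast
  have Y2: "\<forall>\<^sub>F x in at_top. 2 * \<bar>1\<bar> \<le> \<bar>Y x\<bar>"
    using X_big[of m] unfolding negligible_def Y_def by blast
  have Y0: "\<forall>\<^sub>F x in at_top. 0 < Y x" using X_deriv[of "Suc m"] unfolding Y_def by (auto elim: eventually_mono)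
  \<comment> \<open>As \<open>Y\<close> fills a cut over H, it is never of the same order as
    \<open>h\<close>. Hence \<open>h\<close> cannot cancel the leading term \<open>s * Y\<close>,
    and one of the two determines the sign.\<close>
  have dich: "negligible h Y \<or> (\<lambda>x. \<bar>h x\<bar>) \<in> pos \<and> negligible Y h"
  proof (cases "\<forall>\<^sub>F x in at_top. h x = 0")
    case True
    have "negligible h Y"
      unfolding negligible_def by (intro allI eventually_mono[OF True]) simp
    then show ?thesis by simp
  next
    case False
    note p = pos_abs[OF h False]
    show ?thesis using X_cut[OF p, of m] p by (simp add: negligible_def Y_def)
  qed
  then show ?thesis
  proof (elim disjE conjE)
    assume "negligible h Y"
    then have "\<forall>\<^sub>F x in at_top. 4 * \<bar>h x\<bar> \<le> \<bar>Y x\<bar>" unfolding negligible_def by blast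
    with r Y2 Y0 have "\<forall>\<^sub>F x in at_top. 1 \<le> sgn s * (h x + (s * Y x + r x))"
    proof eventually_elim
      case (elim x)
      have "1 * Y x \<le> \<bar>s\<bar> * Y x" using s elim by (intro mult_right_mono) auto
      moreover have "sgn s * (s * Y x) = \<bar>s\<bar> * Y x" by (simp add: sgn_if)
      moreover have "- \<bar>h x\<bar> \<le> sgn s * h x" "- \<bar>r x\<bar> \<le> sgn s * r x" by (auto simp: sgn_if)
      ultimately show ?case unfolding distrib_left using elim by linarith
    qed
    moreover have "sgn s \<in> {1, - 1}" using s by (auto simp: sgn_if)
    ultimately show ?thesis unfolding eq by blast
  next
    assume p: "(\<lambda>x. \<bar>h x\<bar>) \<in> pos" and "negligible Y h"
    \<comment> \<open>Of the factor \<open>\<bar>s\<bar> + 2\<close>, the part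
      \<open>\<bar>s\<bar>\<close> pays for the leading term and the rest for \<open>r\<close> and
      the bound 1.\<close>
    then have Yh: "\<forall>\<^sub>F x in at_top. (\<bar>s\<bar> + 2) * \<bar>Y x\<bar> \<le> \<bar>h x\<bar>" unfolding negligible_def by blast
    have "(\<forall>\<^sub>F x in at_top. 0 < h x) \<or> (\<forall>\<^sub>F x in at_top. h x < 0)"
    proof -
      have "\<not> (\<forall>\<^sub>F x in at_top. h x = 0)"
      proof
        assume "\<forall>\<^sub>F x in at_top. h x = 0"
        with pos_eventually[OF p] have "\<forall>\<^sub>F x in at_top :: real filter. False" by eventually_elim simp
        then show False by simp
      qed
      then show ?thesis using funs_trichotomy[OF h] by blast
    qed
    then obtain \<sigma> :: real where \<sigma>: "\<sigma> \<in> {1, - 1}" "\<forall>\<^sub>F x in at_top. \<sigma> * h x = \<bar>h x\<bar>"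
    proof
      assume a: "\<forall>\<^sub>F x in at_top. 0 < h x"
      show ?thesis by (rule that[of 1]) (use a in \<open>auto elim: eventually_mono\<close>)
    next
      assume a: "\<forall>\<^sub>F x in at_top. h x < 0"
      show ?thesis by (rule that[of "- 1"]) (use a in \<open>auto elim: eventually_mono\<close>)
    qed
    have "\<forall>\<^sub>F x in at_top. 1 \<le> \<sigma> * (h x + (s * Y x + r x))"
      using Yh r Y2 Y0 \<sigma>(2)
    proof eventually_elim
      case (elim x)
      have "- (\<bar>s\<bar> * Y x) \<le> \<sigma> * (s * Y x)"
        using \<sigma>(1) elim(4) mult_right_mono[of "- \<bar>s\<bar>" s "Y x"] mult_right_mono[of "- \<bar>s\<bar>" "- s" "Y x"] by auto
      moreover have "- \<bar>r x\<bar> \<le> \<sigma> * r x" using \<sigma>(1) by auto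
      ultimately show ?case unfolding distrib_left using elim by (simp add: distrib_right)
    qed
    then show ?thesis unfolding eq using \<sigma>(1) by blast
  qed
qed

text \<open>The logarithm \<open>L\<close> of the quotient has as derivative an element of H plus a
  linear form in the levels. Distinct multisets make this form nontrivial, so the derivative is
  eventually at least 1 or at most -1, and the quotient tends to infinity or to 0.\<close>

lemma monomials_comparable:
  assumes f: "f \<in> pos" "g \<in> pos" and "M \<noteq> N"
  shows "negligible (\<lambda>x. f x * mon M x) (\<lambda>x. g x * mon N x) \<or>
    negligible (\<lambda>x. g x * mon N x) (\<lambda>x. f x * mon M x)"
proof -
  obtain n where n: "set_mset M \<union> set_mset N \<subseteq> {..n}"
    using finite_nat_set_iff_bounded_le[of "set_mset M \<union> set_mset N"] by auto
  define k where "k i = int (count M i) - int (count N i)" for i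
  define m where "m = (LEAST i. k i \<noteq> 0)"
  have "\<exists>i. k i \<noteq> 0" using \<open>M \<noteq> N\<close> by (auto simp: k_def multiset_eq_iff)
  then have m: "k m \<noteq> 0" unfolding m_def by (rule LeastI_ex)
  have below: "k i = 0" if "i < m" for i using not_less_Least[of i "\<lambda>i. k i \<noteq> 0"] that m_def by auto
  have "m \<in># M \<or> m \<in># N" using m by (auto simp: k_def simp flip: count_greater_zero_iff)
  then have mn: "m \<le> n" using n by auto
  define h where "h = (\<lambda>x. dlog f x - dlog g x + (\<Sum>i\<le>n. real_of_int (k i) * \<phi> i x))"
  have "h \<in> funs"
    unfolding h_def
    by (intro funs_add funs_diff funs_sum funs_mult funs_const funs_dlog pos_funs f \<phi>_funs) simp
  from linear_form_sign[of h m n k, OF this mn m below] obtain \<sigma> where \<sigma>: "\<sigma> \<in> {1, - 1}"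
    "\<forall>\<^sub>F x in at_top. 1 \<le> \<sigma> * (h x + (\<Sum>i\<le>n. real_of_int (k i) * (\<epsilon> i * X (Suc i) x)))" by blast
  define L where "L x = ln (f x) - ln (g x) + (\<Sum>i\<le>n. real_of_int (k i) * ln (X i x))" for x
  have "\<forall>\<^sub>F x in at_top. \<forall>i\<in>{..n}. 0 < X i x \<and>
      (X i has_real_derivative X i x * (\<phi> i x + \<epsilon> i * X (Suc i) x)) (at x)"
    by (rule eventually_ball_finite) (use X_deriv in auto)
  with pos_deriv[OF f(1)] pos_deriv[OF f(2)]
  have "\<forall>\<^sub>F x in at_top. (L has_real_derivative
      h x + (\<Sum>i\<le>n. real_of_int (k i) * (\<epsilon> i * X (Suc i) x))) (at x)"
  proof eventually_elim
    case (elim x)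
    have "((\<lambda>x. ln (X i x)) has_real_derivative \<phi> i x + \<epsilon> i * X (Suc i) x) (at x)" if "i \<le> n" for i
    proof -
      have "0 < X i x" "(X i has_real_derivative X i x * (\<phi> i x + \<epsilon> i * X (Suc i) x)) (at x)"
        using elim that by auto
      then show ?thesis by (auto intro!: derivative_eq_intros)
    qed
    then have "((\<lambda>x. \<Sum>i\<le>n. real_of_int (k i) * ln (X i x)) has_real_derivative
        (\<Sum>i\<le>n. real_of_int (k i) * (\<phi> i x + \<epsilon> i * X (Suc i) x))) (at x)"
      by (intro DERIV_sum DERIV_cmult) auto
    moreover have "((\<lambda>x. ln (f x)) has_real_derivative dlog f x) (at x)"
      "((\<lambda>x. ln (g x)) has_real_derivative dlog g x) (at x)"
      using elim by (auto intro!: derivative_eq_intros)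
    ultimately have "(L has_real_derivative dlog f x - dlog g x +
        (\<Sum>i\<le>n. real_of_int (k i) * (\<phi> i x + \<epsilon> i * X (Suc i) x))) (at x)"
      unfolding L_def [abs_def] by (intro DERIV_add DERIV_diff)
    then show ?case by (simp add: h_def distrib_left sum.distrib add.assoc)
  qed
  then have "\<forall>\<^sub>F x in at_top. 0 < exp (L x) \<and> ((\<lambda>x. exp (L x)) has_real_derivative
      exp (L x) * (h x + (\<Sum>i\<le>n. real_of_int (k i) * (\<epsilon> i * X (Suc i) x)))) (at x)"
    by eventually_elim (auto intro!: derivative_eq_intros)
  from log_growth[OF this \<sigma>(2)] have lim: "filterlim (\<lambda>x. \<sigma> * L x) at_top at_top" by simp
  have L: "\<forall>\<^sub>F x in at_top. 0 < f x * mon M x \<and> 0 < g x * mon N x \<and>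
      L x = ln (f x * mon M x) - ln (g x * mon N x)"
    using eventually_X_pos[of n] pos_eventually[OF f(1)] pos_eventually[OF f(2)]
  proof eventually_elim
    case (elim x)
    have 1: "0 < mon M x" "ln (mon M x) = (\<Sum>i\<le>n. real (count M i) * ln (X i x))"
      using ln_mon[OF _ elim(1), of M] n by auto
    have 2: "0 < mon N x" "ln (mon N x) = (\<Sum>i\<le>n. real (count N i) * ln (X i x))"
      using ln_mon[OF _ elim(1), of N] n by auto
    have "ln (mon M x) - ln (mon N x) = (\<Sum>i\<le>n. real_of_int (k i) * ln (X i x))"
      unfolding 1 2 k_def by (simp add: left_diff_distrib flip: sum_subtractf)
    then show ?case using elim 1(1) 2(1) by (simp add: L_def ln_mult)
  qed
  have "negligible v u"
    if "\<forall>\<^sub>F x in at_top. 0 < u x \<and> 0 < v x \<and> \<sigma> * L x = ln (u x) - ln (v x)" for u v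
  proof (rule negligible_ln)
    show "\<forall>\<^sub>F x in at_top. 0 < u x" "\<forall>\<^sub>F x in at_top. 0 < v x" using that by (auto elim: eventually_mono)
    show "filterlim (\<lambda>x. ln (u x) - ln (v x)) at_top at_top"
      by (rule filterlim_mono_eventually[OF lim order_refl order_refl])
        (use that in \<open>eventually_elim; simp\<close>)
  qed
  note negl = this
  show ?thesis
  proof (cases "\<sigma> = 1")
    case True
    have "negligible (\<lambda>x. g x * mon N x) (\<lambda>x. f x * mon M x)"
      by (rule negl) (use L in \<open>eventually_elim; simp add: True\<close>)
    then show ?thesis ..
  next
    case False
    then have "\<sigma> = - 1" using \<sigma> by simp
    have "negligible (\<lambda>x. f x * mon M x) (\<lambda>x. g x * mon N x)"
      by (rule negl) (use L in \<open>eventually_elim; simp add: \<open>\<sigma> = - 1\<close>\<close>)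
    then show ?thesis ..
  qed
qed

section \<open>Polynomials in the levels: zeros, ring operations and derivatives\<close>

definition polys :: "(real \<Rightarrow> real) set" where
  "polys = {p. \<exists>E c. finite E \<and> (\<forall>M\<in>E. c M \<in> funs) \<and> (\<forall>\<^sub>F x in at_top. p x = (\<Sum>M\<in>E. c M x * mon M x))}"

lemma polysI:
  "finite E \<Longrightarrow> (\<And>M. M \<in> E \<Longrightarrow> c M \<in> funs) \<Longrightarrow>
    \<forall>\<^sub>F x in at_top. p x = (\<Sum>M\<in>E. c M x * mon M x) \<Longrightarrow> p \<in> polys"
  unfolding polys_def by blast

lemma polysE:
  assumes "p \<in> polys"
  obtains E c where "finite E" "\<And>M. M \<in> E \<Longrightarrow> c M \<in> funs"
    "\<forall>\<^sub>F x in at_top. p x = (\<Sum>M\<in>E. c M x * mon M x)"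
  using assms unfolding polys_def by blast

text \<open>Terms with eventually vanishing coefficient are dropped. The others are pairwise
  comparable, so one of them is at least twice the absolute value of the sum of the rest, and
  nothing can cancel it.\<close>

lemma polys_nonzero:
  assumes p: "p \<in> polys"
  shows "(\<forall>\<^sub>F x in at_top. p x = 0) \<or> (\<forall>\<^sub>F x in at_top. p x \<noteq> 0)"
proof -
  obtain E0 c where E0: "finite E0" "\<And>M. M \<in> E0 \<Longrightarrow> c M \<in> funs"
    "\<forall>\<^sub>F x in at_top. p x = (\<Sum>M\<in>E0. c M x * mon M x)" using p by (rule polysE) blast
  define E where "E = {M \<in> E0. \<not> (\<forall>\<^sub>F x in at_top. c M x = 0)}"
  have E: "finite E" "E \<subseteq> E0" using E0 by (auto simp: E_def)
  have c: "(\<lambda>x. \<bar>c M x\<bar>) \<in> pos" if "M \<in> E" for M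
    using that E0(2) by (intro pos_abs) (auto simp: E_def)
  have "\<forall>\<^sub>F x in at_top. \<forall>M\<in>E0 - E. c M x = 0"
    by (rule eventually_ball_finite) (use E0 in \<open>auto simp: E_def\<close>)
  with E0(3) have pE: "\<forall>\<^sub>F x in at_top. p x = (\<Sum>M\<in>E. c M x * mon M x)"
  proof eventually_elim
    case (elim x)
    have "(\<Sum>M\<in>E0. c M x * mon M x) = (\<Sum>M\<in>E. c M x * mon M x)"
      by (rule sum.mono_neutral_right) (use E0 E elim in auto)
    then show ?case using elim by simp
  qed
  show ?thesis
  proof (cases "E = {}")
    case True
    then show ?thesis using pE by simp
  next
    case False
    have mon_pos: "\<forall>\<^sub>F x in at_top. 0 < mon M x" for M
    proof -
      obtain n where "set_mset M \<subseteq> {..n}"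
        using finite_nat_set_iff_bounded_le[of "set_mset M"] by auto
      from ln_mon(1)[OF this] show ?thesis by (rule eventually_mono[OF eventually_X_pos])
    qed
    have conv: "negligible (\<lambda>x. c M x * mon M x) (\<lambda>x. c N x * mon N x)"
      if "negligible (\<lambda>x. \<bar>c M x\<bar> * mon M x) (\<lambda>x. \<bar>c N x\<bar> * mon N x)" for M N
      using that unfolding negligible_def by (simp add: abs_mult)
    have "\<exists>N\<in>E. \<forall>M\<in>E - {N}. negligible (\<lambda>x. c M x * mon M x) (\<lambda>x. c N x * mon N x)"
      by (rule dominating_member[OF E(1) False]) (use monomials_comparable[OF c c] conv in blast)
    then obtain N where N: "N \<in> E" "\<And>M. M \<in> E - {N} \<Longrightarrow> negligible (\<lambda>x. c M x * mon M x) (\<lambda>x. c N x * mon N x)"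
      by blast
    have "negligible (\<lambda>x. \<Sum>M\<in>E - {N}. c M x * mon M x) (\<lambda>x. c N x * mon N x)"
      by (rule negligible_sum) (use N E in auto)
    then have "\<forall>\<^sub>F x in at_top. 2 * \<bar>\<Sum>M\<in>E - {N}. c M x * mon M x\<bar> \<le> \<bar>c N x * mon N x\<bar>"
      unfolding negligible_def by blast
    with pE mon_pos[of N] pos_eventually[OF c[OF N(1)]] have "\<forall>\<^sub>F x in at_top. p x \<noteq> 0"
    proof eventually_elim
      case (elim x)
      have "0 < \<bar>c N x * mon N x\<bar>" using elim by simp
      moreover have "p x = c N x * mon N x + (\<Sum>M\<in>E - {N}. c M x * mon M x)"
        using elim sum.remove[OF E(1) N(1), of "\<lambda>M. c M x * mon M x"] by simp
      ultimately show ?case using elim by linarith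
    qed
    then show ?thesis ..
  qed
qed

lemma polys_cong: "p \<in> polys \<Longrightarrow> \<forall>\<^sub>F x in at_top. p x = r x \<Longrightarrow> r \<in> polys"
proof (elim polysE)
  fix E c assume E: "finite E" "\<And>M. M \<in> E \<Longrightarrow> c M \<in> funs"
    and ev: "\<forall>\<^sub>F x in at_top. p x = r x" "\<forall>\<^sub>F x in at_top. p x = (\<Sum>M\<in>E. c M x * mon M x)"
  from ev have "\<forall>\<^sub>F x in at_top. r x = (\<Sum>M\<in>E. c M x * mon M x)" by eventually_elim simp
  with E show "r \<in> polys" by (rule polysI)
qed

lemma polys_term: "c \<in> funs \<Longrightarrow> (\<lambda>x. c x * mon M x) \<in> polys"
  by (rule polysI[of "{M}" "\<lambda>_. c"]) auto

lemma polys_funs: "c \<in> funs \<Longrightarrow> c \<in> polys"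
  using polys_term[of c "{#}"] by (simp add: mon_def)

lemma polys_X: "X i \<in> polys"
  using polys_term[OF funs_const[of 1], of "{#i#}"] by (simp add: mon_def)

lemma polys_add:
  assumes "p \<in> polys" "r \<in> polys" shows "(\<lambda>x. p x + r x) \<in> polys"
proof -
  obtain E c where E: "finite E" "\<And>M. M \<in> E \<Longrightarrow> c M \<in> funs"
    "\<forall>\<^sub>F x in at_top. p x = (\<Sum>M\<in>E. c M x * mon M x)" using assms(1) by (rule polysE) blast
  obtain D d where D: "finite D" "\<And>M. M \<in> D \<Longrightarrow> d M \<in> funs"
    "\<forall>\<^sub>F x in at_top. r x = (\<Sum>M\<in>D. d M x * mon M x)" using assms(2) by (rule polysE) blast
  define c' d' where "c' M = (if M \<in> E then c M else (\<lambda>_. 0))" and "d' M = (if M \<in> D then d M else (\<lambda>_. 0))" for M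
  have cd: "c' M \<in> funs" "d' M \<in> funs" for M
    using E(2) D(2) funs_const[of 0] by (auto simp: c'_def d'_def)
  show ?thesis
  proof (rule polysI[of "E \<union> D" "\<lambda>M x. c' M x + d' M x"])
    show "\<forall>\<^sub>F x in at_top. p x + r x = (\<Sum>M\<in>E \<union> D. (c' M x + d' M x) * mon M x)"
      using E(3) D(3)
    proof eventually_elim
      case (elim x)
      have "(\<Sum>M\<in>E. c M x * mon M x) = (\<Sum>M\<in>E \<union> D. c' M x * mon M x)"
        by (rule sum.mono_neutral_cong_left) (use E D in \<open>auto simp: c'_def\<close>)
      moreover have "(\<Sum>M\<in>D. d M x * mon M x) = (\<Sum>M\<in>E \<union> D. d' M x * mon M x)"
        by (rule sum.mono_neutral_cong_left) (use E D in \<open>auto simp: d'_def\<close>)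
      ultimately show ?case using elim by (simp add: distrib_right sum.distrib)
    qed
  qed (use E D cd in \<open>auto intro: funs_add\<close>)
qed

lemma polys_sum: "finite I \<Longrightarrow> (\<And>i. i \<in> I \<Longrightarrow> p i \<in> polys) \<Longrightarrow> (\<lambda>x. \<Sum>i\<in>I. p i x) \<in> polys"
  by (induction I rule: finite_induct)
    (auto intro: polys_funs[OF funs_const[of 0]] polys_add)

lemma polys_term_mult:
  assumes "c \<in> funs" "p \<in> polys" shows "(\<lambda>x. c x * mon N x * p x) \<in> polys"
proof -
  obtain E d where E: "finite E" "\<And>M. M \<in> E \<Longrightarrow> d M \<in> funs"
    "\<forall>\<^sub>F x in at_top. p x = (\<Sum>M\<in>E. d M x * mon M x)" using assms(2) by (rule polysE) blast
  have "(\<lambda>x. \<Sum>M\<in>E. (c x * d M x) * mon (N + M) x) \<in> polys"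
    using E assms(1) by (intro polys_sum polys_term funs_mult)
  moreover have "\<forall>\<^sub>F x in at_top. (\<Sum>M\<in>E. (c x * d M x) * mon (N + M) x) = c x * mon N x * p x"
    using E(3) by eventually_elim (simp add: mon_add sum_distrib_left mult_ac)
  ultimately show ?thesis by (rule polys_cong)
qed

lemma polys_mult:
  assumes "p \<in> polys" "r \<in> polys" shows "(\<lambda>x. p x * r x) \<in> polys"
proof -
  obtain E c where E: "finite E" "\<And>M. M \<in> E \<Longrightarrow> c M \<in> funs"
    "\<forall>\<^sub>F x in at_top. p x = (\<Sum>M\<in>E. c M x * mon M x)" using assms(1) by (rule polysE) blast
  have "(\<lambda>x. \<Sum>M\<in>E. c M x * mon M x * r x) \<in> polys"
    using E assms(2) by (intro polys_sum polys_term_mult)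
  moreover have "\<forall>\<^sub>F x in at_top. (\<Sum>M\<in>E. c M x * mon M x * r x) = p x * r x"
    using E(3) by eventually_elim (simp add: sum_distrib_right)
  ultimately show ?thesis by (rule polys_cong)
qed

lemma polys_diff:
  assumes "p \<in> polys" "r \<in> polys" shows "(\<lambda>x. p x - r x) \<in> polys"
  using polys_add[OF assms(1) polys_mult[OF polys_funs[OF funs_const[of "- 1"]] assms(2)]] by simp

text \<open>Differentiating \<open>X i\<close> brings in \<open>X (Suc i)\<close>. This is why all
  levels are adjoined at once: no finite part of the ladder is visibly closed under
  derivatives.\<close>

lemma mon_deriv: "\<exists>r\<in>polys. \<forall>\<^sub>F x in at_top. (mon M has_real_derivative r x) (at x)"
proof (induction M)
  case empty
  have "mon {#} = (\<lambda>_. 1)" by (simp add: mon_def fun_eq_iff)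
  then show ?case by (intro bexI[OF _ polys_funs[OF funs_const[of 0]]]) simp
next
  case (add i M)
  then obtain r where r: "r \<in> polys" "\<forall>\<^sub>F x in at_top. (mon M has_real_derivative r x) (at x)" by blast
  have eq: "mon (add_mset i M) = (\<lambda>x. X i x * mon M x)" by (simp add: mon_def fun_eq_iff)
  have m: "mon M \<in> polys" using polys_term[OF funs_const[of 1], of M] by simp
  let ?s = "\<lambda>x. X i x * (\<phi> i x + \<epsilon> i * X (Suc i) x) * mon M x + X i x * r x"
  have "?s \<in> polys"
    by (intro polys_add polys_mult polys_X m r polys_funs[OF \<phi>_funs] polys_funs[OF funs_const])
  moreover have "\<forall>\<^sub>F x in at_top. (mon (add_mset i M) has_real_derivative ?s x) (at x)"
    unfolding eq using r(2) X_deriv[of i]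
    by eventually_elim (auto intro!: derivative_eq_intros simp: algebra_simps)
  ultimately show ?case by (intro bexI[of _ ?s])
qed

lemma polys_deriv:
  assumes "p \<in> polys"
  shows "\<exists>r\<in>polys. \<forall>\<^sub>F x in at_top. (p has_real_derivative r x) (at x)"
proof -
  obtain E c where E: "finite E" "\<And>M. M \<in> E \<Longrightarrow> c M \<in> funs"
    "\<forall>\<^sub>F x in at_top. p x = (\<Sum>M\<in>E. c M x * mon M x)" using assms(1) by (rule polysE) blast
  obtain d where d: "\<And>M. d M \<in> polys" "\<And>M. \<forall>\<^sub>F x in at_top. (mon M has_real_derivative d M x) (at x)"
    using mon_deriv by metis
  let ?r = "\<lambda>x. \<Sum>M\<in>E. (deriv (c M) x * mon M x + c M x * d M x)"
  have "\<forall>\<^sub>F x in at_top. \<forall>M\<in>E. (mon M has_real_derivative d M x) (at x) \<and>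
      (c M has_real_derivative deriv (c M) x) (at x)"
    by (intro eventually_ball_finite E ballI eventually_conj d eventually_deriv)
  \<comment> \<open>Equality at large arguments holds in neighbourhoods of these, so the derivative
    of the sum is that of \<open>p\<close>.\<close>
  with germ_eventually_nhds[OF E(3)]
  have "\<forall>\<^sub>F x in at_top. (p has_real_derivative ?r x) (at x)"
  proof eventually_elim
    case (elim x)
    have "((\<lambda>x. \<Sum>M\<in>E. c M x * mon M x) has_real_derivative ?r x) (at x)"
      by (intro DERIV_sum) (use elim in \<open>auto intro!: derivative_eq_intros\<close>)
    then show ?case using elim(1) by (simp add: DERIV_cong_ev)
  qed
  moreover have "?r \<in> polys"
    using E(1,2) d(1)
    by (intro polys_sum polys_add polys_mult[OF polys_funs] polys_term funs_deriv)
  ultimately show ?thesis by (intro bexI[of _ ?r])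
qed

definition fracs :: "germ set" where
  "fracs = {abs_germ u | u. \<exists>p\<in>polys. \<exists>r\<in>polys. (\<forall>\<^sub>F x in at_top. r x \<noteq> 0) \<and> (\<forall>\<^sub>F x in at_top. u x = p x / r x)}"

lemma fracsI:
  "p \<in> polys \<Longrightarrow> r \<in> polys \<Longrightarrow> \<forall>\<^sub>F x in at_top. r x \<noteq> 0 \<Longrightarrow>
    \<forall>\<^sub>F x in at_top. u x = p x / r x \<Longrightarrow> abs_germ u \<in> fracs"
  unfolding fracs_def by blast

lemma fracsE:
  assumes "k \<in> fracs"
  obtains p r where "p \<in> polys" "r \<in> polys" "\<forall>\<^sub>F x in at_top. r x \<noteq> 0" "k = abs_germ (\<lambda>x. p x / r x)"
proof -
  obtain u p r where u: "k = abs_germ u" "p \<in> polys" "r \<in> polys" "\<forall>\<^sub>F x in at_top. r x \<noteq> 0"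
    "\<forall>\<^sub>F x in at_top. u x = p x / r x"
    using assms unfolding fracs_def by blast
  then show ?thesis by (intro that[of p r]) (auto simp: abs_germ_eq_iff)
qed

lemma polys_fracs: "p \<in> polys \<Longrightarrow> abs_germ p \<in> fracs"
  by (rule fracsI[OF _ polys_funs[OF funs_const[of 1]]]) auto

text \<open>The field axiom on inverses is where \<open>polys_nonzero\<close> enters: a numerator
  that is not eventually zero may serve as a denominator.\<close>

lemma hardy_field_fracs: "hardy_field fracs"
  unfolding hardy_field_def
proof (intro conjI ballI impI)
  show "0 \<in> fracs" unfolding zero_germ_def by (intro polys_fracs polys_funs funs_const)
  show "1 \<in> fracs" unfolding one_germ_def by (intro polys_fracs polys_funs funs_const)
next
  fix k l assume "k \<in> fracs" "l \<in> fracs"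
  then obtain p r p' r' where k: "p \<in> polys" "r \<in> polys" "\<forall>\<^sub>F x in at_top. r x \<noteq> 0" "k = abs_germ (\<lambda>x. p x / r x)"
    and l: "p' \<in> polys" "r' \<in> polys" "\<forall>\<^sub>F x in at_top. r' x \<noteq> 0" "l = abs_germ (\<lambda>x. p' x / r' x)"
    by (elim fracsE)
  have nz: "\<forall>\<^sub>F x in at_top. r x * r' x \<noteq> 0" using k(3) l(3) by eventually_elim simp
  have rr: "(\<lambda>x. r x * r' x) \<in> polys" by (intro polys_mult k l)
  show "k + l \<in> fracs"
    unfolding k(4) l(4) plus_germ.abs_eq
  proof (rule fracsI[OF _ rr nz])
    show "(\<lambda>x. p x * r' x + p' x * r x) \<in> polys" by (intro polys_add polys_mult k l)
    show "\<forall>\<^sub>F x in at_top. p x / r x + p' x / r' x = (p x * r' x + p' x * r x) / (r x * r' x)"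
      using k(3) l(3) by eventually_elim (simp add: add_frac_eq)
  qed
  show "k - l \<in> fracs"
    unfolding k(4) l(4) minus_germ.abs_eq
  proof (rule fracsI[OF _ rr nz])
    show "(\<lambda>x. p x * r' x - p' x * r x) \<in> polys" by (intro polys_diff polys_mult k l)
    show "\<forall>\<^sub>F x in at_top. p x / r x - p' x / r' x = (p x * r' x - p' x * r x) / (r x * r' x)"
      using k(3) l(3) by eventually_elim (simp add: diff_frac_eq)
  qed
  show "k * l \<in> fracs"
    unfolding k(4) l(4) times_germ.abs_eq
    by (rule fracsI[of "\<lambda>x. p x * p' x", OF _ rr nz]) (use k l in \<open>auto intro: polys_mult\<close>)
next
  fix k assume "k \<in> fracs" "k \<noteq> 0"
  then obtain p r where k: "p \<in> polys" "r \<in> polys" "\<forall>\<^sub>F x in at_top. r x \<noteq> 0" "k = abs_germ (\<lambda>x. p x / r x)"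
    by (elim fracsE)
  have "\<not> (\<forall>\<^sub>F x in at_top. p x = 0)"
  proof
    assume "\<forall>\<^sub>F x in at_top. p x = 0"
    then have "\<forall>\<^sub>F x in at_top. p x / r x = 0" by eventually_elim simp
    then show False using \<open>k \<noteq> 0\<close> k(4) abs_germ_zero_iff by blast
  qed
  then have p: "\<forall>\<^sub>F x in at_top. p x \<noteq> 0" using polys_nonzero[OF k(1)] by blast
  have "abs_germ (\<lambda>x. r x / p x) \<in> fracs" by (rule fracsI[OF k(2,1) p]) simp
  moreover have "k * abs_germ (\<lambda>x. r x / p x) = 1"
    unfolding k(4) times_germ.abs_eq one_germ_def abs_germ_eq_iff
    using p k(3) by eventually_elim simp
  ultimately show "\<exists>g\<in>fracs. k * g = 1" by blast
next
  fix k assume "k \<in> fracs"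
  then obtain p r where k: "p \<in> polys" "r \<in> polys" "\<forall>\<^sub>F x in at_top. r x \<noteq> 0" "k = abs_germ (\<lambda>x. p x / r x)"
    by (elim fracsE)
  obtain p' where p': "p' \<in> polys" "\<forall>\<^sub>F x in at_top. (p has_real_derivative p' x) (at x)"
    using polys_deriv[OF k(1)] by blast
  obtain r' where r': "r' \<in> polys" "\<forall>\<^sub>F x in at_top. (r has_real_derivative r' x) (at x)"
    using polys_deriv[OF k(2)] by blast
  have d: "\<forall>\<^sub>F x in at_top. ((\<lambda>x. p x / r x) has_real_derivative
      (p' x * r x - p x * r' x) / (r x * r x)) (at x)"
    using p'(2) r'(2) k(3) by eventually_elim (auto intro!: derivative_eq_intros)
  then have "\<forall>\<^sub>F x in at_top. (\<lambda>x. p x / r x) differentiable at x"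
    by eventually_elim (auto simp: real_differentiable_def)
  then show "germ_differentiable k" unfolding k(4) by (simp add: germ_differentiable.abs_eq)
  show "germ_deriv k \<in> fracs"
    unfolding k(4) germ_deriv.abs_eq
  proof (rule fracsI)
    show "(\<lambda>x. p' x * r x - p x * r' x) \<in> polys" by (intro polys_diff polys_mult k p' r')
    show "(\<lambda>x. r x * r x) \<in> polys" by (intro polys_mult k)
    show "\<forall>\<^sub>F x in at_top. r x * r x \<noteq> 0" using k(3) by eventually_elim simp
    show "\<forall>\<^sub>F x in at_top. deriv (\<lambda>x. p x / r x) x = (p' x * r x - p x * r' x) / (r x * r x)"
      using d by eventually_elim (rule DERIV_imp_deriv)
  qed
qed

lemma H_subset_fracs: "H \<subseteq> fracs"
proof
  fix h assume h: "h \<in> H"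
  obtain f where "h = abs_germ f" by (rule germ_exhaust)
  then show "h \<in> fracs" using h by (auto simp: funs_def intro!: polys_fracs polys_funs)
qed

end

theorem theorem9p2:
  fixes H :: "germ set"
    and \<iota> :: "gval \<Rightarrow> 'g::linordered_real_vector"
    and \<psi> :: "'g \<Rightarrow> 'g"
    and \<beta> :: 'g
    and a b :: "nat \<Rightarrow> 'g"
  assumes "Liouville_closed H"
    and "H_couple_extension H \<iota> \<psi>"
    and "countable_type_over (\<iota> ` value_group H) \<beta>"
    and "case_b (\<iota> ` value_group H) \<psi> \<beta> a b"
    and "\<forall>i. \<psi> (b i) < 0"
  shows "\<exists>K. hardy_field K \<and> H \<subseteq> K \<and>
           (\<exists>y\<in>K. y \<noteq> 0 \<and> (\<forall>\<gamma>\<in>value_group H. germ_val y < \<gamma> \<longleftrightarrow> \<beta> < \<iota> \<gamma>))"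
proof -
  interpret case_b_over_hardy H \<iota> \<psi> \<beta> a b
    using assms by unfold_locales auto
  obtain W :: "nat \<Rightarrow> real \<Rightarrow> real" where W: "\<And>i. \<forall>\<^sub>F x in at_top. 0 < W i x \<and>
      (W i has_real_derivative W i x * (dlog (F i) x + \<epsilon> i * W (Suc i) x)) (at x)"
    and cut: "\<And>i h. h \<in> pos \<Longrightarrow> filterlim (\<lambda>x. side i h * (ln (W i x) - ln (h x))) at_top at_top"
    and ratio: "\<And>i. filterlim (\<lambda>x. ln (W (Suc i) x) - ln (W (Suc (Suc i)) x)) at_top at_top"
    by (rule realization) blast
  have W_pos: "\<forall>\<^sub>F x in at_top. 0 < W i x" for i using W[of i] by eventually_elim simp
  have above: "negligible h (W i)" if "h \<in> pos" "q i < V h" for i h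
    using that(2) cut[OF that(1), of i] by (intro negligible_ln W_pos pos_eventually that) (simp add: side_def)
  have below: "negligible (W i) h" if "h \<in> pos" "V h < q i" for i h
  proof -
    have "side i h = - 1" using that(2) by (auto simp: side_def)
    then show ?thesis using cut[OF that(1), of i] by (intro negligible_ln W_pos pos_eventually that) simp
  qed
  interpret ladder_extension H W "\<lambda>i. dlog (F i)" \<epsilon>
  proof
    show "\<forall>\<^sub>F x in at_top. 0 < W i x \<and>
      (W i has_real_derivative W i x * (dlog (F i) x + \<epsilon> i * W (Suc i) x)) (at x)" for i by (rule W)
    show "dlog (F i) \<in> funs" for i by (intro funs_dlog pos_funs F)
    show "\<epsilon> i \<in> {1, - 1}" for i by (simp add: \<epsilon>_def)
    show "negligible h (W (Suc i)) \<or> negligible (W (Suc i)) h" if "h \<in> pos" for h i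
      using V_cut[OF that, of "Suc i"] above[OF that] below[OF that] by blast
    show "negligible (\<lambda>_. 1) (W (Suc i))" for i
      by (rule above) (use q_neg[of i] in \<open>auto intro: pos_const simp: V_const simp del: q.simps\<close>)
    show "negligible (W (Suc (Suc i))) (W (Suc i))" for i
      by (intro negligible_ln W_pos ratio)
  qed
  let ?y = "abs_germ (W 0)"
  have "?y \<noteq> 0"
  proof
    assume "?y = 0"
    then have "\<forall>\<^sub>F x in at_top. W 0 x = 0" by (simp add: abs_germ_zero_iff)
    with W_pos[of 0] have "\<forall>\<^sub>F x in at_top :: real filter. False" by eventually_elim simp
    then show False by simp
  qed
  moreover have "germ_val ?y < \<gamma> \<longleftrightarrow> \<beta> < \<iota> \<gamma>" if \<gamma>: "\<gamma> \<in> value_group H" for \<gamma>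
  proof -
    obtain f where f: "f \<in> pos" "\<gamma> = germ_val (abs_germ f)" using value_group_pos[OF \<gamma>] by blast
    have Vf: "\<iota> \<gamma> = V f" by (simp add: V_def f)
    note le = germ_val_pos_le_iff[OF W_pos pos_eventually[OF f(1)], of 0]
      germ_val_pos_le_iff[OF pos_eventually[OF f(1)] W_pos, of 0]
    show ?thesis
      using V_cut[OF f(1), of 0]
    proof
      assume less: "q 0 < V f"
      from above[OF f(1) less] have n: "\<forall>\<^sub>F x in at_top. C * \<bar>f x\<bar> \<le> \<bar>W 0 x\<bar>" for C
        unfolding negligible_def by blast
      have "\<forall>\<^sub>F x in at_top. f x \<le> 1 * W 0 x"
        using n[of 1] W_pos[of 0] by eventually_elim simp
      then have 1: "germ_val ?y \<le> \<gamma>" using le(1) f(2) by blast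
      have "\<not> (\<forall>\<^sub>F x in at_top. W 0 x \<le> C * f x)" for C
      \<comment> \<open>Since \<open>f\<close> is negligible against \<open>W 0\<close>, the factor
        \<open>C + 1\<close> gives \<open>(C + 1) * f \<le> W 0\<close>, which contradicts
        \<open>W 0 \<le> C * f\<close> for positive \<open>f\<close>. This makes the inequality of
        values strict.\<close>
      proof
        assume "\<forall>\<^sub>F x in at_top. W 0 x \<le> C * f x"
        with n[of "C + 1"] W_pos[of 0] pos_eventually[OF f(1)]
        have "\<forall>\<^sub>F x in at_top :: real filter. False"
          by eventually_elim (simp add: distrib_right)
        then show False by simp
      qed
      then have "\<not> \<gamma> \<le> germ_val ?y" using le(2) f(2) by blast
      with 1 show ?thesis using less Vf by (simp add: less_gval_def)
    next
      assume less: "V f < q 0"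
      from below[OF f(1) less] have n: "\<forall>\<^sub>F x in at_top. 1 * \<bar>W 0 x\<bar> \<le> \<bar>f x\<bar>"
        unfolding negligible_def by blast
      have "\<forall>\<^sub>F x in at_top. W 0 x \<le> 1 * f x"
        using n W_pos[of 0] pos_eventually[OF f(1)] by eventually_elim simp
      then have "\<gamma> \<le> germ_val ?y" using le(2) f(2) by blast
      then show ?thesis using less Vf by (auto simp: less_gval_def)
    qed
  qed
  moreover have "?y \<in> fracs" by (rule polys_fracs[OF polys_X])
  ultimately show ?thesis
    using hardy_field_fracs H_subset_fracs by blast
qed

end
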